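(* Let $\varphi:\mathbb{R}\to\mathbb{R}$ be a Borel measurable function. Assume that $a_G\le a_F$ and $F\{a_F\}=0$, that $F$ is continuous, and that (i) $\int \frac{\varphi^2}{G}\,dF<\infty$ and (ii) $\int\frac{dF}{G}<\infty$. Then, as $n\to\infty$, $$\int \varphi\,[dF_n-dF]=\int\frac{\psi(y)}{C(y)}\,[F_n^*(dy)-F^*(dy)]-\int\frac{C_n(y)-C(y)}{C^2(y)}\,\psi(y)\,F^*(dy)+o_{\mathbb{P}}(n^{-1/2}),$$ where $$\psi(y)=\varphi(y)(1-F(y))-\int_{\{y<x\}}\frac{\varphi(x)(1-F(x))}{C(x)}\,F^*(dx)=\int_{\{y<x\}}[\varphi(y)-\varphi(x)]\,F(dx).$$
   Context: Left-truncation model: $X$ and $Y$ are independent real random variables with distribution functions $F$ and $G$, and $\alpha:=\mathbb{P}(Y\le X)>0$. A pair is observed only when $Y\le X$; conditionally on the number $n$ of observed pairs, the observed data $(X_1,Y_1),\dots,(X_n,Y_n)$ are i.i.d. with joint distribution function $H^*(x,y)=\mathbb{P}(X\le x,Y\le y\mid Y\le X)=\alpha^{-1}\int_{(-\infty,x]}G(y\wedge z)\,F(dz)$. All stochastic statements refer to these i.i.d. data as $n\to\infty$. Notation: $F(z-)=\lim_{x\uparrow z}F(x)$; $F\{z\}=F(z)-F(z-)$ (similarly for other distribution functions); $a_G=\inf\{x:G(x)>0\}$, $a_F=\inf\{x:F(x)>0\}$. Further $$F^*(x)=\mathbb{P}(X\le x\mid Y\le X)=\alpha^{-1}\int_{(-\infty,x]}G(z)\,F(dz),\qquad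 C(z)=\mathbb{P}(Y\le z\le X\mid Y\le X)=\alpha^{-1}G(z)[1-F(z-)],$$ $$F_n^*(x)=\frac1n\sum_{i=1}^n\mathbf 1_{\{X_i\le x\}},\qquad C_n(z)=\frac1n\sum_{i=1}^n\mathbf 1_{\{Y_i\le z\le X_i\}}.$$ The Lynden-Bell estimator $F_n$ of $F$ is defined by $$1-F_n(x)=\prod_{\text{distinct }X_i\le x}\left[1-\frac{F_n^*\{X_i\}}{C_n(X_i)}\right],$$ the product running over the distinct values among the observed $X_i$ that are $\le x$; $\int\varphi\,dF_n$ is the corresponding finite sum $\sum\varphi(x)F_n\{x\}$ over the distinct observed values $x$. $o_{\mathbb{P}}(n^{-1/2})$ denotes a term which, multiplied by $n^{1/2}$, tends to $0$ in probability. *)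

theory Defs
  imports "HOL-Probability.Probability"
begin

text \<open>
  Integrals \<open>\<integral> f dF\<close> against a distribution function are Lebesgue-Stieltjes integrals,
  that is, integrals against \<^term>\<open>interval_measure F\<close>.
  Observations are indexed from \<open>0\<close>: a sample of size \<open>n\<close> consists of the pairs
  \<open>(x i, y i)\<close> with \<open>i < n\<close>.
\<close>

definition rv_cdf :: "'a measure \<Rightarrow> ('a \<Rightarrow> real) \<Rightarrow> real \<Rightarrow> real" where
  "rv_cdf P X = cdf (distr P borel X)"

definition jump :: "(real \<Rightarrow> real) \<Rightarrow> real \<Rightarrow> real" where
  "jump F z = F z - Lim (at_left z) F"

text \<open>Extended-real valued, since the infimum may be \<open>-\<infinity>\<close>.\<close>

definition lower_endpoint :: "(real \<Rightarrow> real) \<Rightarrow> ereal" where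
  "lower_endpoint F = (INF x\<in>{x. F x > 0}. ereal x)"

text \<open>\<open>F{a} = 0\<close> for an extended-real point \<open>a\<close>; a distribution function has no mass at \<open>\<plusminus>\<infinity>\<close>.\<close>

definition no_mass_at :: "(real \<Rightarrow> real) \<Rightarrow> ereal \<Rightarrow> bool" where
  "no_mass_at F a \<longleftrightarrow> (\<forall>z. a = ereal z \<longrightarrow> jump F z = 0)"

subsection \<open>Left truncation: \<open>X\<close> is observed together with \<open>Y\<close> only if \<open>Y \<le> X\<close>\<close>

definition trunc_alpha :: "'a measure \<Rightarrow> ('a \<Rightarrow> real) \<Rightarrow> ('a \<Rightarrow> real) \<Rightarrow> real" where
  "trunc_alpha P X Y = \<P>(\<omega> in P. Y \<omega> \<le> X \<omega>)"

definition trunc_H :: "'a measure \<Rightarrow> ('a \<Rightarrow> real) \<Rightarrow> ('a \<Rightarrow> real) \<Rightarrow> real \<Rightarrow> real \<Rightarrow> real" where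
  "trunc_H P X Y x y = \<P>(\<omega> in P. X \<omega> \<le> x \<and> Y \<omega> \<le> y \<bar> Y \<omega> \<le> X \<omega>)"

definition trunc_F :: "'a measure \<Rightarrow> ('a \<Rightarrow> real) \<Rightarrow> ('a \<Rightarrow> real) \<Rightarrow> real \<Rightarrow> real" where
  "trunc_F P X Y x = \<P>(\<omega> in P. X \<omega> \<le> x \<bar> Y \<omega> \<le> X \<omega>)"

definition trunc_C :: "'a measure \<Rightarrow> ('a \<Rightarrow> real) \<Rightarrow> ('a \<Rightarrow> real) \<Rightarrow> real \<Rightarrow> real" where
  "trunc_C P X Y z = \<P>(\<omega> in P. Y \<omega> \<le> z \<and> z \<le> X \<omega> \<bar> Y \<omega> \<le> X \<omega>)"

subsection \<open>The Lynden-Bell estimator\<close>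

definition emp_F :: "nat \<Rightarrow> (nat \<Rightarrow> real) \<Rightarrow> real \<Rightarrow> real" where
  "emp_F n x z = (1 / real n) * (\<Sum>i<n. of_bool (x i \<le> z))"

definition emp_C :: "nat \<Rightarrow> (nat \<Rightarrow> real) \<Rightarrow> (nat \<Rightarrow> real) \<Rightarrow> real \<Rightarrow> real" where
  "emp_C n x y z = (1 / real n) * (\<Sum>i<n. of_bool (y i \<le> z \<and> z \<le> x i))"

text \<open>The image \<^term>\<open>x ` {..<n}\<close> is the set of distinct observed values.\<close>

definition lynden_bell :: "nat \<Rightarrow> (nat \<Rightarrow> real) \<Rightarrow> (nat \<Rightarrow> real) \<Rightarrow> real \<Rightarrow> real" where
  "lynden_bell n x y z =
     1 - (\<Prod>u\<in>{u \<in> x ` {..<n}. u \<le> z}. 1 - jump (emp_F n x) u / emp_C n x y u)"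

definition lynden_bell_integral ::
  "nat \<Rightarrow> (nat \<Rightarrow> real) \<Rightarrow> (nat \<Rightarrow> real) \<Rightarrow> (real \<Rightarrow> real) \<Rightarrow> real" where
  "lynden_bell_integral n x y \<phi> = (\<Sum>u\<in>x ` {..<n}. \<phi> u * jump (lynden_bell n x y) u)"

subsection \<open>The terms of the expansion\<close>

definition lb_psi ::
  "(real \<Rightarrow> real) \<Rightarrow> (real \<Rightarrow> real) \<Rightarrow> (real \<Rightarrow> real) \<Rightarrow> (real \<Rightarrow> real) \<Rightarrow> real \<Rightarrow> real" where
  "lb_psi \<phi> F Fs C y =
     \<phi> y * (1 - F y) - (LINT x:{y<..}|interval_measure Fs. \<phi> x * (1 - F x) / C x)"

text \<open>
  Convergence to \<open>0\<close> in probability. Measurability is part of the definition: without it the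
  events below might fail to be measurable, and then \<^const>\<open>measure\<close> would be \<open>0\<close> by convention.
\<close>

definition tendsto_0_in_prob :: "'b measure \<Rightarrow> (nat \<Rightarrow> 'b \<Rightarrow> real) \<Rightarrow> bool" where
  "tendsto_0_in_prob M Z \<longleftrightarrow>
     (\<forall>n. Z n \<in> borel_measurable M) \<and>
     (\<forall>\<epsilon>>0. (\<lambda>n. \<P>(\<omega> in M. \<bar>Z n \<omega>\<bar> > \<epsilon>)) \<longlonglongrightarrow> 0)"

definition is_oP_inv_sqrt :: "'b measure \<Rightarrow> (nat \<Rightarrow> 'b \<Rightarrow> real) \<Rightarrow> bool" where
  "is_oP_inv_sqrt M R \<longleftrightarrow> tendsto_0_in_prob M (\<lambda>n \<omega>. sqrt (real n) * R n \<omega>)"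

subsection \<open>The product formulas for the truncated distribution\<close>

lemma interval_measure_rv_cdf:
  assumes "prob_space P" "X \<in> borel_measurable P"
  shows "interval_measure (rv_cdf P X) = distr P borel X"
proof -
  interpret D: real_distribution "distr P borel X"
    using assms by (intro prob_space.real_distribution_distr) auto
  have "interval_measure (rv_cdf P X) = distr P borel X"
  proof (rule cdf_unique)
    show "real_distribution (interval_measure (rv_cdf P X))"
      unfolding rv_cdf_def
      by (rule real_distribution_interval_measure)
         (auto intro: D.cdf_nondecreasing D.cdf_is_right_cont D.cdf_lim_at_top_prob D.cdf_lim_at_bot)
    show "real_distribution (distr P borel X)" ..
    show "cdf (interval_measure (rv_cdf P X)) = cdf (distr P borel X)"
      unfolding rv_cdf_def
      by (rule cdf_interval_measure)
         (auto intro: D.cdf_nondecreasing D.cdf_is_right_cont D.cdf_lim_at_bot)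
  qed
  then show ?thesis .
qed

lemma measure_indep_le:
  fixes A :: "real set"
  assumes P: "prob_space P" and ind: "prob_space.indep_var P borel X borel Y"
    and A[measurable]: "A \<in> sets borel" and g[measurable]: "g \<in> borel_measurable borel"
  shows "\<P>(\<omega> in P. X \<omega> \<in> A \<and> Y \<omega> \<le> g (X \<omega>)) =
    (LINT z:A|interval_measure (rv_cdf P X). rv_cdf P Y (g z))"
proof -
  interpret prob_space P by fact
  have X[measurable]: "X \<in> borel_measurable P" and Y[measurable]: "Y \<in> borel_measurable P"
    using indep_var_rv1[OF ind] indep_var_rv2[OF ind] by auto
  interpret DX: prob_space "distr P borel X" by (rule prob_space_distr) fact
  interpret DY: prob_space "distr P borel Y" by (rule prob_space_distr) fact
  interpret PP: pair_prob_space "distr P borel X" "distr P borel Y" ..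
  let ?S = "{p \<in> space (borel \<Otimes>\<^sub>M borel). fst p \<in> A \<and> snd p \<le> g (fst p)}"
  have S[measurable]: "?S \<in> sets (borel \<Otimes>\<^sub>M borel)"
  proof -
    have "{p \<in> space (borel \<Otimes>\<^sub>M borel). snd p \<le> g (fst p)} \<in> sets (borel \<Otimes>\<^sub>M borel)"
      by (rule borel_measurable_le) measurable
    moreover have "A \<times> (UNIV :: real set) \<in> sets (borel \<Otimes>\<^sub>M borel)"
      using pair_measureI[OF A, of UNIV borel] by simp
    moreover have "?S = (A \<times> UNIV) \<inter> {p \<in> space (borel \<Otimes>\<^sub>M borel). snd p \<le> g (fst p)}"
      by auto
    ultimately show ?thesis by (simp only: sets.Int)
  qed
  have "\<P>(\<omega> in P. X \<omega> \<in> A \<and> Y \<omega> \<le> g (X \<omega>))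
      = measure (distr P (borel \<Otimes>\<^sub>M borel) (\<lambda>\<omega>. (X \<omega>, Y \<omega>))) ?S"
    by (subst measure_distr[OF _ S]) (auto intro!: arg_cong[where f="measure P"] simp: space_pair_measure)
  also have "\<dots> = measure (distr P borel X \<Otimes>\<^sub>M distr P borel Y) ?S"
    using ind by (simp add: indep_var_distribution_eq)
  also have "\<dots> = (LINT p|(distr P borel X \<Otimes>\<^sub>M distr P borel Y). indicator ?S p)"
  proof -
    have "?S \<inter> space (distr P borel X \<Otimes>\<^sub>M distr P borel Y) = ?S"
      by (auto simp: space_pair_measure)
    then show ?thesis by simp
  qed
  also have "\<dots> = (LINT x|distr P borel X. LINT y|distr P borel Y. indicator ?S (x, y))"
    by (rule PP.integral_fst'[symmetric])
       (auto intro!: PP.integrable_const_bound[where B=1] simp: indicator_def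
         simp flip: borel_prod)
  also have "\<dots> = (LINT x|distr P borel X. indicator A x * rv_cdf P Y (g x))"
  proof (rule Bochner_Integration.integral_cong[OF refl])
    fix x
    have "(\<lambda>y. indicator ?S (x, y) :: real) = (\<lambda>y. indicator A x * indicator {..g x} y)"
      by (auto simp: indicator_def space_pair_measure fun_eq_iff)
    then show "(LINT y|distr P borel Y. indicator ?S (x, y)) = indicator A x * rv_cdf P Y (g x)"
      by (simp add: rv_cdf_def cdf_def)
  qed
  finally show ?thesis
    using P X by (simp add: interval_measure_rv_cdf set_lebesgue_integral_def)
qed

lemma trunc_H_eq:
  assumes "prob_space P" "prob_space.indep_var P borel X borel Y"
  shows "trunc_H P X Y x y =
    1 / trunc_alpha P X Y * (LINT z:{..x}|interval_measure (rv_cdf P X). rv_cdf P Y (min y z))"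
proof -
  have "\<P>(\<omega> in P. (X \<omega> \<le> x \<and> Y \<omega> \<le> y) \<and> Y \<omega> \<le> X \<omega>)
      = \<P>(\<omega> in P. X \<omega> \<in> {..x} \<and> Y \<omega> \<le> min y (X \<omega>))"
    by (intro arg_cong[where f="measure P"]) auto
  also have "\<dots> = (LINT z:{..x}|interval_measure (rv_cdf P X). rv_cdf P Y (min y z))"
    by (rule measure_indep_le[OF assms]) auto
  finally show ?thesis by (simp add: trunc_H_def trunc_alpha_def cond_prob_def)
qed

lemma trunc_F_eq:
  assumes "prob_space P" "prob_space.indep_var P borel X borel Y"
  shows "trunc_F P X Y x =
    1 / trunc_alpha P X Y * (LINT z:{..x}|interval_measure (rv_cdf P X). rv_cdf P Y z)"
  using measure_indep_le[OF assms, of "{..x}" "\<lambda>z. z"]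
  by (simp add: trunc_F_def trunc_alpha_def cond_prob_def)

lemma trunc_C_eq:
  assumes P: "prob_space P" and ind: "prob_space.indep_var P borel X borel Y"
  shows "trunc_C P X Y z =
    1 / trunc_alpha P X Y * (rv_cdf P Y z * (1 - Lim (at_left z) (rv_cdf P X)))"
proof -
  interpret prob_space P by fact
  have X[measurable]: "X \<in> borel_measurable P"
    using indep_var_rv1[OF ind] by auto
  interpret D: real_distribution "distr P borel X" by (rule real_distribution_distr) fact
  have "Lim (at_left z) (rv_cdf P X) = measure (distr P borel X) {..<z}"
    unfolding rv_cdf_def by (intro tendsto_Lim D.cdf_at_left) simp
  then have L: "measure (distr P borel X) {z..} = 1 - Lim (at_left z) (rv_cdf P X)"
    using D.prob_compl[of "{..<z}"] by (simp add: Compl_eq_Diff_UNIV[symmetric])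
  have "\<P>(\<omega> in P. (Y \<omega> \<le> z \<and> z \<le> X \<omega>) \<and> Y \<omega> \<le> X \<omega>)
      = \<P>(\<omega> in P. X \<omega> \<in> {z..} \<and> Y \<omega> \<le> z)"
    by (intro arg_cong[where f="measure P"]) auto
  also have "\<dots> = (LINT u:{z..}|interval_measure (rv_cdf P X). rv_cdf P Y z)"
    by (rule measure_indep_le[OF assms]) auto
  also have "\<dots> = rv_cdf P Y z * (1 - Lim (at_left z) (rv_cdf P X))"
    using P X L by (simp add: interval_measure_rv_cdf set_lebesgue_integral_def)
  finally show ?thesis by (simp add: trunc_C_def trunc_alpha_def cond_prob_def)
qed

end

theory Submission
  imports Defs "HOL-Real_Asymp.Real_Asymp"
begin

text \<open>
Write \<open>S = 1 - F\<close>, let \<open>d\<Lambda> = dF / S\<close> be the hazard measure of \<open>X\<close>, let \<open>N t\<close> be the number of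
observed pairs with \<open>Y\<^sub>i \<le> t \<le> X\<^sub>i\<close> (so \<open>C\<^sub>n = N / n\<close>), and let \<open>w t = 1 - F\<^sub>n(t-)\<close> and \<open>Q = w / S\<close>.

The proof rests on an exact identity and a second moment computation. The product \<open>w\<close> solves the Duhamel
equation \<open>Q t = 1 - \<integral>\<^bsub>s<t\<^esub> Q d(\<Lambda>\<^sub>n - \<Lambda>)\<close>, where \<open>\<Lambda>\<^sub>n\<close> puts mass \<open>1 / N(X\<^sub>i)\<close> at each observed
\<open>X\<^sub>i\<close> (\<open>Duhamel\<close>). Inserting it into \<open>\<integral> \<phi> dF\<^sub>n = \<integral> \<phi> w d\<Lambda>\<^sub>n\<close> and exchanging the order of integration
gives \<open>\<integral> \<phi> d(F\<^sub>n - F) = \<integral> \<psi> Q d(\<Lambda>\<^sub>n - \<Lambda>)\<close> for almost every sample (\<open>lynden_bell_identity\<close>). Since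
\<open>dF\<^sup>* = C d\<Lambda>\<close>, the linear terms of the expansion are \<open>\<integral> \<psi> / C (dF\<^sub>n\<^sup>* - C\<^sub>n d\<Lambda>)\<close>. With
\<open>H = \<psi> (n Q / N - 1 / C)\<close>, where \<open>1 / 0 = 0\<close>, the remainder is therefore exactly
\<open>(1 / n) (\<Sum>\<^sub>i H(X\<^sub>i) - \<integral> H N d\<Lambda>) - \<integral> \<psi> Q 1{N = 0} d\<Lambda>\<close>. The lemma \<open>remainder_decomposition\<close> states this
on the event that somebody is at risk at the median of \<open>F\<close>, whose probability tends to \<open>1\<close>.

The value of \<open>H\<close> at time \<open>t\<close> depends on the sample only through the \<open>Y\<^sub>i\<close> and the \<open>min X\<^sub>i t\<close>. Given \<open>Y\<^sub>i\<close>,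
the hazard measure of \<open>X\<^sub>i\<close> is \<open>\<Lambda>\<close> restricted to \<open>[Y\<^sub>i, \<infinity>)\<close>, so for such predictable \<open>H\<close> the compensated
sum \<open>\<Sum>\<^sub>i H(X\<^sub>i) - \<integral> H N d\<Lambda>\<close> is the end value of a martingale, with mean \<open>0\<close> and second moment at most
\<open>E \<integral> H\<^sup>2 N d\<Lambda>\<close> (\<open>isometry_inequality\<close>). No theory of martingales in continuous time enters: the compensator
formula is Fubini's theorem in one coordinate of the sample, and the formula for the second moment is the
case \<open>K t = (\<Sum>\<^bsub>X\<^sub>i<t\<^esub> H(X\<^sub>i) - \<integral>\<^bsub>s<t\<^esub> H N d\<Lambda>) H t\<close> of it.

It remains to show that \<open>\<integral> \<psi>\<^sup>2 E[(n Q / N - 1 / C)\<^sup>2 N / n] d\<Lambda>\<close> tends to \<open>0\<close>, by dominated convergence. The inner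
expectation is at most a constant times \<open>1 / C\<close> (\<open>weight_energy_bound\<close>): to the left of the median of \<open>F\<close>
because \<open>Q \<le> 2\<close> there and \<open>E[1 / N] \<le> 6 / (n C)\<close>, to the right of it because the expectation of
\<open>w\<^sup>2 / (N S)\<close> does not exceed its value at the median (\<open>risk_ratio_expectation_decay\<close>). It tends to \<open>0\<close> at each point
because \<open>Q\<close> and \<open>N / (n C)\<close> tend to \<open>1\<close> (\<open>weight_energy_tendsto_0\<close>). The dominating function is integrable
since \<open>\<integral> \<psi>\<^sup>2 / C d\<Lambda>\<close> is finite, by Hardy's inequality and both integrability conditions
(\<open>psi_square_integrable\<close>). The integral over \<open>{N = 0}\<close> lives on the left of the median, up to an event of
vanishing probability, and there it is negligible because \<open>P(N = 0) \<le> min 1 (1 / (n C))\<close> (\<open>gap_term_tendsto_0\<close>).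
\<close>

section \<open>Distribution functions without atoms\<close>

lemma (in real_distribution) cdf_attains:
  assumes cont: "\<And>x. measure M {x} = 0" and "0 < d" "d < 1"
  obtains x where "cdf M x = d"
proof -
  have c: "continuous_on A (cdf M)" for A
    using isCont_cdf cont by (intro continuous_at_imp_continuous_on) auto
  obtain a where a: "cdf M a < d"
    using order_tendstoD(2)[OF cdf_lim_at_bot \<open>0 < d\<close>] by (auto simp: eventually_at_bot_linorder)
  obtain b where b: "cdf M b > d"
    using order_tendstoD(1)[OF cdf_lim_at_top_prob \<open>d < 1\<close>] by (auto simp: eventually_at_top_linorder)
  have "a \<le> b" using a b cdf_nondecreasing[of b a] by linarith
  with IVT'[of "cdf M" a d b] a b c that show ?thesis by force
qed

lemma (in real_distribution) borel_measurable_cdf [measurable]: "cdf M \<in> borel_measurable borel"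
  by (rule borel_measurable_mono) (auto intro: monoI cdf_nondecreasing)

text \<open>
The probability integral transform. Integrals of functions of \<open>F\<close> against \<open>dF\<close> become Lebesgue integrals
over \<open>[0, 1]\<close>, where the fundamental theorem of calculus evaluates them.
\<close>

lemma (in real_distribution) distr_cdf_uniform:
  assumes cont: "\<And>x. measure M {x} = 0"
  shows "distr M borel (cdf M) = uniform_measure lborel {0..1}"
proof (rule cdf_unique)
  show "real_distribution (distr M borel (cdf M))"
    by (rule real_distribution_distr) simp
  interpret U: prob_space "uniform_measure lborel {0..1::real}"
    by (rule prob_space_uniform_measure) auto
  show "real_distribution (uniform_measure lborel {0..1::real})"
    by unfold_locales simp
  show "cdf (distr M borel (cdf M)) = cdf (uniform_measure lborel {0..1::real})"
  proof
    fix c :: real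
    let ?A = "{x. cdf M x \<le> c}"
    have A[measurable]: "?A \<in> sets borel" by measurable
    have 1: "cdf (distr M borel (cdf M)) c = prob ?A"
      by (subst cdf_def, subst measure_distr) (auto simp: vimage_def)
    have le1: "measure M X \<le> 1" for X by (rule prob_le_1)
    have up: "prob ?A \<le> d" if "c < d" "0 < d" "d < 1" for d
    proof -
      obtain x where x: "cdf M x = d" using cdf_attains[OF cont \<open>0<d\<close> \<open>d<1\<close>] by blast
      have "?A \<subseteq> {..x}"
      proof
        fix y assume "y \<in> ?A"
        then show "y \<in> {..x}" using cdf_nondecreasing[of x y] x \<open>c < d\<close> by (cases "y \<le> x") auto
      qed
      then have "prob ?A \<le> prob {..x}" by (intro finite_measure_mono) auto
      then show ?thesis using x by (simp add: cdf_def)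
    qed
    have lo: "d \<le> prob ?A" if "d \<le> c" "0 < d" "d < 1" for d
    proof -
      obtain x where x: "cdf M x = d" using cdf_attains[OF cont \<open>0<d\<close> \<open>d<1\<close>] by blast
      have "{..x} \<subseteq> ?A" using x \<open>d \<le> c\<close> cdf_nondecreasing[of _ x] by force
      then have "prob {..x} \<le> prob ?A" by (intro finite_measure_mono) auto
      then show ?thesis using x by (simp add: cdf_def)
    qed
    have "prob ?A = max 0 (min 1 c)"
    proof -
      consider "c < 0" | "0 \<le> c" "c < 1" | "c \<ge> 1" by linarith
      then show ?thesis
      proof cases
        case 1
        then have "?A = {}" using cdf_nonneg by (auto simp: not_le intro: less_le_trans)
        then show ?thesis using 1 by simp
      next
        case 2
        have "prob ?A \<le> c"
        proof (rule field_le_epsilon)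
          fix e :: real assume "0 < e"
          have "prob ?A \<le> min (c+e) ((c+1)/2)" using 2 \<open>0<e\<close> by (intro up) (auto simp: min_def)
          then show "prob ?A \<le> c + e" by simp
        qed
        moreover have "c \<le> prob ?A" using lo[of c] 2 by (cases "c = 0") auto
        ultimately show ?thesis using 2 by simp
      next
        case 3
        then have "?A = UNIV" using cdf_bounded_prob by (auto intro: order_trans)
        then show ?thesis using 3 prob_space by simp
      qed
    qed
    moreover have "cdf (uniform_measure lborel {0..1::real}) c = max 0 (min 1 c)"
    proof -
      have "{0..1} \<inter> {..c} = {0..min 1 c}" by auto
      then show ?thesis unfolding cdf_def by (subst measure_uniform_measure) (auto simp: max_def min_def)
    qed
    ultimately show "cdf (distr M borel (cdf M)) c = cdf (uniform_measure lborel {0..1::real}) c"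
      using 1 by simp
  qed
qed

lemma (in real_distribution) nn_integral_function_of_cdf:
  assumes cont: "\<And>x. measure M {x} = 0"
    and g[measurable]: "g \<in> borel_measurable borel" and nn: "\<And>u. u \<in> {a..b} \<Longrightarrow> 0 \<le> g u"
    and I: "(g has_integral I) {a..b}" and ab: "0 \<le> a" "b \<le> 1"
  shows "(\<integral>\<^sup>+x. ennreal (g (cdf M x)) * indicator {a..b} (cdf M x) \<partial>M) = ennreal I"
proof -
  have "(\<integral>\<^sup>+x. ennreal (g (cdf M x)) * indicator {a..b} (cdf M x) \<partial>M)
      = (\<integral>\<^sup>+u. ennreal (g u) * indicator {a..b} u \<partial>distr M borel (cdf M))"
    by (subst nn_integral_distr) auto
  also have "\<dots> = (\<integral>\<^sup>+u. ennreal (g u) * indicator {a..b} u \<partial>lborel)"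
    unfolding distr_cdf_uniform[OF cont] 
    by (subst nn_integral_uniform_measure)
       (use ab in \<open>auto intro!: nn_integral_cong simp: indicator_def divide_ennreal_def\<close>)
  also have "\<dots> = ennreal I"
    by (rule nn_integral_has_integral_lebesgue'[OF nn I]) auto
  finally show ?thesis .
qed

lemma (in real_distribution) AE_cdf_neq:
  assumes cont: "\<And>x. measure M {x} = 0"
  shows "AE x in M. cdf M x \<noteq> c"
proof -
  have "AE u in distr M borel (cdf M). u \<noteq> c"
    unfolding distr_cdf_uniform[OF cont]
    using AE_lborel_singleton[of c] by (intro AE_uniform_measureI) auto
  then show ?thesis by (subst (asm) AE_distr_iff) auto
qed

section \<open>The truncation model and Hardy's inequality\<close>

text \<open>
Here \<open>\<mu>\<close> and \<open>\<nu>\<close> are the laws of \<open>X\<close> and \<open>Y\<close>. The condition that \<open>F x > 0\<close> implies \<open>G x > 0\<close> is what the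
comparison of the lower endpoints amounts to when \<open>F\<close> is continuous; it makes \<open>G\<close> and \<open>C\<close> positive
\<open>\<mu>\<close>-almost everywhere.
\<close>

locale truncation_model =
  X: real_distribution \<mu> + Y: real_distribution \<nu> for \<mu> \<nu> :: "real measure" +
  assumes atomless: "measure \<mu> {x} = 0"
    and G_pos: "cdf \<mu> x > 0 \<Longrightarrow> cdf \<nu> x > 0"
    and inverse_G: "integrable \<mu> (\<lambda>x. 1 / cdf \<nu> x)"
begin

abbreviation F :: "real \<Rightarrow> real" where "F \<equiv> cdf \<mu>"
abbreviation G :: "real \<Rightarrow> real" where "G \<equiv> cdf \<nu>"

definition S :: "real \<Rightarrow> real" where "S x = 1 - F x"
definition \<alpha> :: real where "\<alpha> = (LINT x|\<mu>. G x)"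
definition C :: "real \<Rightarrow> real" where "C x = G x * S x / \<alpha>"

lemma S_measurable [measurable]: "S \<in> borel_measurable borel"
  unfolding S_def by measurable

lemma S_nonneg [simp]: "0 \<le> S x" and S_le_1 [simp]: "S x \<le> 1"
  using X.cdf_bounded_prob[of x] X.cdf_nonneg[of x] by (auto simp: S_def)

lemma S_antimono: "x \<le> y \<Longrightarrow> S y \<le> S x"
  unfolding S_def using X.cdf_nondecreasing by simp

lemma G_nonneg [simp]: "0 \<le> G x" and G_le_1 [simp]: "G x \<le> 1"
  using Y.cdf_bounded_prob[of x] Y.cdf_nonneg[of x] by auto

lemma AE_S_pos: "AE x in \<mu>. 0 < S x"
  using X.AE_cdf_neq[OF atomless, of 1]
  by eventually_elim (simp add: S_def less_le X.cdf_bounded_prob)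

lemma AE_G_pos: "AE x in \<mu>. 0 < G x"
  using X.AE_cdf_neq[OF atomless, of 0]
  by eventually_elim (rule G_pos, simp add: less_le X.cdf_nonneg)

lemma AE_less_iff_F: "AE s in \<mu>. s < x \<longleftrightarrow> F s \<le> F x"
  using X.AE_cdf_neq[OF atomless, of "F x"]
proof eventually_elim
  case (elim s)
  then show ?case using X.cdf_nondecreasing[of x s] X.cdf_nondecreasing[of s x] by force
qed

lemma AE_greater_iff_F: "AE s in \<mu>. x < s \<longleftrightarrow> F x \<le> F s"
  using X.AE_cdf_neq[OF atomless, of "F x"]
proof eventually_elim
  case (elim s)
  then show ?case using X.cdf_nondecreasing[of x s] X.cdf_nondecreasing[of s x] by force
qed

lemma alpha_pos: "0 < \<alpha>"
proof -
  have "integrable \<mu> G"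
    by (rule X.integrable_const_bound[where B=1]) auto
  moreover have "\<not> (AE x in \<mu>. G x = 0)"
  proof
    assume "AE x in \<mu>. G x = 0"
    with AE_G_pos have "AE x in \<mu>. False" by eventually_elim auto
    then show False by simp
  qed
  ultimately have "\<alpha> \<noteq> 0"
    unfolding \<alpha>_def by (subst integral_nonneg_eq_0_iff_AE) auto
  moreover have "0 \<le> \<alpha>" unfolding \<alpha>_def by (intro integral_nonneg_AE) auto
  ultimately show ?thesis by simp
qed

lemma C_measurable [measurable]: "C \<in> borel_measurable borel"
  unfolding C_def by measurable

lemma C_nonneg [simp]: "0 \<le> C x"
  using alpha_pos by (simp add: C_def)

lemma C_pos: "0 < G x \<Longrightarrow> 0 < S x \<Longrightarrow> 0 < C x"
  using alpha_pos by (simp add: C_def)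

lemma AE_C_pos: "AE x in \<mu>. 0 < C x"
  using AE_S_pos AE_G_pos by eventually_elim (rule C_pos)

lemma emeasure_atLeast: "emeasure \<mu> {x..} = ennreal (S x)"
proof -
  have "{x..} = UNIV - {..x} \<union> {x}" by auto
  then have "measure \<mu> {x..} = measure \<mu> (UNIV - {..x}) + measure \<mu> {x}"
    by (simp only:, subst X.finite_measure_Union) auto
  also have "\<dots> = S x"
    using X.prob_compl[of "{..x}"] atomless by (simp add: S_def cdf_def)
  finally show ?thesis by (simp add: X.emeasure_eq_measure)
qed

text \<open>
This is \<open>d(1 / S) = dF / S\<^sup>2\<close>.
\<close>

lemma nn_integral_inverse_S_squared:
  assumes "0 < S x"
  shows "(\<integral>\<^sup>+s. ennreal (1 / (S s)\<^sup>2) * indicator {..<x} s \<partial>\<mu>) = ennreal (1 / S x - 1)"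
proof -
  have "((\<lambda>u. 1 / (1 - u)\<^sup>2) has_integral (1 / (1 - F x) - 1 / (1 - 0))) {0..F x}"
    by (rule fundamental_theorem_of_calculus)
       (use assms in \<open>auto simp: S_def power2_eq_square X.cdf_nonneg has_real_derivative_iff_has_vector_derivative[symmetric] intro!: derivative_eq_intros\<close>)
  then have "(\<integral>\<^sup>+s. ennreal (1 / (1 - F s)\<^sup>2) * indicator {0..F x} (F s) \<partial>\<mu>) = ennreal (1 / S x - 1)"
    unfolding S_def
    by (intro X.nn_integral_function_of_cdf[OF atomless, where g="\<lambda>u. 1 / (1 - u)\<^sup>2"]) (auto simp: X.cdf_bounded_prob)
  moreover have "(\<integral>\<^sup>+s. ennreal (1 / (S s)\<^sup>2) * indicator {..<x} s \<partial>\<mu>)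
      = (\<integral>\<^sup>+s. ennreal (1 / (1 - F s)\<^sup>2) * indicator {0..F x} (F s) \<partial>\<mu>)"
    by (rule nn_integral_cong_AE, use AE_less_iff_F[of x] in eventually_elim)
       (auto simp: indicator_def S_def X.cdf_nonneg)
  ultimately show ?thesis by simp
qed

lemma nn_integral_S_powr_3_2:
  assumes "0 < S x"
  shows "(\<integral>\<^sup>+s. ennreal (1 / (S s * sqrt (S s))) * indicator {..<x} s \<partial>\<mu>) \<le> ennreal (2 / sqrt (S x))"
proof -
  have "((\<lambda>u. 1 / ((1 - u) * sqrt (1 - u))) has_integral (2 / sqrt (1 - F x) - 2 / sqrt (1 - 0))) {0..F x}"
    by (rule fundamental_theorem_of_calculus)
       (use assms in \<open>auto simp: S_def field_simps power2_eq_square X.cdf_nonneg has_real_derivative_iff_has_vector_derivative[symmetric] intro!: derivative_eq_intros\<close>)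
  then have "(\<integral>\<^sup>+s. ennreal (1 / ((1 - F s) * sqrt (1 - F s))) * indicator {0..F x} (F s) \<partial>\<mu>) = ennreal (2 / sqrt (S x) - 2 / sqrt (1 - 0))"
    unfolding S_def
    by (intro X.nn_integral_function_of_cdf[OF atomless, where g="\<lambda>u. 1 / ((1 - u) * sqrt (1 - u))"]) (use X.cdf_bounded_prob[of x] in auto)
  also have "\<dots> \<le> ennreal (2 / sqrt (S x))" by (rule ennreal_leI) simp
  finally have "(\<integral>\<^sup>+s. ennreal (1 / ((1 - F s) * sqrt (1 - F s))) * indicator {0..F x} (F s) \<partial>\<mu>) \<le> ennreal (2 / sqrt (S x))" .
  moreover have "(\<integral>\<^sup>+s. ennreal (1 / (S s * sqrt (S s))) * indicator {..<x} s \<partial>\<mu>)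
      = (\<integral>\<^sup>+s. ennreal (1 / ((1 - F s) * sqrt (1 - F s))) * indicator {0..F x} (F s) \<partial>\<mu>)"
    by (rule nn_integral_cong_AE, use AE_less_iff_F[of x] in eventually_elim)
       (auto simp: indicator_def S_def X.cdf_nonneg)
  ultimately show ?thesis by simp
qed

lemma nn_integral_S_powr_1_2:
  "(\<integral>\<^sup>+s. ennreal (1 / sqrt (S s)) * indicator {x<..} s \<partial>\<mu>) = ennreal (2 * sqrt (S x))"
proof -
  have "((\<lambda>u. 1 / sqrt (1 - u)) has_integral (- 2 * sqrt (1 - 1) - (- 2 * sqrt (1 - F x)))) {F x..1}"
    by (rule fundamental_theorem_of_calculus_interior)
       (auto simp: field_simps X.cdf_bounded_prob has_real_derivative_iff_has_vector_derivative[symmetric] intro!: derivative_eq_intros continuous_intros)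
  then have "(\<integral>\<^sup>+s. ennreal (1 / sqrt (1 - F s)) * indicator {F x..1} (F s) \<partial>\<mu>) = ennreal (2 * sqrt (S x))"
    unfolding S_def
    by (intro X.nn_integral_function_of_cdf[OF atomless, where g="\<lambda>u. 1 / sqrt (1 - u)"]) (auto simp: X.cdf_nonneg)
  moreover have "(\<integral>\<^sup>+s. ennreal (1 / sqrt (S s)) * indicator {x<..} s \<partial>\<mu>)
      = (\<integral>\<^sup>+s. ennreal (1 / sqrt (1 - F s)) * indicator {F x..1} (F s) \<partial>\<mu>)"
    by (rule nn_integral_cong_AE, use AE_greater_iff_F[of x] in eventually_elim)
       (auto simp: indicator_def S_def X.cdf_bounded_prob)
  ultimately show ?thesis by simp
qed

text \<open>
The averages \<open>(1 / S s) \<integral>\<^bsub>x>s\<^esub> f dF\<close> are bounded in \<open>L\<^sup>2(F)\<close> by Hardy's inequality with its constant \<open>4\<close>. The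
proof is Schur's test: Cauchy--Schwarz with the weight \<open>S\<^sup>1\<^sup>/\<^sup>2\<close> on the inner integral, followed by an
exchange of the integrals.
\<close>

lemma Hardy_inequality:
  assumes [measurable]: "f \<in> borel_measurable borel" and f: "\<And>x. 0 \<le> f x"
  shows "(\<integral>\<^sup>+s. (\<integral>\<^sup>+x. ennreal (f x) * indicator {s<..} x \<partial>\<mu>)\<^sup>2 * ennreal (1 / (S s)\<^sup>2) \<partial>\<mu>)
    \<le> 4 * (\<integral>\<^sup>+x. ennreal ((f x)\<^sup>2) \<partial>\<mu>)"
proof -
  interpret XX: pair_sigma_finite \<mu> \<mu> ..
  have gt [measurable]: "Measurable.pred (borel \<Otimes>\<^sub>M borel) (\<lambda>p::real\<times>real. snd p \<in> {fst p<..})"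
    by simp
  let ?q = "\<lambda>s x. ennreal (2 / (S s * sqrt (S s))) * (ennreal ((f x)\<^sup>2 * sqrt (S x)) * indicator {s<..} x)"
  have "AE s in \<mu>. (\<integral>\<^sup>+x. ennreal (f x) * indicator {s<..} x \<partial>\<mu>)\<^sup>2 * ennreal (1 / (S s)\<^sup>2)
      \<le> (\<integral>\<^sup>+x. ?q s x \<partial>\<mu>)"
    using AE_S_pos
  proof eventually_elim
    case (elim s)
    \<comment> \<open>The factor is split as \<open>(f S\<^sup>1\<^sup>/\<^sup>4) S\<^sup>-\<^sup>1\<^sup>/\<^sup>4\<close>, which after squaring leaves \<open>f\<^sup>2 S\<^sup>1\<^sup>/\<^sup>2\<close> and \<open>S\<^sup>-\<^sup>1\<^sup>/\<^sup>2\<close>.\<close>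
    have "(\<integral>\<^sup>+x. ennreal (f x) * indicator {s<..} x \<partial>\<mu>)
        = (\<integral>\<^sup>+x. (ennreal (f x * sqrt (sqrt (S x))) * indicator {s<..} x) * (ennreal (1 / sqrt (sqrt (S x))) * indicator {s<..} x) \<partial>\<mu>)"
      using AE_S_pos
      by (intro nn_integral_cong_AE, eventually_elim)
         (auto simp: indicator_def f simp flip: ennreal_mult)
    then have "(\<integral>\<^sup>+x. ennreal (f x) * indicator {s<..} x \<partial>\<mu>)\<^sup>2
       \<le> (\<integral>\<^sup>+x. (ennreal (f x * sqrt (sqrt (S x))) * indicator {s<..} x)\<^sup>2 \<partial>\<mu>)
        * (\<integral>\<^sup>+x. (ennreal (1 / sqrt (sqrt (S x))) * indicator {s<..} x)\<^sup>2 \<partial>\<mu>)"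
      by (simp only:) (rule Cauchy_Schwarz_nn_integral; measurable)
    also have "(\<lambda>x. (ennreal (f x * sqrt (sqrt (S x))) * indicator {s<..} x)\<^sup>2)
        = (\<lambda>x. ennreal ((f x)\<^sup>2 * sqrt (S x)) * indicator {s<..} x)"
      by (auto simp: indicator_def f ennreal_power power_mult_distrib)
    also have "(\<lambda>x. (ennreal (1 / sqrt (sqrt (S x))) * indicator {s<..} x)\<^sup>2)
        = (\<lambda>x. ennreal (1 / sqrt (S x)) * indicator {s<..} x)"
      by (auto simp: indicator_def ennreal_power power_divide)
    also note nn_integral_S_powr_1_2
    finally have "(\<integral>\<^sup>+x. ennreal (f x) * indicator {s<..} x \<partial>\<mu>)\<^sup>2 * ennreal (1 / (S s)\<^sup>2)
      \<le> (\<integral>\<^sup>+x. ennreal ((f x)\<^sup>2 * sqrt (S x)) * indicator {s<..} x \<partial>\<mu>) * ennreal (2 * sqrt (S s)) * ennreal (1 / (S s)\<^sup>2)"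
      by (intro mult_right_mono) auto
    also have "\<dots> = (\<integral>\<^sup>+x. ennreal ((f x)\<^sup>2 * sqrt (S x)) * indicator {s<..} x \<partial>\<mu>) * ennreal (2 / (S s * sqrt (S s)))"
    proof -
      have "2 * sqrt (S s) * (1 / (S s)\<^sup>2) = 2 / (S s * sqrt (S s))"
        using elim by (simp add: divide_simps power2_eq_square)
      then show ?thesis by (simp add: mult.assoc flip: ennreal_mult)
    qed
    also have "\<dots> = (\<integral>\<^sup>+x. ?q s x \<partial>\<mu>)"
      by (subst nn_integral_cmult) (auto simp: mult.commute)
    finally show ?case .
  qed
  then have "(\<integral>\<^sup>+s. (\<integral>\<^sup>+x. ennreal (f x) * indicator {s<..} x \<partial>\<mu>)\<^sup>2 * ennreal (1 / (S s)\<^sup>2) \<partial>\<mu>)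
    \<le> (\<integral>\<^sup>+s. \<integral>\<^sup>+x. ?q s x \<partial>\<mu> \<partial>\<mu>)"
    by (rule nn_integral_mono_AE)
  also have "\<dots> = (\<integral>\<^sup>+x. \<integral>\<^sup>+s. ?q s x \<partial>\<mu> \<partial>\<mu>)"
    by (rule XX.Fubini'[symmetric]) (simp add: split_beta', measurable)
  also have "\<dots> \<le> (\<integral>\<^sup>+x. 4 * ennreal ((f x)\<^sup>2) \<partial>\<mu>)"
  proof (rule nn_integral_mono_AE, use AE_S_pos in eventually_elim)
    case (elim x)
    have "(\<integral>\<^sup>+s. ?q s x \<partial>\<mu>) = (\<integral>\<^sup>+s. ennreal (2 * (f x)\<^sup>2 * sqrt (S x)) * (ennreal (1 / (S s * sqrt (S s))) * indicator {..<x} s) \<partial>\<mu>)"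
      by (intro nn_integral_cong) (auto simp: indicator_def simp flip: ennreal_mult)
    also have "\<dots> = ennreal (2 * (f x)\<^sup>2 * sqrt (S x)) * (\<integral>\<^sup>+s. ennreal (1 / (S s * sqrt (S s))) * indicator {..<x} s \<partial>\<mu>)"
      by (rule nn_integral_cmult) measurable
    also have "\<dots> \<le> ennreal (2 * (f x)\<^sup>2 * sqrt (S x)) * ennreal (2 / sqrt (S x))"
      by (intro mult_left_mono nn_integral_S_powr_3_2 elim) auto
    also have "\<dots> = ennreal (4 * (f x)\<^sup>2)"
      using elim by (simp flip: ennreal_mult)
    also have "\<dots> = 4 * ennreal ((f x)\<^sup>2)" by (subst ennreal_mult) auto
    finally show ?case .
  qed
  also have "\<dots> = 4 * (\<integral>\<^sup>+x. ennreal ((f x)\<^sup>2) \<partial>\<mu>)"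
    by (rule nn_integral_cmult) measurable
  finally show ?thesis .
qed

end

section \<open>Predictable processes and the compensator of the observations\<close>

text \<open>
The value at time \<open>t\<close> does not change if an \<open>X\<^sub>i\<close> with \<open>X\<^sub>i \<ge> t\<close> is replaced by \<open>t\<close>: the process may look at
all \<open>Y\<^sub>j\<close>, and at the \<open>X\<^sub>j\<close> only up to time \<open>t\<close>. Samples are functions from indices to pairs
\<open>(X\<^sub>i, Y\<^sub>i)\<close>.
\<close>

definition predictable :: "nat \<Rightarrow> (real \<Rightarrow> (nat \<Rightarrow> real \<times> real) \<Rightarrow> 'a) \<Rightarrow> bool" where
  "predictable n K \<longleftrightarrow> (\<forall>i<n. \<forall>t z. t \<le> fst (z i) \<longrightarrow> K t (z(i := (t, snd (z i)))) = K t z)"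

text \<open>
In the notation of the estimator this is \<open>n C\<^sub>n(t)\<close>.
\<close>

definition at_risk :: "nat \<Rightarrow> real \<Rightarrow> (nat \<Rightarrow> real \<times> real) \<Rightarrow> real" where
  "at_risk n t z = (\<Sum>i<n. if snd (z i) \<le> t \<and> t \<le> fst (z i) then 1 else 0)"

text \<open>
For a sample with distinct \<open>X\<^sub>i\<close> this is \<open>1 - F\<^sub>n(t-)\<close>. The left limit is what makes the process predictable.
\<close>

definition surv :: "nat \<Rightarrow> real \<Rightarrow> (nat \<Rightarrow> real \<times> real) \<Rightarrow> real" where
  "surv n t z = (\<Prod>i<n. if fst (z i) < t then 1 - 1 / at_risk n (fst (z i)) z else 1)"

lemma predictableD:
  assumes "predictable n K" "i < n" "s \<le> t" "t \<le> fst (z i)"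
  shows "K s (z(i := (t, snd (z i)))) = K s z"
proof -
  have "K s ((z(i := (t, snd (z i))))(i := (s, snd ((z(i := (t, snd (z i)))) i)))) = K s (z(i := (t, snd (z i))))"
    using assms(1) \<open>i < n\<close> \<open>s \<le> t\<close> unfolding predictable_def
    by (metis fstI fun_upd_same)
  moreover have "K s (z(i := (s, snd (z i)))) = K s z"
    using assms unfolding predictable_def by (meson order_trans)
  ultimately show ?thesis by simp
qed

lemma predictable_at_risk: "predictable n (at_risk n)"
  unfolding predictable_def at_risk_def by (auto intro!: sum.cong)

lemma predictable_surv: "predictable n (surv n)"
  unfolding predictable_def
proof (intro allI impI)
  fix i t and z :: "nat \<Rightarrow> real \<times> real"
  assume i: "i < n" "t \<le> fst (z i)"
  show "surv n t (z(i := (t, snd (z i)))) = surv n t z"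
    unfolding surv_def
  proof (rule prod.cong)
    fix j assume "j \<in> {..<n}"
    show "(if fst ((z(i := (t, snd (z i)))) j) < t then 1 - 1 / at_risk n (fst ((z(i := (t, snd (z i)))) j)) (z(i := (t, snd (z i)))) else 1)
      = (if fst (z j) < t then 1 - 1 / at_risk n (fst (z j)) z else 1)"
      using i predictableD[OF predictable_at_risk i(1), of "fst (z j)" t z] by (cases "j = i") auto
  qed simp
qed

lemma at_risk_nonneg [simp]: "0 \<le> at_risk n t z"
  unfolding at_risk_def by (intro sum_nonneg) auto

lemma at_risk_le: "at_risk n t z \<le> real n"
proof -
  have "at_risk n t z \<le> (\<Sum>i<n. 1)"
    unfolding at_risk_def by (intro sum_mono) auto
  then show ?thesis by simp
qed

lemma at_risk_cases: "at_risk n t z = 0 \<or> 1 \<le> at_risk n t z"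
proof -
  have "at_risk n t z = real (\<Sum>i<n. if snd (z i) \<le> t \<and> t \<le> fst (z i) then 1 else 0)"
    unfolding at_risk_def of_nat_sum by (intro sum.cong) auto
  then obtain k :: nat where "at_risk n t z = real k" by blast
  then show ?thesis by (cases k) auto
qed

lemma surv_nonneg [simp]: "0 \<le> surv n t z"
  unfolding surv_def
  by (rule prod_nonneg) (use at_risk_cases in \<open>fastforce simp: divide_simps\<close>)

lemma surv_le_1 [simp]: "surv n t z \<le> 1"
  unfolding surv_def
  by (rule prod_le_1) (use at_risk_cases in \<open>fastforce simp: divide_simps\<close>)

context truncation_model
begin

text \<open>
The law of an observed pair: the product law conditioned on \<open>Y \<le> X\<close>.
\<close>

definition law :: "(real \<times> real) measure" where
  "law = density (\<mu> \<Otimes>\<^sub>M \<nu>) (\<lambda>p. ennreal (1 / \<alpha>) * indicator {p. snd p \<le> fst p} p)"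

definition sample :: "nat \<Rightarrow> (nat \<Rightarrow> real \<times> real) measure" where
  "sample n = Pi\<^sub>M {..<n} (\<lambda>_. law)"

lemma truncated_event [measurable]: "{p::real\<times>real. snd p \<le> fst p} \<in> sets (borel \<Otimes>\<^sub>M borel)"
proof -
  have "{p \<in> space (borel \<Otimes>\<^sub>M borel). snd p \<le> fst (p::real\<times>real)} \<in> sets (borel \<Otimes>\<^sub>M borel)"
    by measurable
  then show ?thesis by (simp add: space_pair_measure)
qed

lemma sets_pair [measurable_cong]: "sets (\<mu> \<Otimes>\<^sub>M \<nu>) = sets (borel \<Otimes>\<^sub>M borel)"
  by (intro sets_pair_measure_cong) auto

lemma sets_law [measurable_cong, simp]: "sets law = sets (borel \<Otimes>\<^sub>M borel)"
  unfolding law_def by (simp add: sets_pair)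

lemma space_law [simp]: "space law = UNIV"
  using sets_eq_imp_space_eq[OF sets_law] by (simp add: space_pair_measure)

lemma nn_integral_law:
  assumes [measurable]: "f \<in> borel_measurable (borel \<Otimes>\<^sub>M borel)"
  shows "(\<integral>\<^sup>+p. f p \<partial>law) = ennreal (1 / \<alpha>) * (\<integral>\<^sup>+y. \<integral>\<^sup>+x. f (x, y) * indicator {y..} x \<partial>\<mu> \<partial>\<nu>)"
proof -
  interpret P: pair_sigma_finite \<mu> \<nu> ..
  have "(\<integral>\<^sup>+p. f p \<partial>law) = (\<integral>\<^sup>+p. ennreal (1 / \<alpha>) * (f p * indicator {p. snd p \<le> fst p} p) \<partial>(\<mu> \<Otimes>\<^sub>M \<nu>))"
    unfolding law_def by (subst nn_integral_density) (auto simp: mult_ac)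
  also have "\<dots> = ennreal (1 / \<alpha>) * (\<integral>\<^sup>+p. f p * indicator {p. snd p \<le> fst p} p \<partial>(\<mu> \<Otimes>\<^sub>M \<nu>))"
    by (rule nn_integral_cmult) measurable
  also have "(\<integral>\<^sup>+p. f p * indicator {p. snd p \<le> fst p} p \<partial>(\<mu> \<Otimes>\<^sub>M \<nu>))
     = (\<integral>\<^sup>+y. \<integral>\<^sup>+x. f (x, y) * indicator {p. snd p \<le> fst p} (x, y) \<partial>\<mu> \<partial>\<nu>)"
    by (rule P.nn_integral_snd[symmetric]) measurable
  finally show ?thesis by (simp add: indicator_def)
qed

lemma emeasure_law_Times:
  assumes [measurable]: "A \<in> sets borel" "B \<in> sets borel"
  shows "emeasure law (A \<times> B) = ennreal (1 / \<alpha>) * (\<integral>\<^sup>+x. emeasure \<nu> ({..x} \<inter> B) * indicator A x \<partial>\<mu>)"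
proof -
  interpret P: pair_sigma_finite \<mu> \<nu> ..
  have [measurable]: "Measurable.pred (borel \<Otimes>\<^sub>M borel) (\<lambda>p::real\<times>real. snd p \<in> {..fst p})" by simp
  have "emeasure law (A \<times> B) = (\<integral>\<^sup>+p. indicator (A \<times> B) p \<partial>law)"
    by (rule nn_integral_indicator[symmetric]) simp
  also have "\<dots> = ennreal (1 / \<alpha>) * (\<integral>\<^sup>+y. \<integral>\<^sup>+x. indicator (A \<times> B) (x, y) * indicator {y..} x \<partial>\<mu> \<partial>\<nu>)"
    by (rule nn_integral_law) measurable
  also have "(\<integral>\<^sup>+y. \<integral>\<^sup>+x. indicator (A \<times> B) (x, y) * indicator {y..} x \<partial>\<mu> \<partial>\<nu>)
     = (\<integral>\<^sup>+y. \<integral>\<^sup>+x. indicator A x * (indicator B y * indicator {..x} y :: ennreal) \<partial>\<mu> \<partial>\<nu>)"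
    by (intro nn_integral_cong) (auto simp: indicator_def)
  also have "\<dots> = (\<integral>\<^sup>+x. \<integral>\<^sup>+y. indicator A x * (indicator B y * indicator {..x} y :: ennreal) \<partial>\<nu> \<partial>\<mu>)"
    by (rule P.Fubini') (simp add: split_beta', measurable)
  also have "\<dots> = (\<integral>\<^sup>+x. emeasure \<nu> ({..x} \<inter> B) * indicator A x \<partial>\<mu>)"
  proof (rule nn_integral_cong)
    fix x
    have "(\<integral>\<^sup>+y. indicator A x * (indicator B y * indicator {..x} y :: ennreal) \<partial>\<nu>)
        = (\<integral>\<^sup>+y. indicator A x * indicator ({..x} \<inter> B) y \<partial>\<nu>)"
      by (intro nn_integral_cong) (auto simp: indicator_def)
    also have "\<dots> = indicator A x * emeasure \<nu> ({..x} \<inter> B)"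
      by (rule nn_integral_cmult_indicator) simp
    finally show "(\<integral>\<^sup>+y. indicator A x * (indicator B y * indicator {..x} y :: ennreal) \<partial>\<nu>) = emeasure \<nu> ({..x} \<inter> B) * indicator A x"
      by (simp add: mult.commute)
  qed
  finally show ?thesis .
qed

lemma nn_integral_G: "(\<integral>\<^sup>+x. ennreal (G x) \<partial>\<mu>) = ennreal \<alpha>"
  unfolding \<alpha>_def
  by (rule nn_integral_eq_integral) (auto intro!: X.integrable_const_bound[where B=1])

sublocale law: prob_space law
proof
  have "emeasure law (space law) = emeasure law (UNIV \<times> UNIV)" by simp
  also have "\<dots> = ennreal (1 / \<alpha>) * (\<integral>\<^sup>+x. ennreal (G x) \<partial>\<mu>)"
    by (subst emeasure_law_Times) (auto simp: cdf_def Y.emeasure_eq_measure)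
  also have "\<dots> = 1"
    unfolding nn_integral_G using alpha_pos by (simp flip: ennreal_mult)
  finally show "emeasure law (space law) = 1" .
qed

sublocale prod: product_prob_space "\<lambda>_::nat. law" I for I ..

sublocale sample: prob_space "sample n" for n
  unfolding sample_def by (intro prob_space_PiM law.prob_space_axioms)

lemma sets_sample [measurable_cong]: "sets (sample n) = sets (Pi\<^sub>M {..<n} (\<lambda>_. borel \<Otimes>\<^sub>M borel))"
  unfolding sample_def by (intro sets_PiM_cong) auto

lemma component_measurable:
  "i < n \<Longrightarrow> (\<lambda>z. z i) \<in> sample n \<rightarrow>\<^sub>M borel \<Otimes>\<^sub>M borel"
  by (simp add: measurable_cong_sets[OF sets_sample refl])

lemma fst_component_measurable:
  "i < n \<Longrightarrow> (\<lambda>z. fst (z i)) \<in> borel_measurable (sample n)"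
  and snd_component_measurable:
  "i < n \<Longrightarrow> (\<lambda>z. snd (z i)) \<in> borel_measurable (sample n)"
  using measurable_fst''[OF component_measurable] measurable_snd''[OF component_measurable] by auto

lemma at_risk_measurable [measurable]:
  assumes [measurable]: "f \<in> borel_measurable M" "g \<in> M \<rightarrow>\<^sub>M sample n"
  shows "(\<lambda>x. at_risk n (f x) (g x)) \<in> borel_measurable M"
proof -
  have [measurable]: "(\<lambda>x. fst (g x i)) \<in> borel_measurable M" "(\<lambda>x. snd (g x i)) \<in> borel_measurable M" if "i < n" for i
    using measurable_compose[OF assms(2) fst_component_measurable[OF that]]
      measurable_compose[OF assms(2) snd_component_measurable[OF that]] by auto
  show ?thesis unfolding at_risk_def by (intro borel_measurable_sum) measurable
qed

lemma surv_measurable [measurable]: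
  assumes [measurable]: "f \<in> borel_measurable M" "g \<in> M \<rightarrow>\<^sub>M sample n"
  shows "(\<lambda>x. surv n (f x) (g x)) \<in> borel_measurable M"
proof -
  have [measurable]: "(\<lambda>x. fst (g x i)) \<in> borel_measurable M" if "i < n" for i
    using measurable_compose[OF assms(2) fst_component_measurable[OF that]] by auto
  show ?thesis unfolding surv_def by (intro borel_measurable_prod) measurable
qed

text \<open>
Fix all coordinates but the \<open>i\<close>-th, and \<open>Y\<^sub>i = b\<close>. Predictability leaves a function \<open>f t b\<close> of time alone on
\<open>b \<le> t \<le> X\<^sub>i\<close>, and both sides become \<open>\<integral>\<^bsub>t\<ge>b\<^esub> f t b dF(t)\<close> up to the same factor: on the right the integral over
\<open>X\<^sub>i \<ge> t\<close> contributes \<open>S t\<close>, which cancels the denominator of the hazard.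
\<close>

lemma compensator_component:
  fixes K :: "real \<Rightarrow> (nat \<Rightarrow> real \<times> real) \<Rightarrow> ennreal"
  assumes K[measurable]: "case_prod K \<in> borel_measurable (borel \<Otimes>\<^sub>M sample n)"
    and pred: "predictable n K" and i: "i < n"
  shows "(\<integral>\<^sup>+z. K (fst (z i)) z \<partial>sample n)
    = (\<integral>\<^sup>+z. \<integral>\<^sup>+t. K t z * (ennreal (1 / S t) * indicator {snd (z i)..fst (z i)} t) \<partial>\<mu> \<partial>sample n)"
proof -
  note fst_component_measurable[OF i, measurable] snd_component_measurable[OF i, measurable]
  define I where "I = {..<n} - {i}"
  have I: "finite I" "i \<notin> I" "{..<n} = insert i I" using i by (auto simp: I_def)
  have sets_n: "sets (sample n) = sets (Pi\<^sub>M (insert i I) (\<lambda>_. law))"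
    by (simp add: sample_def I)
  have m1: "(\<lambda>z. K (fst (z i)) z) \<in> borel_measurable (sample n)"
  proof -
    have "(\<lambda>z. (fst (z i), z)) \<in> sample n \<rightarrow>\<^sub>M borel \<Otimes>\<^sub>M sample n" using i by measurable
    from measurable_compose[OF this K] show ?thesis by simp
  qed
  have S_ind [measurable]: "Measurable.pred (sample n \<Otimes>\<^sub>M borel) (\<lambda>p. snd p \<in> {snd (fst p i)..fst (fst p i)})"
    using i unfolding atLeastAtMost_iff by measurable
  have K2 [measurable]: "(\<lambda>p. K (snd p) (fst p)) \<in> borel_measurable (sample n \<Otimes>\<^sub>M borel)"
    using measurable_compose[OF measurable_pair_swap' K] by (simp add: split_beta')
  have m2: "(\<lambda>z. \<integral>\<^sup>+t. K t z * (ennreal (1 / S t) * indicator {snd (z i)..fst (z i)} t) \<partial>\<mu>) \<in> borel_measurable (sample n)"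
    by (rule X.borel_measurable_nn_integral) (simp add: split_beta', measurable)
  have "(\<integral>\<^sup>+z. K (fst (z i)) z \<partial>sample n)
     = (\<integral>\<^sup>+x. \<integral>\<^sup>+p. K (fst p) (x(i := p)) \<partial>law \<partial>Pi\<^sub>M I (\<lambda>_. law))"
    unfolding sample_def I(3)
    by (subst prod.product_nn_integral_insert[OF I(1,2)]) (use m1 in \<open>auto simp: sample_def I(3)\<close>)
  also have "\<dots> = (\<integral>\<^sup>+x. \<integral>\<^sup>+p. \<integral>\<^sup>+t. K t (x(i := p)) * (ennreal (1 / S t) * indicator {snd p..fst p} t) \<partial>\<mu> \<partial>law \<partial>Pi\<^sub>M I (\<lambda>_. law))"
  proof (rule nn_integral_cong)
    fix x assume x: "x \<in> space (Pi\<^sub>M I (\<lambda>_. law))"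
    define f where "f = (\<lambda>a b. K a (x(i := (a, b))))"
    have upd [measurable]: "(\<lambda>p. x(i := p)) \<in> borel \<Otimes>\<^sub>M borel \<rightarrow>\<^sub>M sample n"
      using measurable_component_update[OF x I(2)] 
      by (simp add: measurable_cong_sets[OF sets_law sets_n[symmetric], symmetric])
    have f[measurable]: "(\<lambda>p. f (fst p) (snd p)) \<in> borel_measurable (borel \<Otimes>\<^sub>M borel)"
      using measurable_compose[OF measurable_Pair[OF measurable_fst upd] K] by (simp add: f_def)
    have [measurable]: "Measurable.pred (borel \<Otimes>\<^sub>M borel) (\<lambda>p::real\<times>real. snd p \<in> {..fst p})"
      "Measurable.pred (borel \<Otimes>\<^sub>M borel) (\<lambda>p::real\<times>real. fst p \<in> {snd p..})" 
      "Measurable.pred (borel \<Otimes>\<^sub>M borel) (\<lambda>p::real\<times>real. snd p \<in> {fst p..})" 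
      "Measurable.pred ((borel \<Otimes>\<^sub>M borel) \<Otimes>\<^sub>M borel) (\<lambda>p::(real\<times>real)\<times>real. snd p \<in> {snd (fst p)..fst (fst p)})" 
      by simp_all
    have "(\<integral>\<^sup>+p. \<integral>\<^sup>+t. K t (x(i := p)) * (ennreal (1 / S t) * indicator {snd p..fst p} t) \<partial>\<mu> \<partial>law)
        = (\<integral>\<^sup>+p. \<integral>\<^sup>+t. f t (snd p) * (ennreal (1 / S t) * indicator {snd p..fst p} t) \<partial>\<mu> \<partial>law)"
    proof (intro nn_integral_cong)
      fix p :: "real \<times> real" and t
      have "K t (x(i := p)) = f t (snd p)" if "t \<le> fst p"
        using pred i that unfolding predictable_def f_def
        by (metis fun_upd_same fun_upd_upd)
      then show "K t (x(i := p)) * (ennreal (1 / S t) * indicator {snd p..fst p} t)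
          = f t (snd p) * (ennreal (1 / S t) * indicator {snd p..fst p} t)"
        by (auto simp: indicator_def)
    qed
    also have "\<dots> = ennreal (1 / \<alpha>) * (\<integral>\<^sup>+b. \<integral>\<^sup>+a. (\<integral>\<^sup>+t. f t b * (ennreal (1 / S t) * indicator {b..a} t) \<partial>\<mu>) * indicator {b..} a \<partial>\<mu> \<partial>\<nu>)"
    proof (subst nn_integral_law)
      show "(\<lambda>p. \<integral>\<^sup>+t. f t (snd p) * (ennreal (1 / S t) * indicator {snd p..fst p} t) \<partial>\<mu>) \<in> borel_measurable (borel \<Otimes>\<^sub>M borel)"
      proof (rule X.borel_measurable_nn_integral)
        have "(\<lambda>p. (snd p, snd (fst p))) \<in> ((borel \<Otimes>\<^sub>M borel) \<Otimes>\<^sub>M borel) \<rightarrow>\<^sub>M (borel \<Otimes>\<^sub>M borel :: (real \<times> real) measure)"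
          by measurable
        from measurable_compose[OF this f]
        have "(\<lambda>p. f (snd p) (snd (fst p))) \<in> borel_measurable ((borel \<Otimes>\<^sub>M borel) \<Otimes>\<^sub>M borel)"
          by simp
        then show "(\<lambda>(p, t). f t (snd p) * (ennreal (1 / S t) * indicator {snd p..fst p} t)) \<in> borel_measurable ((borel \<Otimes>\<^sub>M borel) \<Otimes>\<^sub>M \<mu>)"
          by (simp add: split_beta', measurable)
      qed
    qed simp
    also have "(\<integral>\<^sup>+b. \<integral>\<^sup>+a. (\<integral>\<^sup>+t. f t b * (ennreal (1 / S t) * indicator {b..a} t) \<partial>\<mu>) * indicator {b..} a \<partial>\<mu> \<partial>\<nu>)
        = (\<integral>\<^sup>+b. \<integral>\<^sup>+t. f t b * indicator {b..} t \<partial>\<mu> \<partial>\<nu>)"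
    proof (rule nn_integral_cong)
      fix b
      interpret XX: pair_sigma_finite \<mu> \<mu> ..
      have fb[measurable]: "(\<lambda>t. f t b) \<in> borel_measurable borel"
        using measurable_compose[OF _ f, of "\<lambda>t. (t, b)" borel] by simp
      have "(\<integral>\<^sup>+a. (\<integral>\<^sup>+t. f t b * (ennreal (1 / S t) * indicator {b..a} t) \<partial>\<mu>) * indicator {b..} a \<partial>\<mu>)
          = (\<integral>\<^sup>+a. \<integral>\<^sup>+t. (f t b * ennreal (1 / S t) * indicator {b..} t) * indicator {t..} a \<partial>\<mu> \<partial>\<mu>)"
        by (subst nn_integral_multc[symmetric]) (auto intro!: nn_integral_cong simp: indicator_def)
      also have "\<dots> = (\<integral>\<^sup>+t. \<integral>\<^sup>+a. (f t b * ennreal (1 / S t) * indicator {b..} t) * indicator {t..} a \<partial>\<mu> \<partial>\<mu>)"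
        by (rule XX.Fubini') (simp add: split_beta', measurable)
      also have "\<dots> = (\<integral>\<^sup>+t. f t b * indicator {b..} t \<partial>\<mu>)"
      proof (rule nn_integral_cong_AE, use AE_S_pos in eventually_elim)
        case (elim t)
        have "(\<integral>\<^sup>+a. (f t b * ennreal (1 / S t) * indicator {b..} t) * indicator {t..} a \<partial>\<mu>)
            = f t b * ennreal (1 / S t) * indicator {b..} t * ennreal (S t)"
          by (subst nn_integral_cmult_indicator) (auto simp: emeasure_atLeast)
        also have "\<dots> = f t b * indicator {b..} t * (ennreal (1 / S t) * ennreal (S t))"
          by (simp add: mult_ac)
        also have "ennreal (1 / S t) * ennreal (S t) = 1"
          using elim by (simp flip: ennreal_mult)
        finally show ?case by simp
      qed
      finally show "(\<integral>\<^sup>+a. (\<integral>\<^sup>+t. f t b * (ennreal (1 / S t) * indicator {b..a} t) \<partial>\<mu>) * indicator {b..} a \<partial>\<mu>)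
         = (\<integral>\<^sup>+t. f t b * indicator {b..} t \<partial>\<mu>)" .
    qed
    also have "ennreal (1 / \<alpha>) * (\<integral>\<^sup>+b. \<integral>\<^sup>+t. f t b * indicator {b..} t \<partial>\<mu> \<partial>\<nu>)
       = (\<integral>\<^sup>+p. f (fst p) (snd p) \<partial>law)"
      by (subst nn_integral_law) auto
    finally show "(\<integral>\<^sup>+p. K (fst p) (x(i := p)) \<partial>law)
      = (\<integral>\<^sup>+p. \<integral>\<^sup>+t. K t (x(i := p)) * (ennreal (1 / S t) * indicator {snd p..fst p} t) \<partial>\<mu> \<partial>law)"
      unfolding f_def prod.collapse by (rule sym)
  qed
  also have "\<dots> = (\<integral>\<^sup>+z. \<integral>\<^sup>+t. K t z * (ennreal (1 / S t) * indicator {snd (z i)..fst (z i)} t) \<partial>\<mu> \<partial>sample n)"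
    unfolding sample_def I(3)
    by (subst prod.product_nn_integral_insert[OF I(1,2)]) (use m2 in \<open>auto simp: sample_def I(3)\<close>)
  finally show ?thesis .
qed

text \<open>
Individual \<open>i\<close> contributes \<open>d\<Lambda>\<close> on \<open>[Y\<^sub>i, X\<^sub>i]\<close>, and the indicators of these intervals add up to \<open>N\<close>.
\<close>

theorem compensator:
  fixes K :: "real \<Rightarrow> (nat \<Rightarrow> real \<times> real) \<Rightarrow> ennreal"
  assumes K[measurable]: "case_prod K \<in> borel_measurable (borel \<Otimes>\<^sub>M sample n)"
    and pred: "predictable n K"
  shows "(\<integral>\<^sup>+z. (\<Sum>i<n. K (fst (z i)) z) \<partial>sample n)
    = (\<integral>\<^sup>+z. \<integral>\<^sup>+t. K t z * ennreal (at_risk n t z / S t) \<partial>\<mu> \<partial>sample n)"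
proof -
  have K2 [measurable]: "(\<lambda>p. K (snd p) (fst p)) \<in> borel_measurable (sample n \<Otimes>\<^sub>M borel)"
    using measurable_compose[OF measurable_pair_swap' K] by (simp add: split_beta')
  have S_ind [measurable]: "Measurable.pred (sample n \<Otimes>\<^sub>M borel) (\<lambda>p. snd p \<in> {snd (fst p i)..fst (fst p i)})" if "i < n" for i
    using fst_component_measurable[OF that, measurable] snd_component_measurable[OF that, measurable]
    unfolding atLeastAtMost_iff by measurable
  have m2: "(\<lambda>z. \<integral>\<^sup>+t. K t z * (ennreal (1 / S t) * indicator {snd (z i)..fst (z i)} t) \<partial>\<mu>) \<in> borel_measurable (sample n)" if "i < n" for i
    by (rule X.borel_measurable_nn_integral) (use that in \<open>simp add: split_beta', measurable\<close>)
  have m1: "(\<lambda>z. K (fst (z i)) z) \<in> borel_measurable (sample n)" if "i < n" for i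
  proof -
    have "(\<lambda>z. (fst (z i), z)) \<in> sample n \<rightarrow>\<^sub>M borel \<Otimes>\<^sub>M sample n" using fst_component_measurable[OF that, measurable] by measurable
    from measurable_compose[OF this K] show ?thesis by simp
  qed
  have "(\<integral>\<^sup>+z. (\<Sum>i<n. K (fst (z i)) z) \<partial>sample n) = (\<Sum>i<n. \<integral>\<^sup>+z. K (fst (z i)) z \<partial>sample n)"
    by (rule nn_integral_sum) (simp add: m1)
  also have "\<dots> = (\<Sum>i<n. \<integral>\<^sup>+z. \<integral>\<^sup>+t. K t z * (ennreal (1 / S t) * indicator {snd (z i)..fst (z i)} t) \<partial>\<mu> \<partial>sample n)"
    by (intro sum.cong refl compensator_component K pred) simp
  also have "\<dots> = (\<integral>\<^sup>+z. (\<Sum>i<n. \<integral>\<^sup>+t. K t z * (ennreal (1 / S t) * indicator {snd (z i)..fst (z i)} t) \<partial>\<mu>) \<partial>sample n)"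
    by (rule nn_integral_sum[symmetric]) (simp add: m2)
  also have "\<dots> = (\<integral>\<^sup>+z. \<integral>\<^sup>+t. K t z * ennreal (at_risk n t z / S t) \<partial>\<mu> \<partial>sample n)"
  proof (rule nn_integral_cong)
    fix z assume z: "z \<in> space (sample n)"
    have Kz[measurable]: "(\<lambda>t. K t z) \<in> borel_measurable borel"
      using measurable_compose[OF measurable_Pair2'[OF z] K] by simp
    have "(\<Sum>i<n. \<integral>\<^sup>+t. K t z * (ennreal (1 / S t) * indicator {snd (z i)..fst (z i)} t) \<partial>\<mu>)
        = (\<integral>\<^sup>+t. (\<Sum>i<n. K t z * (ennreal (1 / S t) * indicator {snd (z i)..fst (z i)} t)) \<partial>\<mu>)"
      by (rule nn_integral_sum[symmetric]) measurable
    also have "\<dots> = (\<integral>\<^sup>+t. K t z * ennreal (at_risk n t z / S t) \<partial>\<mu>)"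
    proof (rule nn_integral_cong)
      fix t
      have "ennreal (at_risk n t z / S t) = (\<Sum>i<n. ennreal (1 / S t) * indicator {snd (z i)..fst (z i)} t)"
      proof -
        have "ennreal (at_risk n t z / S t) = (\<Sum>i<n. ennreal ((if snd (z i) \<le> t \<and> t \<le> fst (z i) then 1 else 0) / S t))"
          unfolding at_risk_def sum_divide_distrib by (rule sum_ennreal[symmetric]) auto
        also have "\<dots> = (\<Sum>i<n. ennreal (1 / S t) * indicator {snd (z i)..fst (z i)} t)"
          by (rule sum.cong) (auto simp: indicator_def)
        finally show ?thesis .
      qed
      then show "(\<Sum>i<n. K t z * (ennreal (1 / S t) * indicator {snd (z i)..fst (z i)} t)) = K t z * ennreal (at_risk n t z / S t)"
        by (simp only: sum_distrib_left)
    qed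
    finally show "(\<Sum>i<n. \<integral>\<^sup>+t. K t z * (ennreal (1 / S t) * indicator {snd (z i)..fst (z i)} t) \<partial>\<mu>)
       = (\<integral>\<^sup>+t. K t z * ennreal (at_risk n t z / S t) \<partial>\<mu>)" .
  qed
  finally show ?thesis .
qed

section \<open>Compensated sums and their second moments\<close>

lemma AE_law_fst:
  assumes Q: "AE x in \<mu>. Q x" and [measurable]: "Measurable.pred borel Q"
  shows "AE p in law. Q (fst p)"
proof (rule AE_I)
  let ?A = "{x. \<not> Q x}"
  have A[measurable]: "?A \<in> sets borel" by measurable
  have "emeasure \<mu> ?A = 0" using Q by (subst (asm) AE_iff_measurable[OF _ refl]) auto
  show "emeasure law (?A \<times> UNIV) = 0"
  proof (subst emeasure_law_Times)
    have "(\<integral>\<^sup>+x. emeasure \<nu> ({..x} \<inter> UNIV) * indicator ?A x \<partial>\<mu>) = (\<integral>\<^sup>+x. 0 \<partial>\<mu>)"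
      by (rule nn_integral_cong_AE, use Q in eventually_elim) auto
    then show "ennreal (1 / \<alpha>) * (\<integral>\<^sup>+x. emeasure \<nu> ({..x} \<inter> UNIV) * indicator ?A x \<partial>\<mu>) = 0"
      by simp
  qed auto
  show "?A \<times> UNIV \<in> sets law" by simp
qed auto

lemma AE_law_truncated: "AE p in law. snd p \<le> fst p"
  unfolding law_def by (subst AE_density) (auto intro!: AE_I2 simp: indicator_def)

lemma AE_sample_component:
  assumes "AE p in law. Q p"
  shows "AE z in sample n. \<forall>i<n. Q (z i)"
proof -
  have "AE z in sample n. \<forall>i\<in>{..<n}. Q (z i)"
  proof (intro AE_finite_allI)
    fix i assume "i \<in> {..<n}"
    then show "AE z in sample n. Q (z i)"
      unfolding sample_def
      by (intro AE_PiM_component) (auto intro: law.prob_space_axioms assms)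
  qed simp
  then show ?thesis by eventually_elim auto
qed

lemma AE_sample_S_pos: "AE z in sample n. \<forall>i<n. 0 < S (fst (z i))"
  by (rule AE_sample_component, rule AE_law_fst[OF AE_S_pos]) measurable

lemma AE_sample_truncated: "AE z in sample n. \<forall>i<n. snd (z i) \<le> fst (z i)"
  by (rule AE_sample_component, rule AE_law_truncated)

lemma AE_sample_distinct: "AE z in sample n. inj_on (\<lambda>i. fst (z i)) {..<n}"
proof -
  have "AE z in sample n. fst (z i) \<noteq> fst (z j)" if ij: "i < n" "j < n" "i \<noteq> j" for i j
  proof -
    define I where "I = {..<n} - {i}"
    have I: "finite I" "i \<notin> I" "{..<n} = insert i I" using ij by (auto simp: I_def)
    note [measurable] = fst_component_measurable[OF ij(1)] fst_component_measurable[OF ij(2)]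
    let ?A = "{z \<in> space (sample n). fst (z i) = fst (z j)}"
    have A[measurable]: "?A \<in> sets (sample n)" by measurable
    have "emeasure (sample n) ?A = (\<integral>\<^sup>+z. indicator ?A z \<partial>sample n)" by simp
    also have "\<dots> = (\<integral>\<^sup>+x. \<integral>\<^sup>+p. indicator ?A (x(i := p)) \<partial>law \<partial>Pi\<^sub>M I (\<lambda>_. law))"
      using A unfolding sample_def I(3)
      by (subst prod.product_nn_integral_insert[OF I(1,2)]) auto
    also have "\<dots> = (\<integral>\<^sup>+x. 0 \<partial>Pi\<^sub>M I (\<lambda>_. law))"
    proof (rule nn_integral_cong)
      fix x :: "nat \<Rightarrow> real \<times> real"
      have "AE p in law. fst p \<noteq> fst (x j)"
      proof (rule AE_law_fst)
        show "AE a in \<mu>. a \<noteq> fst (x j)"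
          by (rule AE_I[of _ _ "{fst (x j)}"]) (auto simp: X.emeasure_eq_measure atomless)
      qed measurable
      then have "(\<integral>\<^sup>+p. indicator ?A (x(i := p)) \<partial>law) = (\<integral>\<^sup>+p. 0 \<partial>law)"
        by (intro nn_integral_cong_AE, eventually_elim) (use ij in \<open>auto simp: indicator_def\<close>)
      then show "(\<integral>\<^sup>+p. indicator ?A (x(i := p)) \<partial>law) = 0" by simp
    qed
    finally have "emeasure (sample n) ?A = 0" by simp
    then show ?thesis by (intro AE_I[of _ _ ?A]) auto
  qed
  then have "AE z in sample n. \<forall>i\<in>{..<n}. \<forall>j\<in>{..<n}. i \<noteq> j \<longrightarrow> fst (z i) \<noteq> fst (z j)"
    by (intro AE_finite_allI) (auto intro!: AE_I2)
  then show ?thesis by eventually_elim (auto simp: inj_on_def)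
qed

text \<open>
In the language of counting processes this is \<open>\<integral> H dM\<close>, where \<open>M\<close> is the compensated counting process of the \<open>X\<^sub>i\<close>.
\<close>

definition comp_sum :: "nat \<Rightarrow> (real \<Rightarrow> (nat \<Rightarrow> real \<times> real) \<Rightarrow> real) \<Rightarrow> (nat \<Rightarrow> real \<times> real) \<Rightarrow> real" where
  "comp_sum n H z = (\<Sum>i<n. H (fst (z i)) z) - (LINT t|\<mu>. H t z * (at_risk n t z / S t))"

lemma measurable_at_observation:
  assumes H: "case_prod H \<in> M' \<Otimes>\<^sub>M sample n \<rightarrow>\<^sub>M N" and sM': "sets M' = sets borel" and "i < n"
  shows "(\<lambda>z. H (fst (z i)) z) \<in> sample n \<rightarrow>\<^sub>M N"
proof -
  have "(\<lambda>z. fst (z i)) \<in> sample n \<rightarrow>\<^sub>M M'"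
    using fst_component_measurable[OF \<open>i < n\<close>] by (simp add: measurable_cong_sets[OF refl sM'])
  then have "(\<lambda>z. (fst (z i), z)) \<in> sample n \<rightarrow>\<^sub>M M' \<Otimes>\<^sub>M sample n" by measurable
  from measurable_compose[OF this H] show ?thesis by simp
qed

lemma compensated_process_measurable:
  assumes H: "case_prod H \<in> borel_measurable (borel \<Otimes>\<^sub>M sample n)"
  shows "(\<lambda>p. H (snd p) (fst p) * (at_risk n (snd p) (fst p) / S (snd p))) \<in> borel_measurable (sample n \<Otimes>\<^sub>M borel)"
proof -
  have [measurable]: "(\<lambda>p. H (snd p) (fst p)) \<in> borel_measurable (sample n \<Otimes>\<^sub>M borel)"
    using measurable_compose[OF measurable_pair_swap' H] by (simp add: split_beta')
  show ?thesis by measurable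
qed

lemma comp_sum_measurable:
  assumes H: "case_prod H \<in> borel_measurable (borel \<Otimes>\<^sub>M sample n)"
  shows "comp_sum n H \<in> borel_measurable (sample n)"
proof -
  have 1: "(\<lambda>z. (\<Sum>i<n. H (fst (z i)) z)) \<in> borel_measurable (sample n)"
    by (intro borel_measurable_sum measurable_at_observation[OF H]) auto
  have 2: "(\<lambda>z. LINT t|\<mu>. H t z * (at_risk n t z / S t)) \<in> borel_measurable (sample n)"
    by (rule X.borel_measurable_lebesgue_integral)
       (use compensated_process_measurable[OF H] in \<open>simp add: split_beta'\<close>)
  show ?thesis unfolding comp_sum_def[abs_def] by (intro borel_measurable_diff 1 2)
qed

lemma section_measurable:
  assumes H: "case_prod H \<in> borel \<Otimes>\<^sub>M sample n \<rightarrow>\<^sub>M N" and z: "z \<in> space (sample n)"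
  shows "(\<lambda>t. H t z) \<in> borel \<rightarrow>\<^sub>M N"
  using measurable_compose[OF measurable_Pair2'[OF z] H] by simp

text \<open>
The diagonal of the square is a null set, and the two triangles contribute equally.
\<close>

lemma square_integral_atomless:
  fixes f :: "real \<Rightarrow> real"
  assumes [measurable]: "f \<in> borel_measurable borel" and b: "\<And>t. \<bar>f t\<bar> \<le> b"
  shows "(LINT t|\<mu>. f t)\<^sup>2 = 2 * (LINT t|\<mu>. (LINT s|\<mu>. indicator {..<t} s * f s) * f t)"
proof -
  interpret PP: pair_prob_space \<mu> \<mu> ..
  have b0: "0 \<le> b" using b[of 0] by linarith
  have [measurable]: "Measurable.pred (borel \<Otimes>\<^sub>M borel) (\<lambda>p::real\<times>real. snd p \<in> {..<fst p})"
      "Measurable.pred (borel \<Otimes>\<^sub>M borel) (\<lambda>p::real\<times>real. fst p \<in> {..<snd p})" 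
      "Measurable.pred (borel \<Otimes>\<^sub>M borel) (\<lambda>p::real\<times>real. snd p \<in> {fst p<..})" by simp_all
  have fi: "integrable \<mu> f" by (rule X.integrable_const_bound[where B=b]) (auto intro: b)
  have gi: "integrable \<mu> (\<lambda>s. indicator A s * f s)" if "A \<in> sets borel" for A
    by (rule X.integrable_const_bound[where B=b]) (use that in \<open>auto intro: b simp: indicator_def b0\<close>)
  let ?p = "\<lambda>t. LINT s|\<mu>. indicator {..<t} s * f s"
  let ?q = "\<lambda>t. LINT s|\<mu>. indicator {t<..} s * f s"
  have bnd: "\<bar>LINT s|\<mu>. indicator A s * f s\<bar> \<le> b" if A: "A \<in> sets borel" for A
  proof -
    have "\<bar>LINT s|\<mu>. indicator A s * f s\<bar> \<le> (LINT s|\<mu>. b)"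
      by (rule integral_abs_bound[THEN order_trans], rule integral_mono[OF integrable_abs[OF gi[OF A]]])
         (auto simp: indicator_def b b0)
    then show ?thesis using X.prob_space by simp
  qed
  have pm[measurable]: "?p \<in> borel_measurable borel" "?q \<in> borel_measurable borel"
    by (rule X.borel_measurable_lebesgue_integral; simp add: split_beta', measurable)+
  have pi: "integrable \<mu> (\<lambda>t. ?p t * f t)" "integrable \<mu> (\<lambda>t. ?q t * f t)"
    by (rule X.integrable_const_bound[where B="b*b"];
        auto simp: abs_mult intro!: AE_I2 mult_mono bnd b b0)+
  have split: "(LINT s|\<mu>. f s) = ?p t + ?q t" for t
  proof -
    have ne: "AE s in \<mu>. s \<noteq> t"
      by (rule AE_I[of _ _ "{t}"]) (auto simp: X.emeasure_eq_measure atomless)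
    have "?p t + ?q t = (LINT s|\<mu>. indicator {..<t} s * f s + indicator {t<..} s * f s)"
      by (rule Bochner_Integration.integral_add[symmetric]) (auto intro: gi)
    also have "\<dots> = (LINT s|\<mu>. f s)"
      by (rule integral_cong_AE) (measurable, use ne in eventually_elim, auto simp: indicator_def)
    finally show ?thesis by simp
  qed
  have "(LINT t|\<mu>. ?q t * f t) = (LINT t|\<mu>. LINT s|\<mu>. indicator {..<s} t * f s * f t)"
    by (intro Bochner_Integration.integral_cong refl, subst integral_mult_left_zero[symmetric])
       (auto intro!: Bochner_Integration.integral_cong simp: indicator_def)
  also have "\<dots> = (LINT s|\<mu>. LINT t|\<mu>. indicator {..<s} t * f s * f t)"
  proof (rule PP.Fubini_integral)
    show "integrable (\<mu> \<Otimes>\<^sub>M \<mu>) (\<lambda>(s, t). indicator {..<s} t * f s * f t)"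
      by (rule PP.integrable_const_bound[where B="b*b"])
         (auto simp: abs_mult indicator_def b0 intro!: AE_I2 mult_mono b)
  qed
  also have "\<dots> = (LINT t|\<mu>. ?p t * f t)"
    by (intro Bochner_Integration.integral_cong refl, subst integral_mult_left_zero[symmetric])
       (auto intro!: Bochner_Integration.integral_cong simp: mult_ac)
  finally have sym: "(LINT t|\<mu>. ?q t * f t) = (LINT t|\<mu>. ?p t * f t)" .
  have "(LINT t|\<mu>. f t)\<^sup>2 = (LINT t|\<mu>. (LINT s|\<mu>. f s) * f t)"
    by (simp add: power2_eq_square)
  also have "\<dots> = (LINT t|\<mu>. ?p t * f t + ?q t * f t)"
    by (intro Bochner_Integration.integral_cong refl) (metis split distrib_right)
  also have "\<dots> = (LINT t|\<mu>. ?p t * f t) + (LINT t|\<mu>. ?q t * f t)"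
    by (rule Bochner_Integration.integral_add) (rule pi)+
  finally show ?thesis using sym by simp
qed

end

lemma square_sum_distinct:
  fixes h :: "nat \<Rightarrow> real" and x :: "nat \<Rightarrow> real"
  assumes "inj_on x {..<n}"
  shows "(\<Sum>i<n. h i)\<^sup>2 = (\<Sum>i<n. (h i)\<^sup>2) + 2 * (\<Sum>i<n. (\<Sum>j<n. if x j < x i then h j else 0) * h i)"
proof -
  let ?L = "\<Sum>i<n. \<Sum>j<n. if x j < x i then h j * h i else 0"
  have e: "h i * h j = (if i = j then (h i)\<^sup>2 else 0) + (if x j < x i then h j * h i else 0) + (if x i < x j then h i * h j else 0)"
    if "i < n" "j < n" for i j
    using that assms by (auto simp: power2_eq_square inj_on_def not_less)
  have "(\<Sum>i<n. h i)\<^sup>2 = (\<Sum>i<n. \<Sum>j<n. h i * h j)"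
    by (simp add: power2_eq_square sum_product)
  also have "\<dots> = (\<Sum>i<n. \<Sum>j<n. (if i = j then (h i)\<^sup>2 else 0) + (if x j < x i then h j * h i else 0) + (if x i < x j then h i * h j else 0))"
    using e by (intro sum.cong refl) simp
  also have "\<dots> = (\<Sum>i<n. (h i)\<^sup>2) + ?L + (\<Sum>i<n. \<Sum>j<n. if x i < x j then h i * h j else 0)"
    by (simp add: sum.distrib)
  also have "(\<Sum>i<n. \<Sum>j<n. if x i < x j then h i * h j else 0) = ?L"
    by (rule sum.swap)
  finally show ?thesis by (simp add: sum_distrib_right if_distrib[of "\<lambda>a. a * _"] cong: if_cong)
qed

context truncation_model
begin

lemma bounded_section_integrable:
  assumes H: "case_prod H \<in> borel_measurable (borel \<Otimes>\<^sub>M sample n)" and z: "z \<in> space (sample n)"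
    and c: "\<And>t. \<bar>H t z\<bar> \<le> c" and \<delta>: "0 < \<delta>" "\<forall>t. H t z \<noteq> 0 \<longrightarrow> \<delta> \<le> S t"
  shows "(\<lambda>t. H t z * (at_risk n t z / S t)) \<in> borel_measurable borel"
    and "\<bar>H t z * (at_risk n t z / S t)\<bar> \<le> c * (n / \<delta>)"
    and "integrable \<mu> (\<lambda>t. H t z * (at_risk n t z / S t))"
proof -
  have zs: "(\<lambda>t. z) \<in> borel \<rightarrow>\<^sub>M sample n" using z by simp
  note [measurable] = section_measurable[OF H z] zs
  show m: "(\<lambda>t. H t z * (at_risk n t z / S t)) \<in> borel_measurable borel" by measurable
  have c0: "0 \<le> c" using c[of 0] by linarith
  have b: "\<bar>H t z * (at_risk n t z / S t)\<bar> \<le> c * (n / \<delta>)" for t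
  proof (cases "H t z = 0")
    case True then show ?thesis using c0 \<delta>(1) by simp
  next
    case False
    then have "\<delta> \<le> S t" using \<delta> by blast
    then have "at_risk n t z / S t \<le> n / \<delta>" using \<delta>(1) at_risk_le by (intro frac_le) auto
    then show ?thesis unfolding abs_mult using c by (intro mult_mono) (auto simp: c0)
  qed
  then show "\<bar>H t z * (at_risk n t z / S t)\<bar> \<le> c * (n / \<delta>)" .
  show "integrable \<mu> (\<lambda>t. H t z * (at_risk n t z / S t))"
    by (rule X.integrable_const_bound[where B="c * (n / \<delta>)"]) (use b m in auto)
qed

lemma compensator_bounded_nonneg:
  fixes H :: "real \<Rightarrow> (nat \<Rightarrow> real \<times> real) \<Rightarrow> real"
  assumes H: "case_prod H \<in> borel_measurable (borel \<Otimes>\<^sub>M sample n)" and pred: "predictable n H"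
    and c: "\<And>t z. \<bar>H t z\<bar> \<le> c" and \<delta>: "0 < \<delta>" "\<forall>z t. H t z \<noteq> 0 \<longrightarrow> \<delta> \<le> S t"
    and nn: "\<And>t z. 0 \<le> H t z"
  shows "integrable (sample n) (comp_sum n H)" and "(LINT z|sample n. comp_sum n H z) = 0"
proof -
  note sec = bounded_section_integrable[OF H _ c \<delta>(1) spec[OF \<delta>(2)]]
  let ?A = "\<lambda>z. \<Sum>i<n. H (fst (z i)) z" and ?B = "\<lambda>z. LINT t|\<mu>. H t z * (at_risk n t z / S t)"
  have Am: "?A \<in> borel_measurable (sample n)"
    by (intro borel_measurable_sum measurable_at_observation[OF H]) auto
  have Bm: "?B \<in> borel_measurable (sample n)"
    by (rule X.borel_measurable_lebesgue_integral)
       (use compensated_process_measurable[OF H] in \<open>simp add: split_beta'\<close>)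
  have Ai: "integrable (sample n) ?A"
  proof (rule sample.integrable_const_bound[where B="n * c"])
    show "AE z in sample n. norm (?A z) \<le> n * c"
    proof (rule AE_I2)
      fix z
      have "\<bar>?A z\<bar> \<le> (\<Sum>i<n. c)" by (rule sum_abs[THEN order_trans], intro sum_mono c)
      then show "norm (?A z) \<le> n * c" by simp
    qed
  qed (rule Am)
  have Bnn: "0 \<le> ?B z" for z
    by (intro integral_nonneg_AE AE_I2 mult_nonneg_nonneg divide_nonneg_nonneg nn) auto
  have Bi: "integrable (sample n) ?B"
  proof (rule sample.integrable_const_bound[where B="c * (n / \<delta>)"])
    show "AE z in sample n. norm (?B z) \<le> c * (n / \<delta>)"
    proof (rule AE_I2)
      fix z assume z: "z \<in> space (sample n)"
      have "?B z \<le> (LINT t|\<mu>. c * (n / \<delta>))"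
        by (rule integral_mono[OF sec(3)[OF z]]) (use sec(2)[OF z] in \<open>auto intro: order_trans[OF abs_ge_self]\<close>)
      then show "norm (?B z) \<le> c * (n / \<delta>)" using Bnn[of z] X.prob_space by simp
    qed
  qed (rule Bm)
  have "ennreal (LINT z|sample n. ?A z) = (\<integral>\<^sup>+z. ennreal (?A z) \<partial>sample n)"
    by (rule nn_integral_eq_integral[symmetric, OF Ai]) (auto intro: sum_nonneg nn)
  also have "\<dots> = (\<integral>\<^sup>+z. (\<Sum>i<n. ennreal (H (fst (z i)) z)) \<partial>sample n)"
    by (intro nn_integral_cong sum_ennreal[symmetric] nn)
  also have "\<dots> = (\<integral>\<^sup>+z. \<integral>\<^sup>+t. ennreal (H t z) * ennreal (at_risk n t z / S t) \<partial>\<mu> \<partial>sample n)"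
  proof (rule compensator)
    show "(\<lambda>(t, z). ennreal (H t z)) \<in> borel_measurable (borel \<Otimes>\<^sub>M sample n)"
      using H by (simp add: split_beta')
    show "predictable n (\<lambda>t z. ennreal (H t z))" using pred by (simp add: predictable_def)
  qed
  also have "\<dots> = (\<integral>\<^sup>+z. ennreal (?B z) \<partial>sample n)"
  proof (rule nn_integral_cong)
    fix z assume z: "z \<in> space (sample n)"
    have "(\<integral>\<^sup>+t. ennreal (H t z) * ennreal (at_risk n t z / S t) \<partial>\<mu>) = (\<integral>\<^sup>+t. ennreal (H t z * (at_risk n t z / S t)) \<partial>\<mu>)"
      by (intro nn_integral_cong ennreal_mult'[symmetric] nn)
    also have "\<dots> = ennreal (?B z)"
      by (rule nn_integral_eq_integral[OF sec(3)[OF z]])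
         (rule AE_I2, intro mult_nonneg_nonneg divide_nonneg_nonneg nn at_risk_nonneg S_nonneg)
    finally show "(\<integral>\<^sup>+t. ennreal (H t z) * ennreal (at_risk n t z / S t) \<partial>\<mu>) = ennreal (?B z)" .
  qed
  also have "\<dots> = ennreal (LINT z|sample n. ?B z)"
    by (rule nn_integral_eq_integral[OF Bi]) (rule AE_I2, rule Bnn)
  finally have eq: "(LINT z|sample n. ?A z) = (LINT z|sample n. ?B z)"
    by (subst (asm) ennreal_inj) (auto intro!: integral_nonneg_AE sum_nonneg nn AE_I2 Bnn simp del: times_divide_eq_right)
  show "integrable (sample n) (comp_sum n H)"
    unfolding comp_sum_def[abs_def] by (rule Bochner_Integration.integrable_diff[OF Ai Bi])
  show "(LINT z|sample n. comp_sum n H z) = 0"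
    unfolding comp_sum_def Bochner_Integration.integral_diff[OF Ai Bi] eq by simp
qed

lemma compensator_bounded:
  fixes H :: "real \<Rightarrow> (nat \<Rightarrow> real \<times> real) \<Rightarrow> real"
  assumes H: "case_prod H \<in> borel_measurable (borel \<Otimes>\<^sub>M sample n)" and pred: "predictable n H"
    and c: "\<And>t z. \<bar>H t z\<bar> \<le> c" and \<delta>: "0 < \<delta>" "\<forall>z t. H t z \<noteq> 0 \<longrightarrow> \<delta> \<le> S t"
  shows "integrable (sample n) (comp_sum n H)" and "(LINT z|sample n. comp_sum n H z) = 0"
proof -
  let ?P = "\<lambda>t z. max 0 (H t z)" and ?N = "\<lambda>t z. max 0 (- H t z)"
  have mP: "case_prod ?P \<in> borel_measurable (borel \<Otimes>\<^sub>M sample n)" and mN: "case_prod ?N \<in> borel_measurable (borel \<Otimes>\<^sub>M sample n)"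
    using H by (simp_all add: split_beta')
  have cP: "\<bar>?P t z\<bar> \<le> c" and cN: "\<bar>?N t z\<bar> \<le> c" for t z
    using c[of t z] by (auto simp: max_def abs_if split: if_splits)
  have dP: "\<forall>z t. ?P t z \<noteq> 0 \<longrightarrow> \<delta> \<le> S t" and dN: "\<forall>z t. ?N t z \<noteq> 0 \<longrightarrow> \<delta> \<le> S t"
    using \<delta>(2) by (auto simp: max_def)
  have pP: "predictable n ?P" and pN: "predictable n ?N" using pred by (auto simp: predictable_def)
  note P = compensator_bounded_nonneg[OF mP pP cP \<delta>(1) dP max.cobounded1]
  note N = compensator_bounded_nonneg[OF mN pN cN \<delta>(1) dN max.cobounded1]
  have eq: "comp_sum n H z = comp_sum n ?P z - comp_sum n ?N z" if z: "z \<in> space (sample n)" for z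
  proof -
    have "(LINT t|\<mu>. H t z * (at_risk n t z / S t))
      = (LINT t|\<mu>. ?P t z * (at_risk n t z / S t) - ?N t z * (at_risk n t z / S t))"
      by (intro Bochner_Integration.integral_cong refl) (auto simp: max_def)
    also have "\<dots> = (LINT t|\<mu>. ?P t z * (at_risk n t z / S t)) - (LINT t|\<mu>. ?N t z * (at_risk n t z / S t))"
      by (rule Bochner_Integration.integral_diff[OF bounded_section_integrable(3)[OF mP z cP \<delta>(1) spec[OF dP]] bounded_section_integrable(3)[OF mN z cN \<delta>(1) spec[OF dN]]])
    moreover have "(\<Sum>i<n. H (fst (z i)) z) = (\<Sum>i<n. ?P (fst (z i)) z) - (\<Sum>i<n. ?N (fst (z i)) z)"
      unfolding sum_subtractf[symmetric] by (intro sum.cong refl) (auto simp: max_def)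
    ultimately show ?thesis by (simp add: comp_sum_def)
  qed
  have "integrable (sample n) (\<lambda>z. comp_sum n ?P z - comp_sum n ?N z)"
    by (rule Bochner_Integration.integrable_diff[OF P(1) N(1)])
  then show "integrable (sample n) (comp_sum n H)"
    by (subst Bochner_Integration.integrable_cong[OF refl eq]) auto
  have "(LINT z|sample n. comp_sum n H z) = (LINT z|sample n. comp_sum n ?P z - comp_sum n ?N z)"
    by (intro Bochner_Integration.integral_cong refl eq)
  also have "\<dots> = 0" using P N by (subst Bochner_Integration.integral_diff) auto
  finally show "(LINT z|sample n. comp_sum n H z) = 0" .
qed

text \<open>
The product rule \<open>D\<^sup>2 = 2 \<integral> D\<^sub>- dD + \<Sum> (\<Delta>D)\<^sup>2\<close> for the path of the compensated sum \<open>D\<close>. It is verified by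
splitting the square of the jump part, the square of the continuous part and their product according to which
of the two times is the larger; distinctness of the \<open>X\<^sub>i\<close> excludes ties.
\<close>

lemma comp_sum_square:
  fixes H :: "real \<Rightarrow> (nat \<Rightarrow> real \<times> real) \<Rightarrow> real"
  assumes H: "case_prod H \<in> borel_measurable (borel \<Otimes>\<^sub>M sample n)" and z: "z \<in> space (sample n)"
    and c: "\<And>t. \<bar>H t z\<bar> \<le> c" and \<delta>: "0 < \<delta>" "\<forall>t. H t z \<noteq> 0 \<longrightarrow> \<delta> \<le> S t"
    and inj: "inj_on (\<lambda>i. fst (z i)) {..<n}"
  defines "K \<equiv> \<lambda>t z. ((\<Sum>j<n. if fst (z j) < t then H (fst (z j)) z else 0)
      - (LINT s|\<mu>. indicator {..<t} s * (H s z * (at_risk n s z / S s)))) * H t z"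
  shows "(comp_sum n H z)\<^sup>2 = 2 * comp_sum n K z + (\<Sum>i<n. (H (fst (z i)) z)\<^sup>2)"
proof -
  note sec = bounded_section_integrable[OF H z c \<delta>]
  define f where "f = (\<lambda>t. H t z * (at_risk n t z / S t))"
  have fm[measurable]: "f \<in> borel_measurable borel" and fb: "\<And>t. \<bar>f t\<bar> \<le> c * (n / \<delta>)" and fi: "integrable \<mu> f"
    using sec unfolding f_def by auto
  define b where "b = c * (n / \<delta>)"
  have b0: "0 \<le> b" using fb[of 0] unfolding b_def by linarith
  define x where "x i = fst (z i)" for i
  define h where "h i = H (x i) z" for i
  define B where "B t = (LINT s|\<mu>. indicator {..<t} s * f s)" for t
  define J where "J t = (\<Sum>j<n. if x j < t then h j else 0)" for t
  have [measurable]: "Measurable.pred (borel \<Otimes>\<^sub>M borel) (\<lambda>p::real\<times>real. snd p \<in> {..<fst p})" by simp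
  have gi: "integrable \<mu> (\<lambda>s. indicator A s * f s)" if "A \<in> sets borel" for A
    by (rule X.integrable_const_bound[where B=b]) (use that in \<open>auto intro: fb[folded b_def] simp: indicator_def b0\<close>)
  have Bb: "\<bar>B t\<bar> \<le> b" for t
  proof -
    have "\<bar>B t\<bar> \<le> (LINT s|\<mu>. b)"
      unfolding B_def
      by (rule integral_abs_bound[THEN order_trans], rule integral_mono[OF integrable_abs[OF gi]])
         (auto simp: indicator_def fb[folded b_def] b0)
    then show ?thesis using X.prob_space by simp
  qed
  have Bm[measurable]: "B \<in> borel_measurable borel"
    unfolding B_def[abs_def] by (rule X.borel_measurable_lebesgue_integral; simp add: split_beta', measurable)
  have Bfi: "integrable \<mu> (\<lambda>t. B t * f t)"
    by (rule X.integrable_const_bound[where B="b*b"])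
       (auto simp: abs_mult intro!: AE_I2 mult_mono Bb fb[folded b_def] b0)
  have Jf: "(\<lambda>t. J t * f t) = (\<lambda>t. \<Sum>j<n. h j * (indicator {x j<..} t * f t))"
    by (auto simp: J_def sum_distrib_right fun_eq_iff intro!: sum.cong)
  have Jfi: "integrable \<mu> (\<lambda>t. J t * f t)"
    unfolding Jf by (intro Bochner_Integration.integrable_sum integrable_mult_right gi) auto
  have split: "(LINT s|\<mu>. f s) = B t + (LINT s|\<mu>. indicator {t<..} s * f s)" for t
  proof -
    have ne: "AE s in \<mu>. s \<noteq> t"
      by (rule AE_I[of _ _ "{t}"]) (auto simp: X.emeasure_eq_measure atomless)
    have "B t + (LINT s|\<mu>. indicator {t<..} s * f s) = (LINT s|\<mu>. indicator {..<t} s * f s + indicator {t<..} s * f s)"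
      unfolding B_def by (rule Bochner_Integration.integral_add[symmetric]) (auto intro: gi)
    also have "\<dots> = (LINT s|\<mu>. f s)"
      by (rule integral_cong_AE) (measurable, use ne in eventually_elim, auto simp: indicator_def)
    finally show ?thesis by simp
  qed
  have 1: "(\<Sum>i<n. h i)\<^sup>2 = (\<Sum>i<n. (h i)\<^sup>2) + 2 * (\<Sum>i<n. J (x i) * h i)"
    unfolding J_def by (rule square_sum_distinct) (use inj in \<open>simp add: x_def inj_on_def\<close>)
  have 2: "(LINT t|\<mu>. f t)\<^sup>2 = 2 * (LINT t|\<mu>. B t * f t)"
    unfolding B_def by (rule square_integral_atomless) (rule fm, rule fb)
  have "(\<Sum>i<n. h i) * (LINT t|\<mu>. f t) = (\<Sum>i<n. h i * (B (x i) + (LINT s|\<mu>. indicator {x i<..} s * f s)))"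
    using split by (simp add: sum_distrib_right)
  also have "\<dots> = (\<Sum>i<n. B (x i) * h i) + (\<Sum>i<n. LINT s|\<mu>. h i * (indicator {x i<..} s * f s))"
    by (simp add: distrib_left sum.distrib mult.commute)
  also have "(\<Sum>i<n. LINT s|\<mu>. h i * (indicator {x i<..} s * f s)) = (LINT t|\<mu>. J t * f t)"
    unfolding Jf by (rule Bochner_Integration.integral_sum[symmetric]) (intro integrable_mult_right gi, auto)
  finally have 3: "(\<Sum>i<n. h i) * (LINT t|\<mu>. f t) = (\<Sum>i<n. B (x i) * h i) + (LINT t|\<mu>. J t * f t)" .
  have K: "K t z = (J t - B t) * H t z" for t
    unfolding K_def J_def B_def f_def x_def h_def by simp
  have "comp_sum n K z = (\<Sum>i<n. (J (x i) - B (x i)) * h i) - (LINT t|\<mu>. J t * f t - B t * f t)"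
    unfolding comp_sum_def K x_def[symmetric] h_def[symmetric]
    by (intro arg_cong2[where f="(-)"] refl Bochner_Integration.integral_cong) (auto simp: f_def algebra_simps)
  also have "\<dots> = (\<Sum>i<n. J (x i) * h i) - (\<Sum>i<n. B (x i) * h i) - ((LINT t|\<mu>. J t * f t) - (LINT t|\<mu>. B t * f t))"
    by (subst Bochner_Integration.integral_diff[OF Jfi Bfi]) (simp add: left_diff_distrib sum_subtractf)
  finally have 4: "comp_sum n K z = \<dots>" .
  have "comp_sum n H z = (\<Sum>i<n. h i) - (LINT t|\<mu>. f t)"
    unfolding comp_sum_def f_def h_def x_def ..
  then have "(comp_sum n H z)\<^sup>2 = (\<Sum>i<n. h i)\<^sup>2 - 2 * ((\<Sum>i<n. h i) * (LINT t|\<mu>. f t)) + (LINT t|\<mu>. f t)\<^sup>2"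
    by (simp add: power2_diff)
  also have "\<dots> = 2 * comp_sum n K z + (\<Sum>i<n. (h i)\<^sup>2)"
    unfolding 1 2 3 4 by (simp add: algebra_simps)
  finally show ?thesis unfolding h_def x_def .
qed

text \<open>
In the product rule \<open>comp_sum_square\<close> the integrand \<open>D\<^sub>- H\<close> is again predictable, so the first term has mean \<open>0\<close>
and only the squared jumps remain. Boundedness of \<open>H\<close>, and of \<open>1 / S\<close> where \<open>H\<close> does not vanish, makes every
expectation finite.
\<close>

lemma isometry_bounded:
  fixes H :: "real \<Rightarrow> (nat \<Rightarrow> real \<times> real) \<Rightarrow> real"
  assumes H: "case_prod H \<in> borel_measurable (borel \<Otimes>\<^sub>M sample n)" and pred: "predictable n H"
    and c: "\<And>t z. \<bar>H t z\<bar> \<le> c" and \<delta>: "0 < \<delta>" "\<forall>z t. H t z \<noteq> 0 \<longrightarrow> \<delta> \<le> S t"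
  shows "(\<integral>\<^sup>+z. ennreal ((comp_sum n H z)\<^sup>2) \<partial>sample n)
    = (\<integral>\<^sup>+z. \<integral>\<^sup>+t. ennreal ((H t z)\<^sup>2) * ennreal (at_risk n t z / S t) \<partial>\<mu> \<partial>sample n)"
proof -
  define K where "K = (\<lambda>t z. ((\<Sum>j<n. if fst (z j) < t then H (fst (z j)) z else 0)
      - (LINT s|\<mu>. indicator {..<t} s * (H s z * (at_risk n s z / S s)))) * H t z)"
  have c0: "0 \<le> c" using c[of 0 undefined] by linarith
  have predK: "predictable n K"
    unfolding predictable_def
  proof (intro allI impI)
    fix i t and z :: "nat \<Rightarrow> real \<times> real"
    assume i: "i < n" "t \<le> fst (z i)"
    let ?z = "z(i := (t, snd (z i)))"
    have Hs: "H s ?z = H s z" and Ns: "at_risk n s ?z = at_risk n s z" if "s \<le> t" for s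
      using predictableD[where z=z and t=t, OF pred i(1) that i(2)]
        predictableD[where z=z and t=t, OF predictable_at_risk i(1) that i(2)] by auto
    have "(\<Sum>j<n. if fst (?z j) < t then H (fst (?z j)) ?z else 0) = (\<Sum>j<n. if fst (z j) < t then H (fst (z j)) z else 0)"
      by (rule sum.cong) (use i Hs in auto)
    moreover have "(LINT s|\<mu>. indicator {..<t} s * (H s ?z * (at_risk n s ?z / S s)))
       = (LINT s|\<mu>. indicator {..<t} s * (H s z * (at_risk n s z / S s)))"
      by (intro Bochner_Integration.integral_cong refl) (auto simp: indicator_def Hs Ns)
    ultimately show "K t ?z = K t z" unfolding K_def using Hs[of t] by simp
  qed
  have [measurable]: "(\<lambda>p. H (fst p) (snd p)) \<in> borel_measurable (borel \<Otimes>\<^sub>M sample n)"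
    using H by (simp add: split_beta')
  have mK: "case_prod K \<in> borel_measurable (borel \<Otimes>\<^sub>M sample n)"
  proof -
    have 1: "(\<lambda>p. if fst (snd p j) < fst p then H (fst (snd p j)) (snd p) else 0) \<in> borel_measurable (borel \<Otimes>\<^sub>M sample n)"
      if "j < n" for j
    proof -
      have "(\<lambda>z. H (fst (z j)) z) \<in> borel_measurable (sample n)"
        using measurable_at_observation[OF H _ that] by simp
      note [measurable] = measurable_compose[OF measurable_snd this, of "borel::real measure"]
         measurable_compose[OF measurable_snd fst_component_measurable[OF that], of "borel::real measure"]
      show ?thesis by measurable
    qed
    have 2: "(\<lambda>p. LINT s|\<mu>. indicator {..<fst p} s * (H s (snd p) * (at_risk n s (snd p) / S s))) \<in> borel_measurable (borel \<Otimes>\<^sub>M sample n)"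
    proof (rule X.borel_measurable_lebesgue_integral)
      have [measurable]: "Measurable.pred ((borel \<Otimes>\<^sub>M sample n) \<Otimes>\<^sub>M borel) (\<lambda>p. snd p \<in> {..<fst (fst p) :: real})"
        by simp
      have "(\<lambda>p. (snd (fst p), snd p)) \<in> (borel \<Otimes>\<^sub>M sample n) \<Otimes>\<^sub>M borel \<rightarrow>\<^sub>M sample n \<Otimes>\<^sub>M borel" by measurable
      from measurable_compose[OF this compensated_process_measurable[OF H]]
      have m1: "(\<lambda>p. H (snd p) (snd (fst p)) * (at_risk n (snd p) (snd (fst p)) / S (snd p))) \<in> borel_measurable ((borel \<Otimes>\<^sub>M sample n) \<Otimes>\<^sub>M borel)"
        by (simp only: fst_conv snd_conv)
      have sets_eq: "sets ((borel \<Otimes>\<^sub>M sample n) \<Otimes>\<^sub>M \<mu>) = sets ((borel \<Otimes>\<^sub>M sample n) \<Otimes>\<^sub>M borel)"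
        by (intro sets_pair_measure_cong) auto
      show "(\<lambda>(p, s). indicator {..<fst p} s * (H s (snd p) * (at_risk n s (snd p) / S s))) \<in> borel_measurable ((borel \<Otimes>\<^sub>M sample n) \<Otimes>\<^sub>M \<mu>)"
        unfolding split_beta' measurable_cong_sets[OF sets_eq refl]
        by (rule borel_measurable_times[OF _ m1]) measurable
    qed
    show ?thesis
      unfolding K_def split_beta'
      by (intro borel_measurable_times borel_measurable_diff borel_measurable_sum 1 2) auto
  qed
  define c' where "c' = (n * c + c * (n / \<delta>)) * c"
  have bK: "\<bar>K t z\<bar> \<le> c'" for t z
  proof -
    have "\<bar>\<Sum>j<n. if fst (z j) < t then H (fst (z j)) z else 0\<bar> \<le> (\<Sum>j<n. c)"
      by (rule sum_abs[THEN order_trans], intro sum_mono) (use c c0 in auto)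
    moreover have "\<bar>LINT s|\<mu>. indicator {..<t} s * (H s z * (at_risk n s z / S s))\<bar> \<le> c * (n / \<delta>)"
    proof (cases "integrable \<mu> (\<lambda>s. indicator {..<t} s * (H s z * (at_risk n s z / S s)))")
      case True
      have "\<bar>LINT s|\<mu>. indicator {..<t} s * (H s z * (at_risk n s z / S s))\<bar> \<le> (LINT s|\<mu>. c * (n / \<delta>))"
      proof (rule integral_abs_bound[THEN order_trans], rule integral_mono[OF integrable_abs[OF True]])
        fix s
        have "\<bar>H s z * (at_risk n s z / S s)\<bar> \<le> c * (n / \<delta>)"
        proof (cases "H s z = 0")
          case False
          then have "\<delta> \<le> S s" using \<delta> by blast
          then have "at_risk n s z / S s \<le> n / \<delta>" using \<delta>(1) at_risk_le by (intro frac_le) auto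
          then show ?thesis unfolding abs_mult using c by (intro mult_mono) (auto simp: c0)
        qed (use c0 \<delta>(1) in simp)
        then show "\<bar>indicator {..<t} s * (H s z * (at_risk n s z / S s))\<bar> \<le> c * (n / \<delta>)"
          using c0 \<delta>(1) by (auto simp: indicator_def)
      qed auto
      then show ?thesis using X.prob_space by simp
    qed (use c0 \<delta>(1) in \<open>simp add: not_integrable_integral_eq\<close>)
    ultimately show ?thesis
      unfolding K_def c'_def abs_mult using c c0 by (intro mult_mono) auto
  qed
  have dK: "\<forall>z t. K t z \<noteq> 0 \<longrightarrow> \<delta> \<le> S t"
    using \<delta>(2) by (auto simp: K_def)
  note Kint = compensator_bounded[OF mK predK bK \<delta>(1) dK]
  let ?Q = "\<lambda>z. \<Sum>i<n. (H (fst (z i)) z)\<^sup>2"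
  have Qm: "?Q \<in> borel_measurable (sample n)"
    by (intro borel_measurable_sum borel_measurable_power measurable_at_observation[OF H]) auto
  have Qi: "integrable (sample n) ?Q"
  proof (rule sample.integrable_const_bound[where B="n * c\<^sup>2"])
    show "AE z in sample n. norm (?Q z) \<le> n * c\<^sup>2"
    proof (rule AE_I2)
      fix z
      have "\<bar>?Q z\<bar> \<le> (\<Sum>i<n. c\<^sup>2)"
        by (rule sum_abs[THEN order_trans], intro sum_mono) (use c c0 in \<open>simp add: abs_le_square_iff[symmetric]\<close>)
      then show "norm (?Q z) \<le> n * c\<^sup>2" by simp
    qed
  qed (rule Qm)
  have D: "AE z in sample n. (comp_sum n H z)\<^sup>2 = 2 * comp_sum n K z + ?Q z"
    using AE_sample_distinct AE_space
  proof eventually_elim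
    case (elim z)
    show ?case unfolding K_def by (rule comp_sum_square[OF H elim(2) c \<delta>(1) spec[OF \<delta>(2)] elim(1)])
  qed
  have Hm: "comp_sum n H \<in> borel_measurable (sample n)" by (rule comp_sum_measurable[OF H])
  have Di: "integrable (sample n) (\<lambda>z. (comp_sum n H z)\<^sup>2)"
    by (subst integrable_cong_AE[OF _ _ D]) (use Hm Qm Kint(1) Qi in auto)
  have "(\<integral>\<^sup>+z. ennreal ((comp_sum n H z)\<^sup>2) \<partial>sample n) = ennreal (LINT z|sample n. (comp_sum n H z)\<^sup>2)"
    by (rule nn_integral_eq_integral[OF Di]) auto
  also have "(LINT z|sample n. (comp_sum n H z)\<^sup>2) = (LINT z|sample n. 2 * comp_sum n K z + ?Q z)"
    by (rule integral_cong_AE[OF _ _ D]) (use Hm Qm Kint(1) in auto)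
  also have "\<dots> = (LINT z|sample n. ?Q z)"
    using Kint Qi by (subst Bochner_Integration.integral_add) auto
  also have "ennreal \<dots> = (\<integral>\<^sup>+z. ennreal (?Q z) \<partial>sample n)"
    by (rule nn_integral_eq_integral[symmetric, OF Qi]) (auto intro!: AE_I2 sum_nonneg)
  also have "\<dots> = (\<integral>\<^sup>+z. (\<Sum>i<n. ennreal ((H (fst (z i)) z)\<^sup>2)) \<partial>sample n)"
    by (intro nn_integral_cong sum_ennreal[symmetric]) auto
  also have "\<dots> = (\<integral>\<^sup>+z. \<integral>\<^sup>+t. ennreal ((H t z)\<^sup>2) * ennreal (at_risk n t z / S t) \<partial>\<mu> \<partial>sample n)"
  proof (rule compensator)
    show "(\<lambda>(t, z). ennreal ((H t z)\<^sup>2)) \<in> borel_measurable (borel \<Otimes>\<^sub>M sample n)"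
      by (simp add: split_beta')
    show "predictable n (\<lambda>t z. ennreal ((H t z)\<^sup>2))" using pred by (simp add: predictable_def)
  qed
  finally show ?thesis .
qed

lemma nn_compensated_measurable:
  assumes H: "case_prod H \<in> borel_measurable (borel \<Otimes>\<^sub>M sample n)"
  shows "(\<lambda>z. \<integral>\<^sup>+t. ennreal ((H t z)\<^sup>2) * ennreal (at_risk n t z / S t) \<partial>\<mu>) \<in> borel_measurable (sample n)"
proof (rule X.borel_measurable_nn_integral)
  have [measurable]: "(\<lambda>p. H (snd p) (fst p)) \<in> borel_measurable (sample n \<Otimes>\<^sub>M borel)"
    using measurable_compose[OF measurable_pair_swap' H] by (simp add: split_beta')
  have sets_eq: "sets (sample n \<Otimes>\<^sub>M \<mu>) = sets (sample n \<Otimes>\<^sub>M borel)"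
    by (intro sets_pair_measure_cong) auto
  show "(\<lambda>(z, t). ennreal ((H t z)\<^sup>2) * ennreal (at_risk n t z / S t)) \<in> borel_measurable (sample n \<Otimes>\<^sub>M \<mu>)"
    unfolding split_beta' measurable_cong_sets[OF sets_eq refl] by measurable
qed

text \<open>
Nobody is at risk after the largest \<open>X\<^sub>i\<close>, so \<open>S\<close> is bounded below where \<open>N\<close> does not vanish.
\<close>

lemma hazard_weight_bounded:
  assumes "\<forall>i<n. 0 < S (fst (z i))"
  obtains b where "\<And>t. at_risk n t z / S t \<le> b"
proof -
  obtain \<delta> where \<delta>: "0 < \<delta>" "\<And>i. i < n \<Longrightarrow> \<delta> \<le> S (fst (z i))"
  proof (cases "n = 0")
    case False
    then have ne: "(\<lambda>i. S (fst (z i))) ` {..<n} \<noteq> {}" by auto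
    show ?thesis
      by (rule that[of "Min ((\<lambda>i. S (fst (z i))) ` {..<n})"]) (use assms ne in \<open>auto simp: Min_gr_iff\<close>)
  qed (use that[of 1] in auto)
  have "at_risk n t z / S t \<le> n / \<delta>" for t
  proof (cases "\<exists>i<n. snd (z i) \<le> t \<and> t \<le> fst (z i)")
    case True
    then obtain i where "i < n" "t \<le> fst (z i)" by blast
    then have "\<delta> \<le> S t" using \<delta>(2)[of i] S_antimono[of t "fst (z i)"] by linarith
    then show ?thesis using \<delta>(1) at_risk_le by (intro frac_le) auto
  next
    case False
    then have "at_risk n t z = 0" unfolding at_risk_def by (intro sum.neutral) auto
    then show ?thesis using \<delta>(1) by simp
  qed
  then show ?thesis by (rule that)
qed

text \<open>
Fatou's lemma extends the bounded case. The first conclusion is what gives the compensated sum a meaning: if the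
integral diverged, its value would be \<open>0\<close> by convention.
\<close>

theorem isometry_inequality:
  fixes H :: "real \<Rightarrow> (nat \<Rightarrow> real \<times> real) \<Rightarrow> real"
  assumes H: "case_prod H \<in> borel_measurable (borel \<Otimes>\<^sub>M sample n)" and pred: "predictable n H"
    and fin: "(\<integral>\<^sup>+z. \<integral>\<^sup>+t. ennreal ((H t z)\<^sup>2) * ennreal (at_risk n t z / S t) \<partial>\<mu> \<partial>sample n) < \<infinity>"
  shows "AE z in sample n. integrable \<mu> (\<lambda>t. H t z * (at_risk n t z / S t))"
    and "(\<integral>\<^sup>+z. ennreal ((comp_sum n H z)\<^sup>2) \<partial>sample n)
      \<le> (\<integral>\<^sup>+z. \<integral>\<^sup>+t. ennreal ((H t z)\<^sup>2) * ennreal (at_risk n t z / S t) \<partial>\<mu> \<partial>sample n)"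
proof -
  have fin_AE: "AE z in sample n. (\<integral>\<^sup>+t. ennreal ((H t z)\<^sup>2) * ennreal (at_risk n t z / S t) \<partial>\<mu>) \<noteq> \<infinity>"
    by (rule nn_integral_PInf_AE[OF nn_compensated_measurable[OF H]]) (use fin in auto)
  show int: "AE z in sample n. integrable \<mu> (\<lambda>t. H t z * (at_risk n t z / S t))"
    using fin_AE AE_sample_S_pos AE_space
  proof eventually_elim
    case (elim z)
    obtain b where b: "\<And>t. at_risk n t z / S t \<le> b" using hazard_weight_bounded[OF elim(2)] by blast
    have zs: "(\<lambda>t. z) \<in> borel \<rightarrow>\<^sub>M sample n" using elim by simp
    note [measurable] = section_measurable[OF H elim(3)] zs
    have w0: "0 \<le> at_risk n t z / S t" for t by simp
    have 1: "integrable \<mu> (\<lambda>t. at_risk n t z / S t)"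
      by (rule X.integrable_const_bound[where B=b]) (use b in \<open>auto intro!: AE_I2\<close>)
    have 2: "integrable \<mu> (\<lambda>t. (H t z)\<^sup>2 * (at_risk n t z / S t))"
    proof (rule integrableI_nonneg)
      have "(\<integral>\<^sup>+t. ennreal ((H t z)\<^sup>2 * (at_risk n t z / S t)) \<partial>\<mu>) = (\<integral>\<^sup>+t. ennreal ((H t z)\<^sup>2) * ennreal (at_risk n t z / S t) \<partial>\<mu>)"
        by (intro nn_integral_cong ennreal_mult') simp
      then show "(\<integral>\<^sup>+t. ennreal ((H t z)\<^sup>2 * (at_risk n t z / S t)) \<partial>\<mu>) < \<infinity>"
        using elim(1) by (simp add: less_top)
    next
      show "AE t in \<mu>. 0 \<le> (H t z)\<^sup>2 * (at_risk n t z / S t)"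
        by (intro AE_I2 mult_nonneg_nonneg w0) simp
    qed measurable
    show ?case
    proof (rule Bochner_Integration.integrable_bound[OF Bochner_Integration.integrable_add[OF 1 2]])
      show "AE t in \<mu>. norm (H t z * (at_risk n t z / S t)) \<le> norm (at_risk n t z / S t + (H t z)\<^sup>2 * (at_risk n t z / S t))"
      proof (rule AE_I2)
        fix t
        have "\<bar>H t z\<bar> \<le> 1 + (H t z)\<^sup>2" using sum_squares_bound[of "\<bar>H t z\<bar>" 1] by simp
        from mult_right_mono[OF this w0[of t]] show "norm (H t z * (at_risk n t z / S t)) \<le> norm (at_risk n t z / S t + (H t z)\<^sup>2 * (at_risk n t z / S t))"
          using w0[of t] by (simp add: abs_mult distrib_right del: times_divide_eq_right)
      qed
    qed measurable
  qed
  \<comment> \<open>Truncation in the value of \<open>H\<close> and away from the right endpoint of \<open>F\<close>; both conditions keep predictability.\<close>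
  define Hk where "Hk = (\<lambda>k t z. if \<bar>H t z\<bar> \<le> real k \<and> 1 / real (Suc k) \<le> S t then H t z else 0)"
  have Hk: "case_prod (Hk k) \<in> borel_measurable (borel \<Otimes>\<^sub>M sample n)" for k
  proof -
    have [measurable]: "(\<lambda>p. H (fst p) (snd p)) \<in> borel_measurable (borel \<Otimes>\<^sub>M sample n)"
      using H by (simp add: split_beta')
    show ?thesis unfolding Hk_def split_beta' by measurable
  qed
  have predk: "predictable n (Hk k)" for k using pred by (simp add: predictable_def Hk_def)
  have le: "(\<integral>\<^sup>+z. ennreal ((comp_sum n (Hk k) z)\<^sup>2) \<partial>sample n)
     \<le> (\<integral>\<^sup>+z. \<integral>\<^sup>+t. ennreal ((H t z)\<^sup>2) * ennreal (at_risk n t z / S t) \<partial>\<mu> \<partial>sample n)" for k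
  proof (subst isometry_bounded[OF Hk predk, where c="real k" and \<delta>="1 / real (Suc k)"])
    show "(\<integral>\<^sup>+z. \<integral>\<^sup>+t. ennreal ((Hk k t z)\<^sup>2) * ennreal (at_risk n t z / S t) \<partial>\<mu> \<partial>sample n)
      \<le> (\<integral>\<^sup>+z. \<integral>\<^sup>+t. ennreal ((H t z)\<^sup>2) * ennreal (at_risk n t z / S t) \<partial>\<mu> \<partial>sample n)"
      by (intro nn_integral_mono mult_right_mono) (auto simp: Hk_def)
  qed (auto simp: Hk_def)
  have ev: "eventually (\<lambda>k. Hk k t z = H t z) sequentially" if "0 < S t" for t z
  proof -
    obtain k1 :: nat where k1: "\<bar>H t z\<bar> \<le> real k1" using real_arch_simple by blast
    obtain k2 :: nat where k2: "1 / S t \<le> real k2" using real_arch_simple by blast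
    show ?thesis
    proof (rule eventually_sequentiallyI[of "max k1 k2"])
      fix k assume k: "max k1 k2 \<le> k"
      then have "1 / S t \<le> real (Suc k)" using k2 by auto
      then have "1 / real (Suc k) \<le> S t" using that by (simp add: field_simps)
      then show "Hk k t z = H t z" using k k1 by (auto simp: Hk_def)
    qed
  qed
  have lim: "AE z in sample n. (\<lambda>k. comp_sum n (Hk k) z) \<longlonglongrightarrow> comp_sum n H z"
    using int AE_sample_S_pos AE_space
  proof eventually_elim
    case (elim z)
    have zs: "(\<lambda>t. z) \<in> borel \<rightarrow>\<^sub>M sample n" using elim by simp
    note [measurable] = section_measurable[OF H elim(3)] section_measurable[OF Hk elim(3)] zs
    show ?case
      unfolding comp_sum_def
    proof (intro tendsto_diff tendsto_sum)
      fix i assume "i \<in> {..<n}"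
      then show "(\<lambda>k. Hk k (fst (z i)) z) \<longlonglongrightarrow> H (fst (z i)) z"
        using elim(2) by (intro tendsto_eventually ev) auto
    next
      show "(\<lambda>k. LINT t|\<mu>. Hk k t z * (at_risk n t z / S t)) \<longlonglongrightarrow> (LINT t|\<mu>. H t z * (at_risk n t z / S t))"
      proof (rule integral_dominated_convergence[where w="\<lambda>t. norm (H t z * (at_risk n t z / S t))"])
        show "integrable \<mu> (\<lambda>t. norm (H t z * (at_risk n t z / S t)))" using elim(1) by (rule integrable_norm)
        show "AE t in \<mu>. (\<lambda>k. Hk k t z * (at_risk n t z / S t)) \<longlonglongrightarrow> H t z * (at_risk n t z / S t)"
          using AE_S_pos by eventually_elim (intro tendsto_mult tendsto_const tendsto_eventually ev)
        show "AE t in \<mu>. norm (Hk k t z * (at_risk n t z / S t)) \<le> norm (H t z * (at_risk n t z / S t))" for k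
          by (intro AE_I2) (auto simp: Hk_def)
      qed measurable
    qed
  qed
  have "(\<integral>\<^sup>+z. ennreal ((comp_sum n H z)\<^sup>2) \<partial>sample n) = (\<integral>\<^sup>+z. liminf (\<lambda>k. ennreal ((comp_sum n (Hk k) z)\<^sup>2)) \<partial>sample n)"
  proof (rule nn_integral_cong_AE, use lim in eventually_elim)
    case (elim z)
    have "(\<lambda>k. ennreal ((comp_sum n (Hk k) z)\<^sup>2)) \<longlonglongrightarrow> ennreal ((comp_sum n H z)\<^sup>2)"
      using elim by (intro tendsto_ennrealI tendsto_power)
    then show ?case by (intro lim_imp_Liminf[symmetric]) auto
  qed
  also have "\<dots> \<le> liminf (\<lambda>k. \<integral>\<^sup>+z. ennreal ((comp_sum n (Hk k) z)\<^sup>2) \<partial>sample n)"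
    by (rule nn_integral_liminf) (use comp_sum_measurable[OF Hk] in measurable)
  also have "\<dots> \<le> (\<integral>\<^sup>+z. \<integral>\<^sup>+t. ennreal ((H t z)\<^sup>2) * ennreal (at_risk n t z / S t) \<partial>\<mu> \<partial>sample n)"
    by (rule Liminf_le) (simp, rule always_eventually, intro allI le)
  finally show "(\<integral>\<^sup>+z. ennreal ((comp_sum n H z)\<^sup>2) \<partial>sample n)
      \<le> (\<integral>\<^sup>+z. \<integral>\<^sup>+t. ennreal ((H t z)\<^sup>2) * ennreal (at_risk n t z / S t) \<partial>\<mu> \<partial>sample n)" .
qed

definition risk_ind :: "real \<Rightarrow> real \<times> real \<Rightarrow> real" where
  "risk_ind s p = (if snd p \<le> s \<and> s \<le> fst p then 1 else 0)"

lemma risk_ind_measurable [measurable]: "risk_ind s \<in> borel_measurable (borel \<Otimes>\<^sub>M borel)"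
  unfolding risk_ind_def[abs_def] by measurable

lemma at_risk_sum: "at_risk n s z = (\<Sum>i<n. risk_ind s (z i))"
  by (simp add: at_risk_def risk_ind_def)

lemma integral_risk_ind: "(LINT p|law. risk_ind s p) = C s"
proof -
  have "(LINT p|law. risk_ind s p) = (LINT p|law. indicator ({s..} \<times> {..s}) p)"
    by (intro Bochner_Integration.integral_cong) (auto simp: risk_ind_def indicator_def)
  also have "\<dots> = measure law ({s..} \<times> {..s})" by simp
  also have "emeasure law ({s..} \<times> {..s}) = ennreal (1 / \<alpha>) * (\<integral>\<^sup>+x. ennreal (G s) * indicator {s..} x \<partial>\<mu>)"
  proof (subst emeasure_law_Times)
    have "(\<integral>\<^sup>+x. emeasure \<nu> ({..x} \<inter> {..s}) * indicator {s..} x \<partial>\<mu>) = (\<integral>\<^sup>+x. ennreal (G s) * indicator {s..} x \<partial>\<mu>)"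
    proof (rule nn_integral_cong)
      fix x
      have "{..x} \<inter> {..s} = {..s}" if "s \<le> x" using that by auto
      then show "emeasure \<nu> ({..x} \<inter> {..s}) * indicator {s..} x = ennreal (G s) * indicator {s..} x"
        by (auto simp: indicator_def cdf_def Y.emeasure_eq_measure)
    qed
    then show "ennreal (1 / \<alpha>) * (\<integral>\<^sup>+x. emeasure \<nu> ({..x} \<inter> {..s}) * indicator {s..} x \<partial>\<mu>)
       = ennreal (1 / \<alpha>) * (\<integral>\<^sup>+x. ennreal (G s) * indicator {s..} x \<partial>\<mu>)" by simp
  qed auto
  then have "emeasure law ({s..} \<times> {..s}) = ennreal (C s)"
    using alpha_pos by (simp add: nn_integral_cmult_indicator emeasure_atLeast C_def flip: ennreal_mult)
  then have "measure law ({s..} \<times> {..s}) = C s" by (simp add: measure_def)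
  finally show ?thesis by simp
qed

lemma distr_component: "i < n \<Longrightarrow> distr (sample n) law (\<lambda>z. z i) = law"
  unfolding sample_def by (rule distr_PiM_component) (auto intro: law.prob_space_axioms)

lemma sample_indep:
  assumes "0 < n"
  shows "prob_space.indep_vars (sample n) (\<lambda>_. law) (\<lambda>i z. z i) {..<n}"
proof (subst sample.indep_vars_iff_distr_eq_PiM')
  show "{..<n} \<noteq> {}" using assms by auto
  show "i \<in> {..<n} \<Longrightarrow> (\<lambda>z. z i) \<in> sample n \<rightarrow>\<^sub>M law" for i
    unfolding sample_def by measurable
  have "distr (sample n) (Pi\<^sub>M {..<n} (\<lambda>_. law)) (\<lambda>z. \<lambda>i\<in>{..<n}. z i) = distr (sample n) (sample n) (\<lambda>z. z)"
    by (rule distr_cong) (auto simp: sample_def space_PiM PiE_def extensional_def restrict_def fun_eq_iff)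
  also have "\<dots> = sample n" by (rule distr_id)
  also have "\<dots> = Pi\<^sub>M {..<n} (\<lambda>i. distr (sample n) law (\<lambda>z. z i))"
    unfolding sample_def by (intro PiM_cong refl) (simp add: distr_component flip: sample_def)
  finally show "distr (sample n) (Pi\<^sub>M {..<n} (\<lambda>_. law)) (\<lambda>z. \<lambda>i\<in>{..<n}. z i) = Pi\<^sub>M {..<n} (\<lambda>i. distr (sample n) law (\<lambda>z. z i))" .
qed

lemma risk_ind_indep:
  assumes "0 < n" and [measurable]: "f \<in> borel_measurable borel"
  shows "prob_space.indep_vars (sample n) (\<lambda>_. borel) (\<lambda>i z. f (risk_ind s (z i)) :: real) {..<n}"
  by (rule sample.indep_vars_compose2[OF sample_indep[OF assms(1)]]) measurable

lemma risk_ind_component_measurable: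
  "i < n \<Longrightarrow> (\<lambda>z. risk_ind s (z i)) \<in> borel_measurable (sample n)"
  using measurable_compose[OF component_measurable risk_ind_measurable] .

lemma integral_risk_ind_component:
  assumes "i < n" and [measurable]: "f \<in> borel_measurable borel"
  shows "(LINT z|sample n. f (risk_ind s (z i)) :: real) = (LINT p|law. f (risk_ind s p))"
proof -
  have "(LINT p|law. f (risk_ind s p)) = (LINT p|distr (sample n) law (\<lambda>z. z i). f (risk_ind s p))"
    using distr_component[OF assms(1)] by simp
  also have "\<dots> = (LINT z|sample n. f (risk_ind s (z i)))"
  proof (rule integral_distr)
    show "(\<lambda>z. z i) \<in> sample n \<rightarrow>\<^sub>M law"
      using component_measurable[OF assms(1)] by (simp add: measurable_cong_sets[OF refl sets_law])
    have "(\<lambda>p. f (risk_ind s p)) \<in> borel_measurable (borel \<Otimes>\<^sub>M borel)" by measurable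
    then show "(\<lambda>p. f (risk_ind s p)) \<in> borel_measurable law"
      by (simp add: measurable_cong_sets[OF sets_law refl])
  qed
  finally show ?thesis ..
qed

lemma risk_ind_integrable: "integrable law (risk_ind s)"
proof (rule law.integrable_const_bound[where B=1])
  show "risk_ind s \<in> borel_measurable law"
    using risk_ind_measurable by (simp add: measurable_cong_sets[OF sets_law refl])
qed (auto simp: risk_ind_def)

lemma measure_law_UNIV [simp]: "measure law UNIV = 1"
  using law.prob_space by simp

lemma C_le_1: "C s \<le> 1"
proof -
  have "(LINT p|law. risk_ind s p) \<le> (LINT p|law. 1)"
    by (rule integral_mono[OF risk_ind_integrable]) (auto simp: risk_ind_def)
  then show ?thesis by (simp add: integral_risk_ind)
qed

lemma at_risk_variance: "(LINT z|sample n. (at_risk n s z - n * C s)\<^sup>2) \<le> n * C s"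
proof (cases "n = 0")
  case True
  then show ?thesis by (simp add: at_risk_def)
next
  case False
  then have n: "0 < n" by simp
  let ?D = "\<lambda>i z. risk_ind s (z i) - C s"
  have Db: "\<bar>?D i z\<bar> \<le> 1" for i z using C_le_1[of s] C_nonneg[of s] by (auto simp: risk_ind_def)
  have Dm: "?D i \<in> borel_measurable (sample n)" if "i < n" for i
    using risk_ind_component_measurable[OF that] by measurable
  have Di: "integrable (sample n) (?D i)" if "i < n" for i
    by (rule sample.integrable_const_bound[where B=1, OF _ Dm[OF that]]) (rule AE_I2, simp only: real_norm_def, rule Db)
  have DDi: "integrable (sample n) (\<lambda>z. ?D i z * ?D j z)" if "i < n" "j < n" for i j
  proof (rule sample.integrable_const_bound[where B="1*1"])
    have "\<bar>?D i z\<bar> * \<bar>?D j z\<bar> \<le> 1 * 1" for z by (intro mult_mono Db) auto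
    then show "AE z in sample n. norm (?D i z * ?D j z) \<le> 1 * 1"
      by (intro AE_I2) (simp only: real_norm_def abs_mult)
  qed (intro borel_measurable_times Dm that)
  have ED: "(LINT z|sample n. ?D i z) = 0" if "i < n" for i
  proof -
    have "(LINT z|sample n. ?D i z) = (LINT p|law. risk_ind s p - C s)"
      using integral_risk_ind_component[OF that, of "\<lambda>u. u - C s" s] by simp
    also have "\<dots> = (LINT p|law. risk_ind s p) - (LINT p|law. C s)"
      by (rule Bochner_Integration.integral_diff[OF risk_ind_integrable]) simp
    finally show ?thesis by (simp add: integral_risk_ind)
  qed
  have cov: "(LINT z|sample n. ?D i z * ?D j z) = 0" if "i < n" "j < n" "i \<noteq> j" for i j
  proof -
    have "prob_space.indep_vars (sample n) (\<lambda>_. borel) (\<lambda>i z. ?D i z) {i, j}"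
      by (rule sample.indep_vars_subset[OF risk_ind_indep[OF n, where f="\<lambda>u. u - C s"]]) (use that in auto)
    then have "(LINT z|sample n. (\<Prod>k\<in>{i,j}. ?D k z)) = (\<Prod>k\<in>{i,j}. LINT z|sample n. ?D k z)"
      by (intro sample.indep_vars_lebesgue_integral) (use Di that(1,2) in \<open>blast | simp\<close>)+
    then show ?thesis using that ED[OF that(1)] by simp
  qed
  have var: "(LINT z|sample n. ?D i z * ?D i z) \<le> C s" if "i < n" for i
  proof -
    have "(LINT z|sample n. ?D i z * ?D i z) = (LINT p|law. (risk_ind s p - C s) * (risk_ind s p - C s))"
      using integral_risk_ind_component[OF that, of "\<lambda>u. (u - C s) * (u - C s)" s] by simp
    also have "\<dots> = (LINT p|law. (1 - 2 * C s) * risk_ind s p + C s * C s)"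
      by (intro Bochner_Integration.integral_cong) (auto simp: risk_ind_def algebra_simps)
    also have "\<dots> = (1 - 2 * C s) * C s + C s * C s"
    proof -
      have "(LINT p|law. (1 - 2 * C s) * risk_ind s p + C s * C s) = (LINT p|law. (1 - 2 * C s) * risk_ind s p) + (LINT p|law. C s * C s)"
        by (rule Bochner_Integration.integral_add[OF integrable_mult_right[OF risk_ind_integrable]]) simp
      then show ?thesis by (simp add: integral_risk_ind)
    qed
    also have "\<dots> \<le> C s" by (simp add: algebra_simps)
    finally show ?thesis .
  qed
  have "(LINT z|sample n. (at_risk n s z - n * C s)\<^sup>2) = (LINT z|sample n. (\<Sum>i<n. \<Sum>j<n. ?D i z * ?D j z))"
    by (intro Bochner_Integration.integral_cong refl)
       (simp add: at_risk_sum power2_eq_square sum_product[symmetric] sum_subtractf)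
  also have "\<dots> = (\<Sum>i<n. \<Sum>j<n. LINT z|sample n. ?D i z * ?D j z)"
  proof -
    have "(LINT z|sample n. (\<Sum>i<n. \<Sum>j<n. ?D i z * ?D j z)) = (\<Sum>i<n. LINT z|sample n. (\<Sum>j<n. ?D i z * ?D j z))"
      by (rule Bochner_Integration.integral_sum) (intro Bochner_Integration.integrable_sum DDi, simp_all)
    also have "\<dots> = (\<Sum>i<n. \<Sum>j<n. LINT z|sample n. ?D i z * ?D j z)"
      by (intro sum.cong refl Bochner_Integration.integral_sum DDi) simp_all
    finally show ?thesis .
  qed
  also have "\<dots> \<le> (\<Sum>i<n. \<Sum>j<n. if i = j then C s else 0)"
    by (intro sum_mono) (use cov var in auto)
  also have "\<dots> = n * C s" by simp
  finally show ?thesis .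
qed

end

section \<open>The Duhamel equation for the estimator\<close>

text \<open>
If the factors are multiplied in the order of increasing \<open>x\<close>, every new factor \<open>1 - q\<close> lowers the product
by \<open>q\<close> times its previous value.
\<close>

lemma prod_one_minus_telescope:
  fixes q :: "'i \<Rightarrow> real" and x :: "'i \<Rightarrow> real"
  assumes "finite A" "inj_on x A"
  shows "(\<Prod>i\<in>A. 1 - q i) = 1 - (\<Sum>i\<in>A. q i * (\<Prod>j\<in>{j\<in>A. x j < x i}. 1 - q j))"
  using assms
proof (induction A rule: finite_ranking_induct[where f=x])
  case (insert a A)
  show ?case
  proof (cases "a \<in> A")
    case True
    then show ?thesis using insert by (simp add: insert_absorb)
  next
    case False
    have lt: "x j < x a" if "j \<in> A" for j
      using insert.hyps(2)[OF that] insert.prems that False by (auto simp: inj_on_def order.strict_iff_order)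
    have 1: "{j \<in> insert a A. x j < x a} = A" using lt by auto
    have 2: "{j \<in> insert a A. x j < x i} = {j \<in> A. x j < x i}" if "i \<in> A" for i using lt[OF that] by auto
    have "(\<Sum>i\<in>insert a A. q i * (\<Prod>j\<in>{j\<in>insert a A. x j < x i}. 1 - q j))
        = q a * (\<Prod>j\<in>{j \<in> insert a A. x j < x a}. 1 - q j) + (\<Sum>i\<in>A. q i * (\<Prod>j\<in>{j\<in>insert a A. x j < x i}. 1 - q j))"
      using False insert.hyps(1) by (rule sum.insert[rotated])
    also have "(\<Sum>i\<in>A. q i * (\<Prod>j\<in>{j\<in>insert a A. x j < x i}. 1 - q j)) = (\<Sum>i\<in>A. q i * (\<Prod>j\<in>{j\<in>A. x j < x i}. 1 - q j))"
      by (rule sum.cong[OF refl]) (simp only: 2)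
    also note 1
    finally have "(\<Sum>i\<in>insert a A. q i * (\<Prod>j\<in>{j\<in>insert a A. x j < x i}. 1 - q j))
        = q a * (\<Prod>j\<in>A. 1 - q j) + (\<Sum>i\<in>A. q i * (\<Prod>j\<in>{j\<in>A. x j < x i}. 1 - q j))" .
    also have "\<dots> = q a * (\<Prod>j\<in>A. 1 - q j) + (1 - (\<Prod>i\<in>A. 1 - q i))"
      using insert by (simp add: inj_on_insert)
    finally show ?thesis using False insert.hyps(1)
      by (simp only: prod.insert) (simp add: algebra_simps)
  qed
qed simp

lemma surv_telescope:
  assumes "inj_on (\<lambda>i. fst (z i)) {..<n}"
  shows "surv n t z = 1 - (\<Sum>i<n. if fst (z i) < t then surv n (fst (z i)) z / at_risk n (fst (z i)) z else 0)"
proof -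
  let ?x = "\<lambda>i. fst (z i)" and ?q = "\<lambda>i. 1 / at_risk n (fst (z i)) z"
  have sp: "surv n s z = (\<Prod>i\<in>{i. i < n \<and> ?x i < s}. 1 - ?q i)" for s
    unfolding surv_def by (subst prod.inter_filter[symmetric]) (auto simp: lessThan_def intro!: prod.cong)
  have "surv n t z = 1 - (\<Sum>i\<in>{i. i < n \<and> ?x i < t}. ?q i * (\<Prod>j\<in>{j\<in>{i. i < n \<and> ?x i < t}. ?x j < ?x i}. 1 - ?q j))"
    unfolding sp by (rule prod_one_minus_telescope) (use assms in \<open>auto simp: inj_on_def\<close>)
  also have "(\<Sum>i\<in>{i. i < n \<and> ?x i < t}. ?q i * (\<Prod>j\<in>{j\<in>{i. i < n \<and> ?x i < t}. ?x j < ?x i}. 1 - ?q j))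
     = (\<Sum>i\<in>{i. i < n \<and> ?x i < t}. surv n (?x i) z / at_risk n (?x i) z)"
  proof (rule sum.cong)
    fix i assume "i \<in> {i. i < n \<and> ?x i < t}"
    then have "{j\<in>{i. i < n \<and> ?x i < t}. ?x j < ?x i} = {j. j < n \<and> ?x j < ?x i}" by auto
    then show "?q i * (\<Prod>j\<in>{j\<in>{i. i < n \<and> ?x i < t}. ?x j < ?x i}. 1 - ?q j) = surv n (?x i) z / at_risk n (?x i) z"
      unfolding sp by simp
  qed simp
  also have "\<dots> = (\<Sum>i<n. if ?x i < t then surv n (?x i) z / at_risk n (?x i) z else 0)"
    by (subst sum.inter_filter[symmetric]) (auto simp: lessThan_def intro!: sum.cong)
  finally show ?thesis .
qed

lemma at_risk_eq_1_iff:
  assumes i: "i < n" and r: "snd (z i) \<le> fst (z i)"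
    and other: "\<And>j. j < n \<Longrightarrow> j \<noteq> i \<Longrightarrow> \<not> (snd (z j) \<le> fst (z i) \<and> fst (z i) \<le> fst (z j))"
  shows "at_risk n (fst (z i)) z = 1"
proof -
  have "at_risk n (fst (z i)) z = (\<Sum>j<n. if j = i then 1 else 0)"
    unfolding at_risk_def by (rule sum.cong) (use r other in auto)
  then show ?thesis using i by simp
qed

lemma surv_eq_0:
  assumes "i < n" "fst (z i) < t" "at_risk n (fst (z i)) z = 1"
  shows "surv n t z = 0"
  unfolding surv_def by (rule prod_zero, simp, rule bexI[of _ i]) (use assms in auto)

text \<open>
If someone has entered and nobody is at risk at time \<open>t\<close>, then the last of the entered individuals to die was alone at
risk when dying, and the corresponding factor of the product is \<open>1 - 1 / 1 = 0\<close>. Hence the estimator stays at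
\<open>1\<close> after a gap.
\<close>

lemma surv_eq_0_of_gap:
  assumes inj: "inj_on (\<lambda>i. fst (z i)) {..<n}" and tr: "\<forall>i<n. snd (z i) \<le> fst (z i)"
    and ex: "k < n" "snd (z k) \<le> t" and gap: "at_risk n t z = 0"
  shows "surv n t z = 0"
proof -
  have gap': "\<not> (snd (z i) \<le> t \<and> t \<le> fst (z i))" if "i < n" for i
  proof
    assume "snd (z i) \<le> t \<and> t \<le> fst (z i)"
    then have "1 \<le> at_risk n t z"
      unfolding at_risk_def using that
      by (intro order_trans[OF _ member_le_sum[of i]]) auto
    then show False using gap by simp
  qed
  define A where "A = {i. i < n \<and> snd (z i) \<le> t}"
  have A: "finite A" "A \<noteq> {}" using ex by (auto simp: A_def)
  obtain i where i: "i \<in> A" "\<And>j. j \<in> A \<Longrightarrow> fst (z j) \<le> fst (z i)"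
  proof -
    have "Max ((\<lambda>i. fst (z i)) ` A) \<in> (\<lambda>i. fst (z i)) ` A" using A by (intro Max_in) auto
    then obtain i where "i \<in> A" "Max ((\<lambda>i. fst (z i)) ` A) = fst (z i)" by auto
    then show ?thesis using that[of i] A(1) Max_ge[of "(\<lambda>i. fst (z i)) ` A"] by (metis finite_imageI imageI)
  qed
  have lt: "fst (z i) < t" using gap'[of i] i(1) by (auto simp: A_def)
  have "at_risk n (fst (z i)) z = 1"
  proof (rule at_risk_eq_1_iff)
    fix j assume j: "j < n" "j \<noteq> i"
    show "\<not> (snd (z j) \<le> fst (z i) \<and> fst (z i) \<le> fst (z j))"
    proof
      assume a: "snd (z j) \<le> fst (z i) \<and> fst (z i) \<le> fst (z j)"
      then have "j \<in> A" using j lt by (auto simp: A_def)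
      then have "fst (z j) = fst (z i)" using i(2)[of j] a by auto
      then show False using inj j i(1) by (auto simp: inj_on_def A_def)
    qed
  qed (use i(1) tr in \<open>auto simp: A_def\<close>)
  then show ?thesis using i(1) lt by (intro surv_eq_0[of i]) (auto simp: A_def)
qed

context truncation_model
begin

lemma has_integral_inverse_S_squared:
  assumes "0 < S t"
  shows "integrable \<mu> (\<lambda>s. indicator {..<t} s / (S s)\<^sup>2)"
    and "(LINT s|\<mu>. indicator {..<t} s / (S s)\<^sup>2) = 1 / S t - 1"
proof -
  have "has_bochner_integral \<mu> (\<lambda>s. indicator {..<t} s / (S s)\<^sup>2) (1 / S t - 1)"
  proof (rule has_bochner_integral_nn_integral)
    have "(\<integral>\<^sup>+s. ennreal (indicator {..<t} s / (S s)\<^sup>2) \<partial>\<mu>) = (\<integral>\<^sup>+s. ennreal (1 / (S s)\<^sup>2) * indicator {..<t} s \<partial>\<mu>)"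
      by (intro nn_integral_cong) (auto simp: indicator_def)
    then show "(\<integral>\<^sup>+s. ennreal (indicator {..<t} s / (S s)\<^sup>2) \<partial>\<mu>) = ennreal (1 / S t - 1)"
      using nn_integral_inverse_S_squared[OF assms] by simp
    show "0 \<le> 1 / S t - 1" using assms S_le_1[of t] by (simp add: field_simps)
  qed auto
  then show "integrable \<mu> (\<lambda>s. indicator {..<t} s / (S s)\<^sup>2)" "(LINT s|\<mu>. indicator {..<t} s / (S s)\<^sup>2) = 1 / S t - 1"
    by (auto simp: has_bochner_integral_iff)
qed

lemma AE_neq: "AE s in \<mu>. s \<noteq> a"
  by (rule AE_I[of _ _ "{a}"]) (auto simp: X.emeasure_eq_measure atomless)

lemma integral_inverse_S_squared_between:
  assumes "0 < S t" "a < t"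
  shows "integrable \<mu> (\<lambda>s. indicator {a<..<t} s / (S s)\<^sup>2)"
    and "(LINT s|\<mu>. indicator {a<..<t} s / (S s)\<^sup>2) = 1 / S t - 1 / S a"
proof -
  have Sa: "0 < S a" using assms S_antimono[of a t] by auto
  note t = has_integral_inverse_S_squared[OF assms(1)] and a = has_integral_inverse_S_squared[OF Sa]
  have eq: "AE s in \<mu>. indicator {a<..<t} s / (S s)\<^sup>2 = indicator {..<t} s / (S s)\<^sup>2 - indicator {..<a} s / (S s)\<^sup>2"
    using AE_neq[of a] by eventually_elim (use assms(2) in \<open>auto simp: indicator_def\<close>)
  have i: "integrable \<mu> (\<lambda>s. indicator {..<t} s / (S s)\<^sup>2 - indicator {..<a} s / (S s)\<^sup>2)"
    by (rule Bochner_Integration.integrable_diff[OF t(1) a(1)])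
  show "integrable \<mu> (\<lambda>s. indicator {a<..<t} s / (S s)\<^sup>2)"
    by (subst integrable_cong_AE[OF _ _ eq]) (use i in auto)
  have "(LINT s|\<mu>. indicator {a<..<t} s / (S s)\<^sup>2) = (LINT s|\<mu>. indicator {..<t} s / (S s)\<^sup>2 - indicator {..<a} s / (S s)\<^sup>2)"
    by (rule integral_cong_AE[OF _ _ eq]) auto
  also have "\<dots> = 1 / S t - 1 / S a"
    by (subst Bochner_Integration.integral_diff[OF t(1) a(1)]) (simp add: t(2) a(2))
  finally show "(LINT s|\<mu>. indicator {a<..<t} s / (S s)\<^sup>2) = 1 / S t - 1 / S a" .
qed

lemma surv_section_measurable: "z \<in> space (sample n) \<Longrightarrow> (\<lambda>t. surv n t z) \<in> borel_measurable borel"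
  using surv_measurable[of "\<lambda>t. t" borel "\<lambda>t. z" n] by simp

lemma at_risk_section_measurable: "z \<in> space (sample n) \<Longrightarrow> (\<lambda>t. at_risk n t z) \<in> borel_measurable borel"
  using at_risk_measurable[of "\<lambda>t. t" borel "\<lambda>t. z" n] by simp

text \<open>
Inserting \<open>surv_telescope\<close> into the integral, each jump \<open>d\<^sub>i\<close> of the product contributes
\<open>d\<^sub>i (1 / S t - 1 / S(X\<^sub>i))\<close>, because \<open>dF / S\<^sup>2 = d(1 / S)\<close>.
\<close>

lemma Duhamel:
  assumes inj: "inj_on (\<lambda>i. fst (z i)) {..<n}" and t: "0 < S t"
  shows "surv n t z / S t = 1
    - (\<Sum>i<n. if fst (z i) < t then surv n (fst (z i)) z / at_risk n (fst (z i)) z / S (fst (z i)) else 0)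
    + (LINT s|\<mu>. indicator {..<t} s * (surv n s z / (S s)\<^sup>2))"
proof -
  define x where "x i = fst (z i)" for i
  define d where "d i = surv n (x i) z / at_risk n (x i) z" for i
  have w: "surv n s z = 1 - (\<Sum>i<n. if x i < s then d i else 0)" for s
    using surv_telescope[OF inj, of s] unfolding x_def d_def .
  let ?I = "{i\<in>{..<n}. x i < t}"
  have pt: "indicator {..<t} s * (surv n s z / (S s)\<^sup>2)
      = indicator {..<t} s / (S s)\<^sup>2 - (\<Sum>i\<in>?I. d i * (indicator {x i<..<t} s / (S s)\<^sup>2))" for s
  proof (cases "s < t")
    case True
    have "(\<Sum>i<n. if x i < s then d i else 0) = (\<Sum>i<n. if x i < t then (if x i < s then d i else 0) else 0)"
      using True by (intro sum.cong) auto
    also have "\<dots> = (\<Sum>i\<in>?I. if x i < s then d i else 0)"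
      by (subst sum.inter_filter) auto
    finally have "surv n s z = 1 - (\<Sum>i\<in>?I. if x i < s then d i else 0)" using w by simp
    moreover have "(\<Sum>i\<in>?I. d i * (indicator {x i<..<t} s / (S s)\<^sup>2)) = (\<Sum>i\<in>?I. if x i < s then d i else 0) / (S s)\<^sup>2"
      unfolding sum_divide_distrib using True by (intro sum.cong) (auto simp: indicator_def)
    ultimately show ?thesis using True by (simp add: diff_divide_distrib)
  qed (auto simp: indicator_def intro!: sum.neutral)
  note core = has_integral_inverse_S_squared[OF t] and bt = integral_inverse_S_squared_between[OF t]
  have ii: "integrable \<mu> (\<lambda>s. d i * (indicator {x i<..<t} s / (S s)\<^sup>2))" if "i \<in> ?I" for i
    by (intro integrable_mult_right bt) (use that in auto)
  have "(LINT s|\<mu>. indicator {..<t} s * (surv n s z / (S s)\<^sup>2))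
     = (LINT s|\<mu>. indicator {..<t} s / (S s)\<^sup>2) - (LINT s|\<mu>. (\<Sum>i\<in>?I. d i * (indicator {x i<..<t} s / (S s)\<^sup>2)))"
    unfolding pt by (intro Bochner_Integration.integral_diff core Bochner_Integration.integrable_sum ii)
  also have "(LINT s|\<mu>. (\<Sum>i\<in>?I. d i * (indicator {x i<..<t} s / (S s)\<^sup>2))) = (\<Sum>i\<in>?I. LINT s|\<mu>. d i * (indicator {x i<..<t} s / (S s)\<^sup>2))"
    by (rule Bochner_Integration.integral_sum) (rule ii)
  also have "\<dots> = (\<Sum>i\<in>?I. d i / S t - d i / S (x i))"
  proof (rule sum.cong)
    fix i assume "i \<in> ?I"
    then show "(LINT s|\<mu>. d i * (indicator {x i<..<t} s / (S s)\<^sup>2)) = d i / S t - d i / S (x i)"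
      by (subst integral_mult_right_zero, subst bt(2)) (auto simp: right_diff_distrib)
  qed simp
  also have "\<dots> = (\<Sum>i\<in>?I. d i) / S t - (\<Sum>i\<in>?I. d i / S (x i))"
    by (simp add: sum_subtractf sum_divide_distrib)
  finally have I: "(LINT s|\<mu>. indicator {..<t} s * (surv n s z / (S s)\<^sup>2))
     = 1 / S t - 1 - ((\<Sum>i\<in>?I. d i) / S t - (\<Sum>i\<in>?I. d i / S (x i)))"
    using core(2) by simp
  have s: "(\<Sum>i\<in>?I. f i) = (\<Sum>i<n. if x i < t then f i else 0)" for f :: "nat \<Rightarrow> real"
    by (rule sum.inter_filter) simp
  have "surv n t z = 1 - (\<Sum>i\<in>?I. d i)" unfolding s by (rule w)
  then have "surv n t z / S t = 1 / S t - (\<Sum>i\<in>?I. d i) / S t" by (simp only: diff_divide_distrib)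
  then have "surv n t z / S t = 1 - (\<Sum>i\<in>?I. d i / S (x i)) + (LINT s|\<mu>. indicator {..<t} s * (surv n s z / (S s)\<^sup>2))"
    using I by linarith
  then show ?thesis unfolding s unfolding x_def d_def .
qed

section \<open>The exact identity for integrals against the estimator\<close>

definition tail :: "(real \<Rightarrow> real) \<Rightarrow> real \<Rightarrow> real" where
  "tail \<phi> t = (LINT x|\<mu>. indicator {t<..} x * \<phi> x)"

text \<open>
The function \<open>\<psi>\<close> of the expansion with its inner integral written against \<open>F\<close> instead of \<open>F\<^sup>*\<close>.
\<close>

definition psi :: "(real \<Rightarrow> real) \<Rightarrow> real \<Rightarrow> real" where
  "psi \<phi> t = \<phi> t * S t - tail \<phi> t"

lemma gt_pred [measurable]: "Measurable.pred (borel \<Otimes>\<^sub>M borel) (\<lambda>p::real\<times>real. snd p \<in> {fst p<..})"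
  and gt_pred' [measurable]: "Measurable.pred (borel \<Otimes>\<^sub>M borel) (\<lambda>p::real\<times>real. fst p \<in> {snd p<..})"
  by simp_all

lemma tail_measurable [measurable]:
  assumes [measurable]: "\<phi> \<in> borel_measurable borel"
  shows "tail \<phi> \<in> borel_measurable borel"
  unfolding tail_def[abs_def]
  by (rule X.borel_measurable_lebesgue_integral) (simp add: split_beta', measurable)

lemma psi_measurable [measurable]:
  assumes [measurable]: "\<phi> \<in> borel_measurable borel"
  shows "psi \<phi> \<in> borel_measurable borel"
  unfolding psi_def[abs_def] by measurable

lemma integrable_restrict:
  assumes "integrable \<mu> (\<phi> :: real \<Rightarrow> real)" "A \<in> sets borel"
  shows "integrable \<mu> (\<lambda>x. indicator A x * \<phi> x)"
  using integrable_mult_indicator[of A \<mu> \<phi>] assms by simp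

lemma abs_tail_le:
  assumes "integrable \<mu> \<phi>"
  shows "\<bar>tail \<phi> t\<bar> \<le> (LINT x|\<mu>. \<bar>\<phi> x\<bar>)"
  unfolding tail_def
  by (rule integral_abs_bound[THEN order_trans], rule integral_mono[OF integrable_abs[OF integrable_restrict] integrable_abs])
     (use assms in \<open>auto simp: indicator_def\<close>)

text \<open>
The largest \<open>X\<^sub>i\<close> is alone at risk, so no mass of the estimator escapes to infinity.
\<close>

lemma surv_eq_0_beyond:
  assumes inj: "inj_on (\<lambda>i. fst (z i)) {..<n}" and tr: "\<forall>i<n. snd (z i) \<le> fst (z i)" and n: "0 < n"
    and t: "\<And>i. i < n \<Longrightarrow> fst (z i) < t"
  shows "surv n t z = 0"
proof (rule surv_eq_0_of_gap[OF inj tr n])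
  show "snd (z 0) \<le> t" using tr[rule_format, OF n] t[OF n] by linarith
  show "at_risk n t z = 0" unfolding at_risk_def using t by (intro sum.neutral) force
qed

lemma surv_support:
  assumes inj: "inj_on (\<lambda>i. fst (z i)) {..<n}" and tr: "\<forall>i<n. snd (z i) \<le> fst (z i)" and n: "0 < n"
    and S: "\<forall>i<n. 0 < S (fst (z i))"
  obtains \<delta> where "0 < \<delta>" "\<And>t. surv n t z \<noteq> 0 \<Longrightarrow> \<delta> \<le> S t"
proof -
  let ?m = "Max ((\<lambda>i. fst (z i)) ` {..<n})"
  have "?m \<in> (\<lambda>i. fst (z i)) ` {..<n}" using n by (intro Max_in) auto
  then have "0 < S ?m" using S by auto
  moreover have "S ?m \<le> S t" if "surv n t z \<noteq> 0" for t
  proof (rule S_antimono)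
    have "\<exists>i<n. t \<le> fst (z i)" using surv_eq_0_beyond[OF inj tr n, of t] that by force
    then obtain i where i: "i < n" "t \<le> fst (z i)" by blast
    have "fst (z i) \<le> ?m" using i(1) by (intro Max_ge) auto
    with i(2) show "t \<le> ?m" by (rule order_trans)
  qed
  ultimately show ?thesis by (rule that)
qed

text \<open>
This is \<open>\<integral> \<phi> d(F\<^sub>n - F) = \<integral> \<psi> Q d(\<Lambda>\<^sub>n - \<Lambda>)\<close>. Writing \<open>\<psi> = \<phi> S - \<integral>\<^bsub>x>\<cdot>\<^esub> \<phi> dF\<close>, Fubini's theorem turns the
part with the tail integral of \<open>\<phi>\<close> into the integral of \<open>\<phi> x\<close> times the right-hand side of the Duhamel equation
at \<open>x\<close>. The exchange is legitimate because \<open>w\<close> vanishes beyond the largest \<open>X\<^sub>i\<close>, where \<open>1 / S\<close> may be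
too large to integrate.
\<close>

lemma lynden_bell_identity:
  assumes z: "z \<in> space (sample n)"
    and inj: "inj_on (\<lambda>i. fst (z i)) {..<n}" and tr: "\<forall>i<n. snd (z i) \<le> fst (z i)" and n: "0 < n"
    and Spos: "\<forall>i<n. 0 < S (fst (z i))"
    and [measurable]: "\<phi> \<in> borel_measurable borel" and \<phi>: "integrable \<mu> \<phi>"
  shows "integrable \<mu> (\<lambda>t. psi \<phi> t * (surv n t z / (S t)\<^sup>2))"
    and "(\<Sum>i<n. \<phi> (fst (z i)) * (surv n (fst (z i)) z / at_risk n (fst (z i)) z)) - (LINT x|\<mu>. \<phi> x)
      = (\<Sum>i<n. psi \<phi> (fst (z i)) * (surv n (fst (z i)) z / at_risk n (fst (z i)) z / S (fst (z i))))
        - (LINT t|\<mu>. psi \<phi> t * (surv n t z / (S t)\<^sup>2))"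
proof -
  interpret PP: pair_prob_space \<mu> \<mu> ..
  note [measurable] = surv_section_measurable[OF z]
  obtain \<delta> where \<delta>: "0 < \<delta>" "\<And>t. surv n t z \<noteq> 0 \<Longrightarrow> \<delta> \<le> S t" using surv_support[OF inj tr n Spos] by blast
  define w where "w t = surv n t z" for t
  define g where "g t = w t / (S t)\<^sup>2" for t
  define b where "b = 1 / \<delta>\<^sup>2"
  define x where "x i = fst (z i)" for i
  define d where "d i = surv n (x i) z / at_risk n (x i) z" for i
  have b0: "0 \<le> b" by (simp add: b_def)
  have [measurable]: "w \<in> borel_measurable borel" "g \<in> borel_measurable borel"
    unfolding g_def[abs_def] w_def[abs_def] by measurable
  have g: "0 \<le> g t" "g t \<le> b" for t
  proof -
    show "0 \<le> g t" by (simp add: g_def w_def)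
    show "g t \<le> b"
    proof (cases "w t = 0")
      case False
      then have "\<delta> \<le> S t" using \<delta> by (auto simp: w_def)
      then have "\<delta>\<^sup>2 \<le> (S t)\<^sup>2" using \<delta>(1) by (intro power_mono) auto
      then show ?thesis unfolding g_def b_def w_def using \<delta>(1) by (intro frac_le) auto
    qed (simp add: g_def b0)
  qed
  have wS: "\<bar>w t / S t\<bar> \<le> 1 / \<delta>" for t
  proof (cases "w t = 0")
    case False
    then have "\<delta> \<le> S t" using \<delta> by (auto simp: w_def)
    then show ?thesis unfolding w_def using \<delta>(1) by (auto intro!: frac_le)
  qed (use \<delta>(1) in simp)
  have \<phi>w: "integrable \<mu> (\<lambda>t. \<phi> t * (w t / S t))"
  proof (rule Bochner_Integration.integrable_bound[OF integrable_mult_right[OF \<phi>, of "1 / \<delta>"]])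
    show "AE t in \<mu>. norm (\<phi> t * (w t / S t)) \<le> norm (1 / \<delta> * \<phi> t)"
      using wS \<delta>(1) by (auto simp: abs_mult simp del: times_divide_eq_left times_divide_eq_right intro!: AE_I2 mult_left_mono simp: mult.commute[of "1 / \<delta>"])
  qed measurable
  have tg: "integrable \<mu> (\<lambda>t. tail \<phi> t * g t)"
  proof (rule X.integrable_const_bound[where B="(LINT x|\<mu>. \<bar>\<phi> x\<bar>) * b"])
    show "AE t in \<mu>. norm (tail \<phi> t * g t) \<le> (LINT x|\<mu>. \<bar>\<phi> x\<bar>) * b"
      unfolding real_norm_def abs_mult
      by (intro AE_I2 mult_mono abs_tail_le[OF \<phi>]) (use g in \<open>auto intro!: integral_nonneg_AE\<close>)
  qed measurable
  have eq: "psi \<phi> t * (surv n t z / (S t)\<^sup>2) = \<phi> t * (w t / S t) - tail \<phi> t * g t" for t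
    by (cases "S t = 0") (simp_all add: psi_def g_def w_def power2_eq_square left_diff_distrib diff_divide_distrib)
  show "integrable \<mu> (\<lambda>t. psi \<phi> t * (surv n t z / (S t)\<^sup>2))"
    unfolding eq by (rule Bochner_Integration.integrable_diff[OF \<phi>w tg])
  have I1: "(LINT t|\<mu>. psi \<phi> t * (surv n t z / (S t)\<^sup>2)) = (LINT t|\<mu>. \<phi> t * (w t / S t)) - (LINT t|\<mu>. tail \<phi> t * g t)"
    unfolding eq by (rule Bochner_Integration.integral_diff[OF \<phi>w tg])
  have "(LINT t|\<mu>. tail \<phi> t * g t) = (LINT t|\<mu>. LINT x|\<mu>. indicator {t<..} x * \<phi> x * g t)"
    unfolding tail_def by (intro Bochner_Integration.integral_cong refl integral_mult_left_zero[symmetric])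
  also have "\<dots> = (LINT x|\<mu>. LINT t|\<mu>. indicator {t<..} x * \<phi> x * g t)"
  proof (rule PP.Fubini_integral)
    have p: "integrable (\<mu> \<Otimes>\<^sub>M \<mu>) (\<lambda>(x, t). \<phi> x * b)"
    proof (rule PP.Fubini_integrable)
      show "integrable \<mu> (\<lambda>x. LINT t|\<mu>. norm (case (x, t) of (x, t) \<Rightarrow> \<phi> x * b))"
        using \<phi> X.prob_space by (simp add: abs_mult b0)
    qed (auto simp: split_beta')
    show "integrable (\<mu> \<Otimes>\<^sub>M \<mu>) (\<lambda>(x, t). indicator {t<..} x * \<phi> x * g t)"
    proof (rule Bochner_Integration.integrable_bound[OF p])
      show "AE p in \<mu> \<Otimes>\<^sub>M \<mu>. norm (case p of (x, t) \<Rightarrow> indicator {t<..} x * \<phi> x * g t) \<le> norm (case p of (x, t) \<Rightarrow> \<phi> x * b)"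
        using g b0 by (auto simp: abs_mult indicator_def split_beta' intro!: AE_I2 mult_left_mono)
      show "(\<lambda>(x, t). indicator {t<..} x * \<phi> x * g t) \<in> borel_measurable (\<mu> \<Otimes>\<^sub>M \<mu>)"
        unfolding split_beta' by measurable
    qed
  qed
  also have "\<dots> = (LINT x|\<mu>. \<phi> x * (w x / S x) - \<phi> x + (\<Sum>i<n. d i / S (fst (z i)) * (indicator {fst (z i)<..} x * \<phi> x)))"
  proof (rule integral_cong_AE)
    show "AE y in \<mu>. (LINT t|\<mu>. indicator {t<..} y * \<phi> y * g t)
       = \<phi> y * (w y / S y) - \<phi> y + (\<Sum>i<n. d i / S (fst (z i)) * (indicator {fst (z i)<..} y * \<phi> y))"
      using AE_S_pos
    proof eventually_elim
      case (elim y)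
      have "(LINT t|\<mu>. indicator {t<..} y * \<phi> y * g t) = (LINT t|\<mu>. \<phi> y * (indicator {..<y} t * (surv n t z / (S t)\<^sup>2)))"
        by (intro Bochner_Integration.integral_cong refl) (auto simp: indicator_def g_def w_def)
      also have "\<dots> = \<phi> y * (LINT t|\<mu>. indicator {..<y} t * (surv n t z / (S t)\<^sup>2))"
        by (rule integral_mult_right_zero)
      also have "(LINT t|\<mu>. indicator {..<y} t * (surv n t z / (S t)\<^sup>2)) = w y / S y - 1 + (\<Sum>i<n. if x i < y then d i / S (x i) else 0)"
        using Duhamel[OF inj elim] by (simp add: w_def d_def x_def cong: if_cong)
      also have "\<phi> y * \<dots> = \<phi> y * (w y / S y) - \<phi> y + (\<Sum>i<n. d i / S (fst (z i)) * (indicator {fst (z i)<..} y * \<phi> y))"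
        unfolding distrib_left right_diff_distrib sum_distrib_left x_def
        by (intro arg_cong2[where f="(+)"] arg_cong2[where f="(-)"] sum.cong) (auto simp: indicator_def)
      finally show ?case .
    qed
    show "(\<lambda>y. LINT t|\<mu>. indicator {t<..} y * \<phi> y * g t) \<in> borel_measurable \<mu>"
      by (rule X.measurable_finite_borel, rule X.borel_measurable_lebesgue_integral) (simp add: split_beta', measurable)
  qed measurable
  also have "\<dots> = (LINT x|\<mu>. \<phi> x * (w x / S x)) - (LINT x|\<mu>. \<phi> x) + (\<Sum>i<n. d i / S (x i) * tail \<phi> (x i))"
  proof -
    have it: "integrable \<mu> (\<lambda>y. d i / S (fst (z i)) * (indicator {fst (z i)<..} y * \<phi> y))" for i
      by (intro integrable_mult_right integrable_restrict \<phi>) auto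
    have "(LINT x|\<mu>. \<phi> x * (w x / S x) - \<phi> x + (\<Sum>i<n. d i / S (fst (z i)) * (indicator {fst (z i)<..} x * \<phi> x)))
       = (LINT x|\<mu>. \<phi> x * (w x / S x) - \<phi> x) + (LINT x|\<mu>. (\<Sum>i<n. d i / S (fst (z i)) * (indicator {fst (z i)<..} x * \<phi> x)))"
      by (intro Bochner_Integration.integral_add Bochner_Integration.integrable_diff Bochner_Integration.integrable_sum it \<phi>w \<phi>)
    also have "(LINT x|\<mu>. \<phi> x * (w x / S x) - \<phi> x) = (LINT x|\<mu>. \<phi> x * (w x / S x)) - (LINT x|\<mu>. \<phi> x)"
      by (rule Bochner_Integration.integral_diff[OF \<phi>w \<phi>])
    also have "(LINT x|\<mu>. (\<Sum>i<n. d i / S (fst (z i)) * (indicator {fst (z i)<..} x * \<phi> x))) = (\<Sum>i<n. LINT x|\<mu>. d i / S (fst (z i)) * (indicator {fst (z i)<..} x * \<phi> x))"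
      by (rule Bochner_Integration.integral_sum) (rule it)
    finally show ?thesis by (simp add: tail_def x_def del: times_divide_eq_left)
  qed
  finally have I2: "(LINT t|\<mu>. tail \<phi> t * g t) = (LINT x|\<mu>. \<phi> x * (w x / S x)) - (LINT x|\<mu>. \<phi> x) + (\<Sum>i<n. d i / S (x i) * tail \<phi> (x i))" .
  have "(\<Sum>i<n. psi \<phi> (x i) * (d i / S (x i))) = (\<Sum>i<n. \<phi> (x i) * d i - d i / S (x i) * tail \<phi> (x i))"
    by (rule sum.cong) (use Spos in \<open>auto simp: psi_def x_def field_simps dest: spec\<close>)
  also have "\<dots> = (\<Sum>i<n. \<phi> (x i) * d i) - (\<Sum>i<n. d i / S (x i) * tail \<phi> (x i))"
    by (rule sum_subtractf)
  finally have "(\<Sum>i<n. psi \<phi> (x i) * (d i / S (x i))) = \<dots>" .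
  then show "(\<Sum>i<n. \<phi> (fst (z i)) * (surv n (fst (z i)) z / at_risk n (fst (z i)) z)) - (LINT x|\<mu>. \<phi> x)
      = (\<Sum>i<n. psi \<phi> (fst (z i)) * (surv n (fst (z i)) z / at_risk n (fst (z i)) z / S (fst (z i))))
        - (LINT t|\<mu>. psi \<phi> t * (surv n t z / (S t)\<^sup>2))"
    unfolding I1 I2 x_def d_def by simp
qed

end

section \<open>Square integrability of psi and moments of the number at risk\<close>

lemma abs_le_1_plus_square: "\<bar>a\<bar> \<le> 1 + a\<^sup>2" for a :: real
  using sum_squares_bound[of "\<bar>a\<bar>" 1] by simp

lemma square_sum_le: "(a + b)\<^sup>2 \<le> 2 * a\<^sup>2 + 2 * b\<^sup>2" for a b :: real
  using sum_squares_bound[of a b] by (simp add: power2_sum)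

lemma square_diff_le: "(a - b)\<^sup>2 \<le> 2 * a\<^sup>2 + 2 * b\<^sup>2" for a b :: real
  using square_sum_le[of a "- b"] by simp

context truncation_model
begin

lemma median_exists: obtains m where "S m = 1 / 2" "0 < G m"
proof -
  obtain m where m: "F m = 1 / 2" by (rule X.cdf_attains[OF atomless, of "1/2"]) auto
  then have "0 < G m" by (intro G_pos) simp
  with m show ?thesis by (intro that[of m]) (auto simp: S_def)
qed

lemma G_mono: "x \<le> y \<Longrightarrow> G x \<le> G y"
  by (rule Y.cdf_nondecreasing)

lemma integrable_phi_square:
  assumes [measurable]: "\<phi> \<in> borel_measurable borel" and i: "integrable \<mu> (\<lambda>x. (\<phi> x)\<^sup>2 / G x)"
  shows "integrable \<mu> (\<lambda>x. (\<phi> x)\<^sup>2)" and "integrable \<mu> \<phi>"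
proof -
  show sq: "integrable \<mu> (\<lambda>x. (\<phi> x)\<^sup>2)"
  proof (rule Bochner_Integration.integrable_bound[OF i])
    show "AE x in \<mu>. norm ((\<phi> x)\<^sup>2) \<le> norm ((\<phi> x)\<^sup>2 / G x)"
      using AE_G_pos
    proof eventually_elim
      case (elim x)
      have "(\<phi> x)\<^sup>2 * G x \<le> (\<phi> x)\<^sup>2 * 1" by (intro mult_left_mono) auto
      then show ?case using elim by (simp add: field_simps)
    qed
  qed measurable
  show "integrable \<mu> \<phi>"
  proof (rule Bochner_Integration.integrable_bound[OF Bochner_Integration.integrable_add[OF _ sq]])
    show "integrable \<mu> (\<lambda>x. 1::real)" by simp
    show "AE x in \<mu>. norm (\<phi> x) \<le> norm (1 + (\<phi> x)\<^sup>2)"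
      using abs_le_1_plus_square by (auto intro!: AE_I2)
  qed measurable
qed

text \<open>
Up to the factor \<open>\<alpha>\<close> this integral is \<open>\<integral> \<psi>\<^sup>2 / C d\<Lambda>\<close>. As \<open>\<psi> / S = \<phi> - tail \<phi> / S\<close>, the first part is
covered by the condition on \<open>\<phi>\<^sup>2 / G\<close>. For the second, \<open>1 / G\<close> is harmful only in the left tail and \<open>1 / S\<close>
only in the right tail: to the left of the median \<open>tail \<phi> / S\<close> is bounded and \<open>1 / G\<close> is integrable,
to the right \<open>1 / G\<close> is bounded and Hardy's inequality applies.
\<close>

lemma psi_square_integrable:
  assumes [measurable]: "\<phi> \<in> borel_measurable borel" and i: "integrable \<mu> (\<lambda>x. (\<phi> x)\<^sup>2 / G x)"
  shows "integrable \<mu> (\<lambda>s. (psi \<phi> s)\<^sup>2 / (G s * (S s)\<^sup>2))"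
proof -
  note sq = integrable_phi_square[OF assms]
  obtain m where m: "S m = 1 / 2" "0 < G m" by (rule median_exists)
  define c where "c = (LINT x|\<mu>. \<bar>\<phi> x\<bar>)"
  have c0: "0 \<le> c" unfolding c_def by (intro integral_nonneg_AE) auto
  define T where "T s = (\<integral>\<^sup>+x. ennreal \<bar>\<phi> x\<bar> * indicator {s<..} x \<partial>\<mu>)\<^sup>2 * ennreal (1 / (S s)\<^sup>2)" for s
  have Tm [measurable]: "T \<in> borel_measurable borel"
  proof -
    have "(\<lambda>s. \<integral>\<^sup>+x. ennreal \<bar>\<phi> x\<bar> * indicator {s<..} x \<partial>\<mu>) \<in> borel_measurable borel"
      by (rule X.borel_measurable_nn_integral) (simp add: split_beta', measurable)
    then show ?thesis unfolding T_def[abs_def] by measurable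
  qed
  have tail_T: "ennreal ((tail \<phi> s / S s)\<^sup>2) \<le> T s" for s
  proof -
    have int: "integrable \<mu> (\<lambda>x. indicator {s<..} x * \<phi> x)" by (rule integrable_restrict[OF sq(2)]) auto
    have "ennreal \<bar>tail \<phi> s\<bar> \<le> (\<integral>\<^sup>+x. norm (indicator {s<..} x * \<phi> x) \<partial>\<mu>)"
      using integral_norm_bound_ennreal[OF int] by (simp add: tail_def)
    also have "\<dots> = (\<integral>\<^sup>+x. ennreal \<bar>\<phi> x\<bar> * indicator {s<..} x \<partial>\<mu>)"
      by (intro nn_integral_cong) (auto simp: indicator_def)
    finally have "(ennreal \<bar>tail \<phi> s\<bar>)\<^sup>2 \<le> (\<integral>\<^sup>+x. ennreal \<bar>\<phi> x\<bar> * indicator {s<..} x \<partial>\<mu>)\<^sup>2"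
      by (rule power_mono_ennreal)
    then have "ennreal ((tail \<phi> s)\<^sup>2) * ennreal (1 / (S s)\<^sup>2) \<le> T s"
      unfolding T_def by (intro mult_right_mono) (auto simp: ennreal_power)
    also have "ennreal ((tail \<phi> s)\<^sup>2) * ennreal (1 / (S s)\<^sup>2) = ennreal ((tail \<phi> s / S s)\<^sup>2)"
      by (simp add: power_divide flip: ennreal_mult)
    finally show ?thesis .
  qed
  have bound: "AE s in \<mu>. ennreal ((psi \<phi> s)\<^sup>2 / (G s * (S s)\<^sup>2))
      \<le> ennreal (2 * ((\<phi> s)\<^sup>2 / G s) + 8 * c\<^sup>2 * (1 / G s)) + ennreal (2 / G m) * T s"
    using AE_S_pos AE_G_pos
  proof eventually_elim
    case (elim s)
    define q where "q = (tail \<phi> s / S s)\<^sup>2"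
    have q0: "0 \<le> q" by (simp add: q_def)
    have "(psi \<phi> s)\<^sup>2 / (G s * (S s)\<^sup>2) = (\<phi> s - tail \<phi> s / S s)\<^sup>2 / G s"
      using elim by (simp add: psi_def divide_simps power2_eq_square)
    also have "\<dots> \<le> (2 * (\<phi> s)\<^sup>2 + 2 * q) / G s"
      unfolding q_def using elim by (intro divide_right_mono square_diff_le) auto
    also have "\<dots> = 2 * ((\<phi> s)\<^sup>2 / G s) + 2 * (q / G s)" by (simp add: add_divide_distrib)
    also have "q / G s \<le> 4 * c\<^sup>2 / G s + q / G m"
    proof (cases "s \<le> m")
      case True
      then have "1 / 2 \<le> S s" using S_antimono m(1) by metis
      then have "c * 1 \<le> c * (S s * 2)" using c0 by (intro mult_left_mono) auto
      then have "\<bar>tail \<phi> s\<bar> \<le> 2 * c * S s"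
        using abs_tail_le[OF sq(2), of s] unfolding c_def[symmetric] by linarith
      then have "\<bar>tail \<phi> s / S s\<bar> \<le> 2 * c"
        using elim by (simp add: divide_le_eq)
      then have "q \<le> (2 * c)\<^sup>2" unfolding q_def using power_mono[of "\<bar>tail \<phi> s / S s\<bar>" "2 * c" 2]
        by (simp only: power2_abs abs_ge_zero)
      then have "q / G s \<le> 4 * c\<^sup>2 / G s" using elim by (intro divide_right_mono) (auto simp: power_mult_distrib)
      then show ?thesis using q0 m(2) by (simp add: add_increasing2)
    next
      case False
      then have "q / G s \<le> q / G m" using G_mono[of m s] q0 m elim by (intro divide_left_mono) auto
      then show ?thesis using c0 elim by (simp add: add_increasing)
    qed
    finally have le: "(psi \<phi> s)\<^sup>2 / (G s * (S s)\<^sup>2) \<le> (2 * ((\<phi> s)\<^sup>2 / G s) + 8 * c\<^sup>2 * (1 / G s)) + 2 / G m * q"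
      by simp
    have "ennreal ((psi \<phi> s)\<^sup>2 / (G s * (S s)\<^sup>2)) \<le> ennreal ((2 * ((\<phi> s)\<^sup>2 / G s) + 8 * c\<^sup>2 * (1 / G s)) + 2 / G m * q)"
      by (rule ennreal_leI[OF le])
    also have "\<dots> = ennreal (2 * ((\<phi> s)\<^sup>2 / G s) + 8 * c\<^sup>2 * (1 / G s)) + ennreal (2 / G m) * ennreal q"
      using q0 m(2) elim by (subst ennreal_plus) (auto simp flip: ennreal_mult'')
    also have "\<dots> \<le> ennreal (2 * ((\<phi> s)\<^sup>2 / G s) + 8 * c\<^sup>2 * (1 / G s)) + ennreal (2 / G m) * T s"
      unfolding q_def by (intro add_left_mono mult_left_mono tail_T) auto
    finally show ?case .
  qed
  have fin1: "integrable \<mu> (\<lambda>s. 2 * ((\<phi> s)\<^sup>2 / G s) + 8 * c\<^sup>2 * (1 / G s))"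
    by (intro Bochner_Integration.integrable_add integrable_mult_right i inverse_G)
  have "(\<integral>\<^sup>+s. ennreal ((psi \<phi> s)\<^sup>2 / (G s * (S s)\<^sup>2)) \<partial>\<mu>)
     \<le> (\<integral>\<^sup>+s. ennreal (2 * ((\<phi> s)\<^sup>2 / G s) + 8 * c\<^sup>2 * (1 / G s)) + ennreal (2 / G m) * T s \<partial>\<mu>)"
    by (rule nn_integral_mono_AE[OF bound])
  also have "\<dots> = (\<integral>\<^sup>+s. ennreal (2 * ((\<phi> s)\<^sup>2 / G s) + 8 * c\<^sup>2 * (1 / G s)) \<partial>\<mu>) + ennreal (2 / G m) * (\<integral>\<^sup>+s. T s \<partial>\<mu>)"
    by (subst nn_integral_add) (auto simp: nn_integral_cmult)
  also have "\<dots> < \<infinity>"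
  proof -
    have a: "(\<integral>\<^sup>+s. ennreal (2 * ((\<phi> s)\<^sup>2 / G s) + 8 * c\<^sup>2 * (1 / G s)) \<partial>\<mu>) < \<infinity>"
      by (subst nn_integral_eq_integral[OF fin1]) auto
    have "(\<integral>\<^sup>+s. T s \<partial>\<mu>) \<le> 4 * (\<integral>\<^sup>+x. ennreal (\<bar>\<phi> x\<bar>\<^sup>2) \<partial>\<mu>)"
      unfolding T_def by (rule Hardy_inequality) auto
    also have "\<dots> = 4 * ennreal (LINT x|\<mu>. (\<phi> x)\<^sup>2)"
      by (subst nn_integral_eq_integral[symmetric, OF sq(1)]) auto
    also have "\<dots> < \<infinity>" by (simp add: ennreal_mult_less_top)
    finally show ?thesis using a by (simp add: ennreal_mult_less_top)
  qed
  finally show ?thesis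
    by (intro integrableI_nonneg) (use AE_G_pos in \<open>auto intro!: AE_I2\<close>)
qed

lemma at_risk_measurable_sample [measurable]: "(\<lambda>z. at_risk n s z) \<in> borel_measurable (sample n)"
  and surv_measurable_sample [measurable]: "(\<lambda>z. surv n s z) \<in> borel_measurable (sample n)"
  by (rule at_risk_measurable surv_measurable; simp)+

lemma at_risk_variance_integrable: "integrable (sample n) (\<lambda>z. (at_risk n s z - n * C s)\<^sup>2)"
proof (rule sample.integrable_const_bound[where B="(real n)\<^sup>2"])
  show "AE z in sample n. norm ((at_risk n s z - n * C s)\<^sup>2) \<le> (real n)\<^sup>2"
  proof (rule AE_I2)
    fix z
    have "n * C s \<le> n" using C_le_1[of s] by (simp add: mult_left_le)
    moreover have "0 \<le> n * C s" by simp
    ultimately have "\<bar>at_risk n s z - n * C s\<bar> \<le> real n"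
      using at_risk_le[of n s z] at_risk_nonneg[of n s z] by linarith
    then show "norm ((at_risk n s z - n * C s)\<^sup>2) \<le> (real n)\<^sup>2"
      by (simp add: abs_le_square_iff[symmetric])
  qed
qed measurable

text \<open>
Chebyshev's inequality: the number at risk is binomial with mean \<open>n C\<close> and variance at most \<open>n C\<close>.
\<close>

lemma at_risk_zero_prob:
  assumes "0 < n" "0 < C s"
  shows "(\<integral>\<^sup>+z. ennreal (if at_risk n s z = 0 then 1 else 0) \<partial>sample n) \<le> ennreal (1 / (n * C s))"
proof -
  let ?p = "n * C s"
  have p: "0 < ?p" using assms by simp
  have "(\<integral>\<^sup>+z. ennreal (if at_risk n s z = 0 then 1 else 0) \<partial>sample n) \<le> (\<integral>\<^sup>+z. ennreal (1 / ?p\<^sup>2 * (at_risk n s z - ?p)\<^sup>2) \<partial>sample n)"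
    by (intro nn_integral_mono ennreal_leI) (use p in auto)
  also have "\<dots> = ennreal (1 / ?p\<^sup>2 * (LINT z|sample n. (at_risk n s z - ?p)\<^sup>2))"
    by (subst nn_integral_eq_integral) (use at_risk_variance_integrable in auto)
  also have "\<dots> \<le> ennreal (1 / ?p\<^sup>2 * ?p)"
    by (intro ennreal_leI mult_left_mono at_risk_variance) auto
  also have "1 / ?p\<^sup>2 * ?p = 1 / ?p" using p by (simp add: power2_eq_square)
  finally show ?thesis .
qed

text \<open>
Either \<open>N \<ge> n C / 2\<close>, or \<open>N\<close> deviates by \<open>n C / 2\<close> from its mean and \<open>1 / N \<le> 1\<close>. The convention \<open>1 / 0 = 0\<close>
removes the samples with nobody at risk.
\<close>

lemma inverse_at_risk_moment:
  assumes "0 < n" "0 < C s"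
  shows "(\<integral>\<^sup>+z. ennreal (1 / at_risk n s z) \<partial>sample n) \<le> ennreal (6 / (n * C s))"
proof -
  let ?p = "n * C s"
  have p: "0 < ?p" using assms by simp
  have "(\<integral>\<^sup>+z. ennreal (1 / at_risk n s z) \<partial>sample n) \<le> (\<integral>\<^sup>+z. ennreal (4 / ?p\<^sup>2 * (at_risk n s z - ?p)\<^sup>2 + 2 / ?p) \<partial>sample n)"
  proof (intro nn_integral_mono ennreal_leI)
    fix z
    let ?N = "at_risk n s z"
    show "1 / ?N \<le> 4 / ?p\<^sup>2 * (?N - ?p)\<^sup>2 + 2 / ?p"
    proof (cases "?p / 2 \<le> ?N")
      case True
      then have "1 / ?N \<le> 1 / (?p / 2)" using p by (intro divide_left_mono) auto
      then have "1 / ?N \<le> 2 / ?p" by simp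
      moreover have "0 \<le> 4 / ?p\<^sup>2 * (?N - ?p)\<^sup>2" by simp
      ultimately show ?thesis by linarith
    next
      case False
      have "1 / ?N \<le> 1" using at_risk_cases[of n s z] by (auto simp: divide_le_eq)
      moreover have "1 \<le> 4 / ?p\<^sup>2 * (?N - ?p)\<^sup>2"
      proof -
        have "\<bar>?p / 2\<bar> \<le> \<bar>?N - ?p\<bar>" using False p by linarith
        then have "(?p / 2)\<^sup>2 \<le> (?N - ?p)\<^sup>2" by (simp only: abs_le_square_iff)
        then have "4 / ?p\<^sup>2 * (?p / 2)\<^sup>2 \<le> 4 / ?p\<^sup>2 * (?N - ?p)\<^sup>2" by (rule mult_left_mono) simp
        moreover have "4 / ?p\<^sup>2 * (?p / 2)\<^sup>2 = 1" using p assms by (simp add: power_divide)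
        ultimately show ?thesis by linarith
      qed
      moreover have "0 \<le> 2 / ?p" using p by simp
      ultimately show ?thesis by linarith
    qed
  qed
  also have "\<dots> = ennreal (LINT z|sample n. 4 / ?p\<^sup>2 * (at_risk n s z - ?p)\<^sup>2 + 2 / ?p)"
    by (rule nn_integral_eq_integral)
       (use at_risk_variance_integrable p in \<open>auto intro!: AE_I2 add_nonneg_nonneg\<close>)
  also have "(LINT z|sample n. 4 / ?p\<^sup>2 * (at_risk n s z - ?p)\<^sup>2 + 2 / ?p) = 4 / ?p\<^sup>2 * (LINT z|sample n. (at_risk n s z - ?p)\<^sup>2) + 2 / ?p"
    by (subst Bochner_Integration.integral_add) (use at_risk_variance_integrable sample.prob_space in auto)
  also have "\<dots> \<le> 4 / ?p\<^sup>2 * ?p + 2 / ?p"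
    by (intro add_right_mono mult_left_mono at_risk_variance) auto
  also have "\<dots> = 6 / ?p" using p by (simp add: power2_eq_square field_simps)
  finally show ?thesis by (simp add: ennreal_leI)
qed

text \<open>
Hoeffding's inequality. Chebyshev's inequality would only give the order \<open>1 / n\<close>, which does not beat the factor
\<open>n\<close> that this probability is multiplied with in \<open>weight_energy_tendsto_0\<close>.
\<close>

lemma at_risk_lower_tail:
  assumes n: "0 < n"
  shows "sample.prob n {z \<in> space (sample n). at_risk n s z \<le> n * C s / 2} \<le> exp (- (C s)\<^sup>2 / 2 * n)"
proof -
  have meas: "(\<lambda>z. risk_ind s (z i)) \<in> borel_measurable (sample n)" if "i < n" for i
    by (rule risk_ind_component_measurable[OF that])
  interpret H: Hoeffding_ineq "sample n" "{..<n}" "\<lambda>i z. risk_ind s (z i)" "\<lambda>_. 0" "\<lambda>_. 1" "n * C s"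
  proof unfold_locales
    show "sample.indep_vars n (\<lambda>_. borel) (\<lambda>i z. risk_ind s (z i)) {..<n}"
      using risk_ind_indep[OF n, of "\<lambda>u. u" s] by simp
    show "n * C s \<equiv> (\<Sum>i<n. sample.expectation n (\<lambda>z. risk_ind s (z i)))"
      using integral_risk_ind_component[of _ n "\<lambda>u. u" s] integral_risk_ind[of s]
      by (simp add: atomize_eq)
  qed (auto simp: risk_ind_def)
  have "sample.prob n {z \<in> space (sample n). at_risk n s z \<le> n * C s / 2}
     = sample.prob n {z \<in> space (sample n). (\<Sum>i<n. risk_ind s (z i)) \<le> n * C s - n * C s / 2}"
    by (simp add: at_risk_sum)
  also have "\<dots> \<le> exp (- 2 * (n * C s / 2)\<^sup>2 / (\<Sum>i<n. (1 - 0)\<^sup>2))"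
    by (rule H.Hoeffding_ineq_le) (use n in auto)
  also have "- 2 * (n * C s / 2)\<^sup>2 / (\<Sum>i<n. (1 - 0)\<^sup>2) = - (C s)\<^sup>2 / 2 * n"
    using n by (simp add: power2_eq_square)
  finally show ?thesis .
qed

end

section \<open>Control of the estimator in the right tail\<close>

lemma surv_no_death:
  assumes "s \<le> t" "\<And>i. i < n \<Longrightarrow> \<not> (s \<le> fst (z i) \<and> fst (z i) < t)"
  shows "surv n t z = surv n s z"
  unfolding surv_def by (rule prod.cong) (use assms in force)+

lemma at_risk_no_death:
  assumes "s \<le> t" "\<And>i. i < n \<Longrightarrow> \<not> (s \<le> fst (z i) \<and> fst (z i) < t)"
  shows "at_risk n s z \<le> at_risk n t z"
  unfolding at_risk_def by (rule sum_mono) (use assms in force)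

lemma surv_one_death:
  assumes i: "i < n" "fst (z i) < t"
    and o: "\<And>j. j < n \<Longrightarrow> j \<noteq> i \<Longrightarrow> \<not> (fst (z i) \<le> fst (z j) \<and> fst (z j) < t)"
  shows "surv n t z = surv n (fst (z i)) z * (1 - 1 / at_risk n (fst (z i)) z)"
proof -
  have "surv n t z = (1 - 1 / at_risk n (fst (z i)) z) *
     (\<Prod>j\<in>{..<n} - {i}. if fst (z j) < t then 1 - 1 / at_risk n (fst (z j)) z else 1)"
    unfolding surv_def using i by (subst prod.remove[of _ i]) auto
  also have "(\<Prod>j\<in>{..<n} - {i}. if fst (z j) < t then 1 - 1 / at_risk n (fst (z j)) z else 1)
      = (\<Prod>j\<in>{..<n} - {i}. if fst (z j) < fst (z i) then 1 - 1 / at_risk n (fst (z j)) z else 1)"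
    by (rule prod.cong) (use i o in force)+
  also have "\<dots> = surv n (fst (z i)) z"
    unfolding surv_def using i by (subst (2) prod.remove[of _ i]) auto
  finally show ?thesis by simp
qed

lemma at_risk_one_death:
  assumes i: "i < n" "fst (z i) < t"
    and o: "\<And>j. j < n \<Longrightarrow> j \<noteq> i \<Longrightarrow> \<not> (fst (z i) \<le> fst (z j) \<and> fst (z j) < t)"
  shows "at_risk n (fst (z i)) z \<le> at_risk n t z + 1"
proof -
  have "at_risk n (fst (z i)) z \<le> (\<Sum>j<n. (if snd (z j) \<le> t \<and> t \<le> fst (z j) then 1 else 0) + (if j = i then 1 else 0))"
    unfolding at_risk_def by (rule sum_mono) (use i o in force)
  also have "\<dots> = at_risk n t z + 1" unfolding at_risk_def using i by (simp add: sum.distrib)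
  finally show ?thesis .
qed

text \<open>
The effect of a death on \<open>w\<^sup>2 / N\<close>: \<open>w\<close> is multiplied by \<open>1 - 1 / N\<close>, and the number at risk drops by at most \<open>1\<close>
(later entries only increase it). The ratio loses at least the fraction \<open>1 / N\<close> of its value.
\<close>

lemma square_over_risk_step:
  fixes w N N' :: real
  assumes N: "1 \<le> N" and N': "N \<le> N' + 1" and c: "N' = 0 \<or> 1 \<le> N'"
  shows "(w * (1 - 1 / N))\<^sup>2 / N' \<le> w\<^sup>2 / N - w\<^sup>2 / N / N"
proof (cases "N = 1")
  case False
  have e: "w\<^sup>2 / N - w\<^sup>2 / N / N = w\<^sup>2 * (N - 1) / N\<^sup>2"
    using N by (simp add: field_simps power2_eq_square)
  show ?thesis
  proof (cases "N' = 0")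
    case True
    then show ?thesis unfolding e using N by simp
  next
    case 2: False
    have "N > 1" "N' > 0" using False N 2 c by auto
    have "(w * (1 - 1 / N))\<^sup>2 / N' = (w\<^sup>2 * (N - 1) / N\<^sup>2) * ((N - 1) / N')"
      using N by (simp add: field_simps power2_eq_square)
    also have "\<dots> \<le> (w\<^sup>2 * (N - 1) / N\<^sup>2) * 1"
      by (rule mult_left_mono) (use N N' \<open>N' > 0\<close> in auto)
    finally show ?thesis unfolding e by simp
  qed
qed (use assms in auto)

text \<open>
With \<open>w\<^sup>2 / 0 = 0\<close>: after a gap the numerator vanishes as well, and the time
before the first entry is avoided by starting where somebody is at risk.
\<close>

definition risk_ratio :: "nat \<Rightarrow> real \<Rightarrow> (nat \<Rightarrow> real \<times> real) \<Rightarrow> real" where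
  "risk_ratio n t z = (surv n t z)\<^sup>2 / at_risk n t z"

lemma risk_ratio_nonneg [simp]: "0 \<le> risk_ratio n t z"
  by (simp add: risk_ratio_def)

lemma risk_ratio_le_1: "risk_ratio n t z \<le> 1"
proof -
  have "(surv n t z)\<^sup>2 \<le> 1" by (simp add: power_le_one)
  then show ?thesis using at_risk_cases[of n t z] unfolding risk_ratio_def
    by (auto simp: divide_le_eq)
qed

lemma risk_ratio_no_death:
  assumes inj: "inj_on (\<lambda>i. fst (z i)) {..<n}" and tr: "\<forall>i<n. snd (z i) \<le> fst (z i)"
    and m: "at_risk n m z \<noteq> 0" "m \<le> s" and st: "s \<le> t" and nd: "\<And>i. i < n \<Longrightarrow> \<not> (s \<le> fst (z i) \<and> fst (z i) < t)"
  shows "risk_ratio n t z \<le> risk_ratio n s z"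
proof (cases "at_risk n s z = 0")
  case True
  have "\<exists>k<n. snd (z k) \<le> m"
  proof (rule ccontr)
    assume "\<not> (\<exists>k<n. snd (z k) \<le> m)"
    then have "at_risk n m z = 0" unfolding at_risk_def by (intro sum.neutral) auto
    then show False using m by simp
  qed
  then obtain k where "k < n" "snd (z k) \<le> s" using m(2) by force
  then have "surv n s z = 0" by (rule surv_eq_0_of_gap[OF inj tr _ _ True])
  then show ?thesis using surv_no_death[OF st nd] by (simp add: risk_ratio_def)
next
  case False
  have "at_risk n s z \<le> at_risk n t z" by (rule at_risk_no_death[OF st nd])
  moreover have "0 < at_risk n s z" using False at_risk_nonneg[of n s z] by linarith
  moreover have "surv n t z = surv n s z" by (rule surv_no_death[OF st nd])
  ultimately show ?thesis
    unfolding risk_ratio_def by (auto intro!: divide_left_mono)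
qed

lemma risk_ratio_one_death:
  assumes tr: "\<forall>i<n. snd (z i) \<le> fst (z i)" and i: "i < n" "fst (z i) < t"
    and o: "\<And>j. j < n \<Longrightarrow> j \<noteq> i \<Longrightarrow> \<not> (fst (z i) \<le> fst (z j) \<and> fst (z j) < t)"
  shows "risk_ratio n t z \<le> risk_ratio n (fst (z i)) z - risk_ratio n (fst (z i)) z / at_risk n (fst (z i)) z"
proof -
  have "1 \<le> at_risk n (fst (z i)) z"
    unfolding at_risk_def using i tr by (intro order_trans[OF _ member_le_sum[of i]]) auto
  moreover have "surv n t z = surv n (fst (z i)) z * (1 - 1 / at_risk n (fst (z i)) z)"
    by (rule surv_one_death) (use i o in auto)
  moreover have "at_risk n (fst (z i)) z \<le> at_risk n t z + 1"
    by (rule at_risk_one_death) (use i o in auto)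
  ultimately show ?thesis
    unfolding risk_ratio_def
    using square_over_risk_step[of "at_risk n (fst (z i)) z" "at_risk n t z" "surv n (fst (z i)) z"] at_risk_cases[of n t z]
    by simp
qed

context truncation_model
begin

lemma risk_ratio_measurable [measurable]:
  assumes [measurable]: "f \<in> borel_measurable M" "g \<in> M \<rightarrow>\<^sub>M sample n"
  shows "(\<lambda>x. risk_ratio n (f x) (g x)) \<in> borel_measurable M"
  unfolding risk_ratio_def by measurable

lemma risk_ratio_weighted_integrable:
  assumes z: "z \<in> space (sample n)" and t: "0 < S t"
  shows "integrable \<mu> (\<lambda>u. indicator {s..<t} u * (risk_ratio n u z / (S u)\<^sup>2))"
proof (rule X.integrable_const_bound[where B="1 / (S t)\<^sup>2"])
  show "AE u in \<mu>. norm (indicator {s..<t} u * (risk_ratio n u z / (S u)\<^sup>2)) \<le> 1 / (S t)\<^sup>2"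
  proof (rule AE_I2)
    fix u
    show "norm (indicator {s..<t} u * (risk_ratio n u z / (S u)\<^sup>2)) \<le> 1 / (S t)\<^sup>2"
    proof (cases "u < t")
      case True
      then have "(S t)\<^sup>2 \<le> (S u)\<^sup>2" by (intro power_mono S_antimono) auto
      then have "risk_ratio n u z / (S u)\<^sup>2 \<le> 1 / (S t)\<^sup>2"
        using t risk_ratio_le_1 by (intro frac_le) auto
      then show ?thesis by (auto simp: indicator_def)
    qed simp
  qed
  have zs: "(\<lambda>u. z) \<in> borel \<rightarrow>\<^sub>M sample n" using z by simp
  note [measurable] = zs
  show "(\<lambda>u. indicator {s..<t} u * (risk_ratio n u z / (S u)\<^sup>2)) \<in> borel_measurable \<mu>"
    by (rule X.measurable_finite_borel) measurable
qed

text \<open>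
Between deaths \<open>w\<^sup>2 / N\<close> can only decrease, so \<open>w\<^sup>2 / (N S)\<close> grows at most by the integral of \<open>w\<^sup>2 / N\<close> against
\<open>d(1 / S) = dF / S\<^sup>2\<close>.
\<close>

lemma risk_ratio_growth:
  assumes z: "z \<in> space (sample n)" and inj: "inj_on (\<lambda>i. fst (z i)) {..<n}" and tr: "\<forall>i<n. snd (z i) \<le> fst (z i)"
    and m: "at_risk n m z \<noteq> 0" "m \<le> s" and st: "s \<le> t" and t: "0 < S t"
    and nd: "\<And>i. i < n \<Longrightarrow> \<not> (s < fst (z i) \<and> fst (z i) < t)"
  shows "risk_ratio n t z / S t \<le> risk_ratio n t z / S s + (LINT u|\<mu>. indicator {s..<t} u * (risk_ratio n u z / (S u)\<^sup>2))"
proof (cases "s = t")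
  case False
  then have st': "s < t" using st by simp
  note b = integral_inverse_S_squared_between[OF t st']
  have "risk_ratio n t z * (1 / S t - 1 / S s) = (LINT u|\<mu>. risk_ratio n t z * (indicator {s<..<t} u / (S u)\<^sup>2))"
    by (subst integral_mult_right_zero) (simp only: b(2))
  also have "\<dots> \<le> (LINT u|\<mu>. indicator {s..<t} u * (risk_ratio n u z / (S u)\<^sup>2))"
  proof (rule integral_mono[OF integrable_mult_right[OF b(1)] risk_ratio_weighted_integrable[OF z t]])
    fix u
    show "risk_ratio n t z * (indicator {s<..<t} u / (S u)\<^sup>2) \<le> indicator {s..<t} u * (risk_ratio n u z / (S u)\<^sup>2)"
    proof (cases "s < u \<and> u < t")
      case True
      then have "risk_ratio n t z \<le> risk_ratio n u z"
        using m nd by (intro risk_ratio_no_death[OF inj tr m(1)]) force+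
      then have "risk_ratio n t z / (S u)\<^sup>2 \<le> risk_ratio n u z / (S u)\<^sup>2" by (rule divide_right_mono) simp
      then show ?thesis using True by simp
    qed (auto simp: indicator_def)
  qed
  finally show ?thesis by (simp add: algebra_simps)
qed simp

text \<open>
Along a path, \<open>b = w\<^sup>2 / (N S)\<close> grows at most at rate \<open>b d\<Lambda>\<close> and loses at least \<open>b / N\<close> at each death. The proof
is by induction on the number of deaths before \<open>t\<close>, removing the last one.
\<close>

lemma risk_ratio_path:
  assumes z: "z \<in> space (sample n)" and inj: "inj_on (\<lambda>i. fst (z i)) {..<n}" and tr: "\<forall>i<n. snd (z i) \<le> fst (z i)"
    and m: "at_risk n m z \<noteq> 0"
  shows "m \<le> t \<Longrightarrow> 0 < S t \<Longrightarrow> risk_ratio n t z / S t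
      + (\<Sum>i<n. if m \<le> fst (z i) \<and> fst (z i) < t then risk_ratio n (fst (z i)) z / S (fst (z i)) / at_risk n (fst (z i)) z else 0)
    \<le> risk_ratio n m z / S m + (LINT u|\<mu>. indicator {m..<t} u * (risk_ratio n u z / (S u)\<^sup>2))"
proof (induction "card {i. i < n \<and> m \<le> fst (z i) \<and> fst (z i) < t}" arbitrary: t rule: less_induct)
  case less
  let ?I = "\<lambda>s t. LINT u|\<mu>. indicator {s..<t} u * (risk_ratio n u z / (S u)\<^sup>2)"
  define D where "D = {i. i < n \<and> m \<le> fst (z i) \<and> fst (z i) < t}"
  define e where "e i = risk_ratio n (fst (z i)) z / S (fst (z i)) / at_risk n (fst (z i)) z" for i
  have fD: "finite D" by (simp add: D_def)
  have Sm: "0 < S m" using less.prems S_antimono[of m t] by linarith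
  have sumD: "(\<Sum>i<n. if m \<le> fst (z i) \<and> fst (z i) < s then e i else 0) = (\<Sum>i\<in>{i. i < n \<and> m \<le> fst (z i) \<and> fst (z i) < s}. e i)" for s
    by (subst sum.inter_filter[symmetric]) (auto intro!: sum.cong)
  show ?case
  proof (cases "D = {}")
    case True
    have "risk_ratio n t z / S t \<le> risk_ratio n t z / S m + ?I m t"
      by (rule risk_ratio_growth[OF z inj tr m order_refl less.prems]) (use True in \<open>auto simp: D_def\<close>)
    moreover have "risk_ratio n t z / S m \<le> risk_ratio n m z / S m"
      by (intro divide_right_mono risk_ratio_no_death[OF inj tr m order_refl less.prems(1)]) (use True in \<open>auto simp: D_def\<close>)
    moreover have "(\<Sum>i<n. if m \<le> fst (z i) \<and> fst (z i) < t then e i else 0) = 0"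
      unfolding sumD D_def[symmetric] True by simp
    ultimately show ?thesis unfolding e_def by linarith
  next
    case False
    obtain i where i: "i \<in> D" "\<And>j. j \<in> D \<Longrightarrow> fst (z j) \<le> fst (z i)"
    proof -
      have "Max ((\<lambda>i. fst (z i)) ` D) \<in> (\<lambda>i. fst (z i)) ` D" using False fD by (intro Max_in) auto
      then obtain i where "i \<in> D" "Max ((\<lambda>i. fst (z i)) ` D) = fst (z i)" by auto
      then show ?thesis using that[of i] fD Max_ge[of "(\<lambda>i. fst (z i)) ` D"] by (metis finite_imageI imageI)
    qed
    define s where "s = fst (z i)"
    have s: "i < n" "m \<le> s" "s < t" using i(1) by (auto simp: D_def s_def)
    have Ss: "0 < S s" using less.prems S_antimono[of s t] s by linarith
    have other: "\<not> (fst (z i) \<le> fst (z j) \<and> fst (z j) < t)" if "j < n" "j \<noteq> i" for j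
    proof
      assume a: "fst (z i) \<le> fst (z j) \<and> fst (z j) < t"
      then have "j \<in> D" using that s by (auto simp: D_def s_def)
      then have "fst (z j) = fst (z i)" using i(2)[of j] a by auto
      then show False using inj that s(1) by (auto simp: inj_on_def)
    qed
    have Ds: "{i. i < n \<and> m \<le> fst (z i) \<and> fst (z i) < s} = D - {i}"
      using other s unfolding D_def s_def by force
    have "card {i. i < n \<and> m \<le> fst (z i) \<and> fst (z i) < s} < card {i. i < n \<and> m \<le> fst (z i) \<and> fst (z i) < t}"
      unfolding Ds unfolding D_def[symmetric] by (rule card_Diff1_less[OF fD i(1)])
    from less.hyps[OF this s(2) Ss]
    have IH: "risk_ratio n s z / S s + (\<Sum>j\<in>D - {i}. e j) \<le> risk_ratio n m z / S m + ?I m s"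
      unfolding e_def[symmetric] sumD Ds .
    have g: "risk_ratio n t z / S t \<le> risk_ratio n t z / S s + ?I s t"
    proof (rule risk_ratio_growth[OF z inj tr m s(2) less_imp_le[OF s(3)] less.prems(2)])
      fix j assume "j < n"
      then show "\<not> (s < fst (z j) \<and> fst (z j) < t)" using other[of j] by (cases "j = i") (auto simp: s_def)
    qed
    have "risk_ratio n t z / S s \<le> (risk_ratio n s z - risk_ratio n s z / at_risk n s z) / S s"
      unfolding s_def by (intro divide_right_mono risk_ratio_one_death[OF tr s(1)] other) (use s in \<open>auto simp: s_def\<close>)
    also have "\<dots> = risk_ratio n s z / S s - e i" unfolding e_def s_def by (simp add: diff_divide_distrib)
    finally have d: "risk_ratio n t z / S s \<le> risk_ratio n s z / S s - e i" .
    have "?I m t = (LINT u|\<mu>. indicator {m..<s} u * (risk_ratio n u z / (S u)\<^sup>2) + indicator {s..<t} u * (risk_ratio n u z / (S u)\<^sup>2))"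
      by (intro Bochner_Integration.integral_cong refl) (use s in \<open>auto simp: indicator_def\<close>)
    also have "\<dots> = ?I m s + ?I s t"
      by (rule Bochner_Integration.integral_add[OF risk_ratio_weighted_integrable[OF z Ss] risk_ratio_weighted_integrable[OF z less.prems(2)]])
    finally have I: "?I m t = ?I m s + ?I s t" .
    have "(\<Sum>i<n. if m \<le> fst (z i) \<and> fst (z i) < t then e i else 0) = e i + (\<Sum>j\<in>D - {i}. e j)"
      unfolding sumD D_def[symmetric] by (rule sum.remove[OF fD i(1)])
    then show ?thesis using IH g d I unfolding e_def[symmetric] by linarith
  qed
qed

lemma pair_sigma_sample: "pair_sigma_finite (sample n) \<mu>"
  by (intro pair_sigma_finite.intro) unfold_locales

lemma sets_sample_mu: "sets (sample n \<Otimes>\<^sub>M \<mu>) = sets (sample n \<Otimes>\<^sub>M borel)"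
  by (intro sets_pair_measure_cong) auto

lemma nn_integral_sample_swap:
  assumes "(\<lambda>p. f (fst p) (snd p)) \<in> borel_measurable (sample n \<Otimes>\<^sub>M borel)"
  shows "(\<integral>\<^sup>+z. \<integral>\<^sup>+t. f z t \<partial>\<mu> \<partial>sample n) = (\<integral>\<^sup>+t. \<integral>\<^sup>+z. f z t \<partial>sample n \<partial>\<mu>)"
proof -
  interpret P: pair_sigma_finite "sample n" \<mu> by (rule pair_sigma_sample)
  show ?thesis
    by (rule P.Fubini'[symmetric])
       (use assms in \<open>simp add: split_beta' measurable_cong_sets[OF sets_sample_mu refl]\<close>)
qed

text \<open>
Deaths occur at rate \<open>N d\<Lambda>\<close>, so by the compensator formula the loss \<open>b / N\<close> at the deaths has the same mean as the
growth \<open>\<integral> b d\<Lambda>\<close> between them, and the two cancel in \<open>risk_ratio_path\<close>. The restriction to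
samples with somebody at risk at time \<open>m\<close> excludes an increase of \<open>b\<close> from \<open>0\<close> at a first entry.
\<close>

lemma risk_ratio_expectation_decay:
  assumes m: "m \<le> t" and t: "0 < S t"
  shows "(\<integral>\<^sup>+z. ennreal ((if at_risk n m z = 0 then 0 else 1) * (risk_ratio n t z / S t)) \<partial>sample n)
    \<le> (\<integral>\<^sup>+z. ennreal (risk_ratio n m z / S m) \<partial>sample n)"
proof -
  define A where "A z = (if at_risk n m z = 0 then 0 else 1 :: real)" for z
  have A: "A z = 0 \<or> A z = 1" for z by (simp add: A_def)
  have Am[measurable]: "A \<in> borel_measurable (sample n)" unfolding A_def[abs_def] by measurable
  have Sm: "0 < S m" using t S_antimono[OF m] by linarith
  \<comment> \<open>The loss \<open>b / N\<close> at a death at time \<open>u\<close>. It is predictable because \<open>A\<close> is known from time \<open>m\<close> on.\<close>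
  define K where "K = (\<lambda>u z. A z * (indicator {m..<t} u * (risk_ratio n u z / S u / at_risk n u z)))"
  have Kpred: "predictable n K"
    unfolding predictable_def
  proof (intro allI impI)
    fix i u and z :: "nat \<Rightarrow> real \<times> real"
    assume i: "i < n" "u \<le> fst (z i)"
    let ?z = "z(i := (u, snd (z i)))"
    have "at_risk n u ?z = at_risk n u z" "surv n u ?z = surv n u z"
      using predictable_at_risk predictable_surv i unfolding predictable_def by blast+
    moreover have "A ?z = A z" if "m \<le> u"
      using predictableD[where z=z and t=u and s=m, OF predictable_at_risk i(1) that i(2)] by (simp add: A_def)
    ultimately show "K u ?z = K u z" unfolding K_def risk_ratio_def by (auto simp: indicator_def)
  qed
  have Km: "case_prod K \<in> borel_measurable (borel \<Otimes>\<^sub>M sample n)"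
    unfolding K_def split_beta' by measurable
  have K0: "0 \<le> K u z" for u z using A[of z] by (auto simp: K_def)
  define I where "I z = (LINT u|\<mu>. indicator {m..<t} u * (risk_ratio n u z / (S u)\<^sup>2))" for z
  have I0: "0 \<le> I z" for z unfolding I_def by (intro integral_nonneg_AE AE_I2) auto
  have Im[measurable]: "I \<in> borel_measurable (sample n)"
  proof -
    have "(\<lambda>z. LINT u|\<mu>. indicator {m..<t} u * (risk_ratio n u z / (S u)\<^sup>2)) \<in> borel_measurable (sample n)"
      by (rule X.borel_measurable_lebesgue_integral)
         (unfold split_beta' measurable_cong_sets[OF sets_sample_mu refl], measurable)
    then show ?thesis unfolding I_def[abs_def] .
  qed
  have KI: "(\<integral>\<^sup>+z. (\<Sum>i<n. ennreal (K (fst (z i)) z)) \<partial>sample n) = (\<integral>\<^sup>+z. ennreal (A z * I z) \<partial>sample n)"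
  proof -
    have "(\<integral>\<^sup>+z. (\<Sum>i<n. ennreal (K (fst (z i)) z)) \<partial>sample n)
        = (\<integral>\<^sup>+z. \<integral>\<^sup>+u. ennreal (K u z) * ennreal (at_risk n u z / S u) \<partial>\<mu> \<partial>sample n)"
    proof (rule compensator)
      show "(\<lambda>(t, z). ennreal (K t z)) \<in> borel_measurable (borel \<Otimes>\<^sub>M sample n)"
        using Km by (simp add: split_beta')
      show "predictable n (\<lambda>t z. ennreal (K t z))" using Kpred by (simp add: predictable_def)
    qed
    also have "\<dots> = (\<integral>\<^sup>+z. ennreal (A z * I z) \<partial>sample n)"
    proof (rule nn_integral_cong)
      fix z assume z: "z \<in> space (sample n)"
      have "(\<integral>\<^sup>+u. ennreal (K u z) * ennreal (at_risk n u z / S u) \<partial>\<mu>)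
          = (\<integral>\<^sup>+u. ennreal (A z * (indicator {m..<t} u * (risk_ratio n u z / (S u)\<^sup>2))) \<partial>\<mu>)"
      proof (rule nn_integral_cong)
        fix u
        have "K u z * (at_risk n u z / S u) = A z * (indicator {m..<t} u * (risk_ratio n u z / (S u)\<^sup>2))"
          by (simp add: K_def power2_eq_square risk_ratio_def)
        then show "ennreal (K u z) * ennreal (at_risk n u z / S u) = ennreal (A z * (indicator {m..<t} u * (risk_ratio n u z / (S u)\<^sup>2)))"
          using ennreal_mult'[OF K0[of u z], of "at_risk n u z / S u"] by simp
      qed
      also have "\<dots> = ennreal (LINT u|\<mu>. A z * (indicator {m..<t} u * (risk_ratio n u z / (S u)\<^sup>2)))"
        by (rule nn_integral_eq_integral[OF integrable_mult_right[OF risk_ratio_weighted_integrable[OF z t]]])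
           (use A[of z] in \<open>auto intro!: AE_I2\<close>)
      also have "(LINT u|\<mu>. A z * (indicator {m..<t} u * (risk_ratio n u z / (S u)\<^sup>2))) = A z * I z"
        unfolding I_def by (rule integral_mult_right_zero)
      finally show "(\<integral>\<^sup>+u. ennreal (K u z) * ennreal (at_risk n u z / S u) \<partial>\<mu>) = ennreal (A z * I z)" .
    qed
    finally show ?thesis .
  qed
  have fin: "(\<integral>\<^sup>+z. ennreal (A z * I z) \<partial>sample n) < \<infinity>"
  proof -
    have "(\<integral>\<^sup>+z. ennreal (A z * I z) \<partial>sample n) \<le> (\<integral>\<^sup>+z. ennreal (1 / (S t)\<^sup>2) \<partial>sample n)"
    proof (intro nn_integral_mono ennreal_leI)
      fix z assume z: "z \<in> space (sample n)"
      have "I z \<le> (LINT u|\<mu>. 1 / (S t)\<^sup>2)"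
        unfolding I_def
      proof (rule integral_mono[OF risk_ratio_weighted_integrable[OF z t]])
        fix u
        show "indicator {m..<t} u * (risk_ratio n u z / (S u)\<^sup>2) \<le> 1 / (S t)\<^sup>2"
        proof (cases "u < t")
          case True
          then have "(S t)\<^sup>2 \<le> (S u)\<^sup>2" by (intro power_mono S_antimono) auto
          then have "risk_ratio n u z / (S u)\<^sup>2 \<le> 1 / (S t)\<^sup>2"
            using t risk_ratio_le_1 by (intro frac_le) auto
          then show ?thesis by (auto simp: indicator_def)
        qed simp
      qed simp
      then have "I z \<le> 1 / (S t)\<^sup>2" using X.prob_space by simp
      then show "A z * I z \<le> 1 / (S t)\<^sup>2" using A[of z] by auto
    qed
    also have "\<dots> < \<infinity>" by (simp add: sample.emeasure_space_1)
    finally show ?thesis .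
  qed
  \<comment> \<open>The two terms of equal mean appear on either side of the path inequality; finiteness allows to cancel them.\<close>
  have path: "AE z in sample n. ennreal (A z * (risk_ratio n t z / S t)) + (\<Sum>i<n. ennreal (K (fst (z i)) z))
      \<le> ennreal (risk_ratio n m z / S m) + ennreal (A z * I z)"
    using AE_sample_distinct AE_sample_truncated AE_space
  proof eventually_elim
    case (elim z)
    have "A z * (risk_ratio n t z / S t) + (\<Sum>i<n. K (fst (z i)) z) \<le> risk_ratio n m z / S m + A z * I z"
    proof (cases "at_risk n m z = 0")
      case True
      then have "A z = 0" by (simp add: A_def)
      then show ?thesis by (simp add: K_def)
    next
      case False
      then have A1: "A z = 1" by (simp add: A_def)
      have "(\<Sum>i<n. K (fst (z i)) z) = (\<Sum>i<n. if m \<le> fst (z i) \<and> fst (z i) < t then risk_ratio n (fst (z i)) z / S (fst (z i)) / at_risk n (fst (z i)) z else 0)"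
        by (rule sum.cong) (auto simp: K_def A1 indicator_def)
      then show ?thesis using risk_ratio_path[OF elim(3,1,2) False m t] by (simp add: A1 I_def)
    qed
    then have "ennreal (A z * (risk_ratio n t z / S t) + (\<Sum>i<n. K (fst (z i)) z)) \<le> ennreal (risk_ratio n m z / S m + A z * I z)"
      by (rule ennreal_leI)
    moreover have "0 \<le> A z * (risk_ratio n t z / S t)" "0 \<le> A z * I z" "0 \<le> (\<Sum>i<n. K (fst (z i)) z)" "0 \<le> risk_ratio n m z / S m"
      using A[of z] I0[of z] K0 by (auto intro!: sum_nonneg)
    ultimately show ?case by (simp add: ennreal_plus sum_ennreal K0 del: times_divide_eq_right)
  qed
  have Ksm: "(\<lambda>z. \<Sum>i<n. ennreal (K (fst (z i)) z)) \<in> borel_measurable (sample n)"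
    by (intro borel_measurable_sum measurable_compose[OF measurable_at_observation[OF Km refl] measurable_ennreal]) auto
  have "(\<integral>\<^sup>+z. ennreal (A z * (risk_ratio n t z / S t)) \<partial>sample n) + (\<integral>\<^sup>+z. ennreal (A z * I z) \<partial>sample n)
     = (\<integral>\<^sup>+z. ennreal (A z * (risk_ratio n t z / S t)) + (\<Sum>i<n. ennreal (K (fst (z i)) z)) \<partial>sample n)"
    unfolding KI[symmetric] by (rule nn_integral_add[OF _ Ksm, symmetric]) measurable
  also have "\<dots> \<le> (\<integral>\<^sup>+z. ennreal (risk_ratio n m z / S m) + ennreal (A z * I z) \<partial>sample n)"
    by (rule nn_integral_mono_AE[OF path])
  also have "\<dots> = (\<integral>\<^sup>+z. ennreal (risk_ratio n m z / S m) \<partial>sample n) + (\<integral>\<^sup>+z. ennreal (A z * I z) \<partial>sample n)"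
    by (rule nn_integral_add) measurable
  finally show ?thesis
    using fin unfolding A_def by (subst (asm) (1 2) add.commute) (auto simp: ennreal_add_left_cancel_le)
qed

lemma risk_ratio_moment:
  assumes n: "0 < n" and m: "0 < C m" "m \<le> t" and t: "0 < S t"
  shows "(\<integral>\<^sup>+z. ennreal ((if at_risk n m z = 0 then 0 else 1) * risk_ratio n t z) \<partial>sample n)
    \<le> ennreal (6 * S t / (n * C m * S m))"
proof -
  have Sm: "0 < S m" using t S_antimono[OF m(2)] by linarith
  have "(\<integral>\<^sup>+z. ennreal ((if at_risk n m z = 0 then 0 else 1) * risk_ratio n t z) \<partial>sample n)
     = (\<integral>\<^sup>+z. ennreal (S t) * ennreal ((if at_risk n m z = 0 then 0 else 1) * (risk_ratio n t z / S t)) \<partial>sample n)"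
    by (intro nn_integral_cong) (use t in \<open>simp flip: ennreal_mult'\<close>)
  also have "\<dots> = ennreal (S t) * (\<integral>\<^sup>+z. ennreal ((if at_risk n m z = 0 then 0 else 1) * (risk_ratio n t z / S t)) \<partial>sample n)"
    by (rule nn_integral_cmult) measurable
  also have "\<dots> \<le> ennreal (S t) * (\<integral>\<^sup>+z. ennreal (risk_ratio n m z / S m) \<partial>sample n)"
    by (intro mult_left_mono risk_ratio_expectation_decay m t) auto
  also have "(\<integral>\<^sup>+z. ennreal (risk_ratio n m z / S m) \<partial>sample n) \<le> (\<integral>\<^sup>+z. ennreal (1 / S m) * ennreal (1 / at_risk n m z) \<partial>sample n)"
  proof (rule nn_integral_mono)
    fix z
    have "(surv n m z)\<^sup>2 \<le> 1" by (simp add: power_le_one)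
    then have "risk_ratio n m z \<le> 1 / at_risk n m z" unfolding risk_ratio_def by (rule divide_right_mono) simp
    then have "risk_ratio n m z / S m \<le> 1 / at_risk n m z / S m" by (rule divide_right_mono) simp
    then show "ennreal (risk_ratio n m z / S m) \<le> ennreal (1 / S m) * ennreal (1 / at_risk n m z)"
      by (simp add: mult.commute flip: ennreal_mult'')
  qed
  also have "\<dots> = ennreal (1 / S m) * (\<integral>\<^sup>+z. ennreal (1 / at_risk n m z) \<partial>sample n)"
    by (rule nn_integral_cmult) measurable
  also have "\<dots> \<le> ennreal (1 / S m) * ennreal (6 / (n * C m))"
    by (intro mult_left_mono inverse_at_risk_moment n m) auto
  also have "ennreal (S t) * (ennreal (1 / S m) * ennreal (6 / (n * C m))) = ennreal (6 * S t / (n * C m * S m))"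
    using Sm by (simp add: mult_ac flip: ennreal_mult'')
  finally show ?thesis by (simp add: mult_left_mono)
qed

section \<open>Consistency of the estimator at a point\<close>

lemma inverse_C_le:
  assumes "u < t" "0 < S t" "0 < G u"
  shows "1 / C u \<le> \<alpha> / S t * (1 / G u)"
proof -
  have "0 < S u" "S t \<le> S u" using assms S_antimono[of u t] by auto
  then have "\<alpha> / (G u * S u) \<le> \<alpha> / (G u * S t)"
    using assms alpha_pos by (intro divide_left_mono mult_left_mono mult_pos_pos) auto
  then show ?thesis by (simp add: C_def mult.commute)
qed

text \<open>
On \<open>{..<t}\<close> the function \<open>1 / C\<close> is at most a multiple of \<open>1 / G\<close>, which is integrable.
\<close>

lemma early_time_average:
  assumes t: "0 < S t" and n: "0 < n" and c: "0 \<le> c" and k: "0 \<le> k"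
    and q: "(\<lambda>p. q (snd p) (fst p)) \<in> borel_measurable (sample n \<Otimes>\<^sub>M borel)"
    and le: "\<And>u. 0 < C u \<Longrightarrow> (\<integral>\<^sup>+z. q u z \<partial>sample n) \<le> ennreal (k / (n * C u))"
  shows "(\<integral>\<^sup>+z. \<integral>\<^sup>+u. ennreal (c * indicator {..<t} u) * q u z \<partial>\<mu> \<partial>sample n)
    \<le> ennreal (c * k * (\<alpha> / S t) * (LINT u|\<mu>. 1 / G u) / n)"
proof -
  have qs: "q u \<in> borel_measurable (sample n)" for u
    using measurable_compose[OF measurable_Pair2' q, of u] by simp
  have "(\<integral>\<^sup>+z. \<integral>\<^sup>+u. ennreal (c * indicator {..<t} u) * q u z \<partial>\<mu> \<partial>sample n)
      = (\<integral>\<^sup>+u. \<integral>\<^sup>+z. ennreal (c * indicator {..<t} u) * q u z \<partial>sample n \<partial>\<mu>)"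
    by (rule nn_integral_sample_swap) (use q in measurable)
  also have "\<dots> \<le> (\<integral>\<^sup>+u. ennreal (c * k * (\<alpha> / S t) / n * (1 / G u)) \<partial>\<mu>)"
  proof (rule nn_integral_mono_AE, use AE_G_pos AE_S_pos in eventually_elim)
    case (elim u)
    have "(\<integral>\<^sup>+z. ennreal (c * indicator {..<t} u) * q u z \<partial>sample n) = ennreal (c * indicator {..<t} u) * (\<integral>\<^sup>+z. q u z \<partial>sample n)"
      by (rule nn_integral_cmult[OF qs])
    also have "\<dots> \<le> ennreal (c * indicator {..<t} u) * ennreal (k / (n * C u))"
      by (intro mult_left_mono le C_pos elim) auto
    also have "\<dots> = ennreal (c * indicator {..<t} u * (k / (n * C u)))"
      using k by (simp flip: ennreal_mult'')
    also have "\<dots> \<le> ennreal (c * k * (\<alpha> / S t) / n * (1 / G u))"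
    proof (rule ennreal_leI, cases "u < t")
      case True
      have "c * indicator {..<t} u * (k / (n * C u)) = c * k / n * (1 / C u)" using True by simp
      also have "\<dots> \<le> c * k / n * (\<alpha> / S t * (1 / G u))"
        by (intro mult_left_mono inverse_C_le True t elim) (use c k in auto)
      finally show "c * indicator {..<t} u * (k / (n * C u)) \<le> c * k * (\<alpha> / S t) / n * (1 / G u)"
        by (simp add: mult_ac)
    qed (use t alpha_pos c k in simp)
    finally show ?case .
  qed
  also have "\<dots> = ennreal (LINT u|\<mu>. c * k * (\<alpha> / S t) / n * (1 / G u))"
    by (rule nn_integral_eq_integral[OF integrable_mult_right[OF inverse_G]]) (use c k t alpha_pos in auto)
  also have "(LINT u|\<mu>. c * k * (\<alpha> / S t) / n * (1 / G u)) = c * k * (\<alpha> / S t) / n * (LINT u|\<mu>. 1 / G u)"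
    by (rule integral_mult_right_zero)
  finally show ?thesis by (simp only: times_divide_eq_left)
qed

text \<open>
By the Duhamel equation \<open>Q t - 1\<close> is minus the compensated sum of \<open>H u = 1{u < t} Q u / N u\<close>, plus the integral of
\<open>Q\<close> over \<open>{N = 0}\<close>. Before time \<open>t\<close> both \<open>Q\<close> and \<open>1 / S\<close> are at most \<open>1 / S t\<close>, so the second moments of both
terms are of order \<open>1 / n\<close> by the bounds on \<open>E[1 / N]\<close> and \<open>P(N = 0)\<close>.
\<close>

lemma surv_consistency:
  assumes t: "0 < S t"
  obtains K where "0 \<le> K" "\<And>n. 0 < n \<Longrightarrow> (\<integral>\<^sup>+z. ennreal ((surv n t z / S t - 1)\<^sup>2) \<partial>sample n) \<le> ennreal (K / n)"
proof -
  define A0 where "A0 = (LINT u|\<mu>. 1 / G u)"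
  have A0: "0 \<le> A0" unfolding A0_def by (intro integral_nonneg_AE AE_I2) auto
  define K1 where "K1 = 1 / (S t)^3 * 6 * (\<alpha> / S t) * A0"
  define K2 where "K2 = 1 / (S t)^4 * 1 * (\<alpha> / S t) * A0"
  define K where "K = 2 * K1 + 2 * K2"
  have K0: "0 \<le> K1" "0 \<le> K2" using t alpha_pos A0 by (auto simp: K1_def K2_def)
  show ?thesis
  proof (rule that[of K])
    show "0 \<le> K" using K0 by (simp add: K_def)
    fix n :: nat assume n: "0 < n"
    define H where "H = (\<lambda>u z. indicator {..<t} u * (surv n u z / (S u * at_risk n u z)))"
    have Hpred: "predictable n H"
      using predictable_at_risk[of n] predictable_surv[of n] by (simp add: predictable_def H_def)
    have Hm: "case_prod H \<in> borel_measurable (borel \<Otimes>\<^sub>M sample n)"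
      unfolding H_def split_beta' by measurable
    define v where "v u z = indicator {..<t} u * (if at_risk n u z = 0 then 1 else 0 :: real)" for u z
    have vm: "(\<lambda>p. v (snd p) (fst p)) \<in> borel_measurable (sample n \<Otimes>\<^sub>M borel)"
      unfolding v_def by measurable
    have v01: "0 \<le> v u z" "v u z \<le> 1" for u z by (auto simp: v_def indicator_def)
    define p where "p z = (LINT u|\<mu>. v u z)" for z
    have le3: "1 / (S u)^k \<le> 1 / (S t)^k" if "u < t" for u k
      using that t S_antimono[of u t] by (intro frac_le power_mono) auto
    have EH: "(\<integral>\<^sup>+z. \<integral>\<^sup>+u. ennreal ((H u z)\<^sup>2) * ennreal (at_risk n u z / S u) \<partial>\<mu> \<partial>sample n) \<le> ennreal (K1 / n)"
    proof -
      have "(\<integral>\<^sup>+z. \<integral>\<^sup>+u. ennreal ((H u z)\<^sup>2) * ennreal (at_risk n u z / S u) \<partial>\<mu> \<partial>sample n)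
         \<le> (\<integral>\<^sup>+z. \<integral>\<^sup>+u. ennreal (1 / (S t)^3 * indicator {..<t} u) * ennreal (1 / at_risk n u z) \<partial>\<mu> \<partial>sample n)"
      proof (intro nn_integral_mono)
        fix u z
        have "(H u z)\<^sup>2 * (at_risk n u z / S u) \<le> 1 / (S t)^3 * indicator {..<t} u * (1 / at_risk n u z)"
        proof (cases "u < t")
          case True
          have "(H u z)\<^sup>2 * (at_risk n u z / S u) = (surv n u z)\<^sup>2 * (1 / (S u)^3) * (1 / at_risk n u z)"
            using True by (simp add: H_def power2_eq_square power3_eq_cube)
          also have "\<dots> \<le> 1 * (1 / (S t)^3) * (1 / at_risk n u z)"
            by (intro mult_right_mono mult_mono le3 True) (auto simp: power_le_one)
          finally show ?thesis using True by simp
        qed (simp add: H_def)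
        then show "ennreal ((H u z)\<^sup>2) * ennreal (at_risk n u z / S u) \<le> ennreal (1 / (S t)^3 * indicator {..<t} u) * ennreal (1 / at_risk n u z)"
          by (simp only: ennreal_mult''[symmetric] divide_nonneg_nonneg at_risk_nonneg S_nonneg zero_le_one ennreal_leI)
      qed
      also have "\<dots> \<le> ennreal (1 / (S t)^3 * 6 * (\<alpha> / S t) * A0 / n)"
        unfolding A0_def
        by (rule early_time_average[OF t n _ _ _ inverse_at_risk_moment[OF n]]) (use t in \<open>simp, simp, measurable\<close>)
      also have "1 / (S t)^3 * 6 * (\<alpha> / S t) * A0 / n = K1 / n" by (simp only: K1_def)
      finally show ?thesis .
    qed
    have fin: "(\<integral>\<^sup>+z. \<integral>\<^sup>+u. ennreal ((H u z)\<^sup>2) * ennreal (at_risk n u z / S u) \<partial>\<mu> \<partial>sample n) < \<infinity>"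
      using EH by (rule order.strict_trans1) simp
    note iso = isometry_inequality(2)[OF Hm Hpred fin]
    have Ep: "(\<integral>\<^sup>+z. ennreal (1 / (S t)^4 * p z) \<partial>sample n) \<le> ennreal (K2 / n)"
    proof -
      have "(\<integral>\<^sup>+z. ennreal (1 / (S t)^4 * p z) \<partial>sample n) = (\<integral>\<^sup>+z. \<integral>\<^sup>+u. ennreal (1 / (S t)^4 * v u z) \<partial>\<mu> \<partial>sample n)"
      proof (rule nn_integral_cong)
        fix z assume z: "z \<in> space (sample n)"
        have "(\<lambda>u. v u z) \<in> borel_measurable borel"
          using measurable_compose[OF measurable_Pair1'[OF z] vm] by simp
        then have vi: "integrable \<mu> (\<lambda>u. v u z)"
          by (intro X.integrable_const_bound[where B=1]) (use v01 in auto)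
        show "ennreal (1 / (S t)^4 * p z) = (\<integral>\<^sup>+u. ennreal (1 / (S t)^4 * v u z) \<partial>\<mu>)"
          unfolding p_def by (subst nn_integral_eq_integral[OF integrable_mult_right[OF vi]]) (use v01 in auto)
      qed
      also have "\<dots> = (\<integral>\<^sup>+z. \<integral>\<^sup>+u. ennreal (1 / (S t)^4 * indicator {..<t} u) * ennreal (if at_risk n u z = 0 then 1 else 0) \<partial>\<mu> \<partial>sample n)"
        by (intro nn_integral_cong) (auto simp: v_def indicator_def)
      also have "\<dots> \<le> ennreal (1 / (S t)^4 * 1 * (\<alpha> / S t) * A0 / n)"
        unfolding A0_def
        by (rule early_time_average[OF t n _ _ _ at_risk_zero_prob[OF n]]) (use t in \<open>simp, simp, measurable\<close>)
      also have "1 / (S t)^4 * 1 * (\<alpha> / S t) * A0 / n = K2 / n" by (simp only: K2_def)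
      finally show ?thesis .
    qed
    have path: "AE z in sample n. (surv n t z / S t - 1)\<^sup>2 \<le> 2 * (comp_sum n H z)\<^sup>2 + 2 * (1 / (S t)^4 * p z)"
      using AE_sample_distinct AE_space
    proof eventually_elim
      case (elim z)
      have zs: "(\<lambda>u. z) \<in> borel \<rightarrow>\<^sub>M sample n" using elim by simp
      note [measurable] = surv_section_measurable[OF elim(2)] at_risk_section_measurable[OF elim(2)]
      define c where "c = 1 / (S t)\<^sup>2"
      define f where "f u = indicator {..<t} u * (surv n u z / (S u)\<^sup>2)" for u
      have fb: "0 \<le> f u" "f u \<le> c" for u
      proof -
        show "0 \<le> f u" by (simp add: f_def)
        show "f u \<le> c"
        proof (cases "u < t")
          case True
          have "surv n u z * (1 / (S u)\<^sup>2) \<le> 1 * (1 / (S t)\<^sup>2)" by (intro mult_mono le3 True) auto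
          then show ?thesis using True by (simp add: f_def c_def)
        qed (simp add: f_def c_def)
      qed
      have vb: "f u * v u z \<le> c * v u z" for u using fb v01 by (intro mult_right_mono) auto
      have fm[measurable]: "f \<in> borel_measurable borel" unfolding f_def[abs_def] by measurable
      have vzm[measurable]: "(\<lambda>u. v u z) \<in> borel_measurable borel" unfolding v_def by measurable
      have fi: "integrable \<mu> f" by (rule X.integrable_const_bound[where B=c]) (use fb in auto)
      have vi: "integrable \<mu> (\<lambda>u. v u z)" by (rule X.integrable_const_bound[where B=1]) (use v01 in auto)
      have fvi: "integrable \<mu> (\<lambda>u. f u * v u z)"
        by (rule Bochner_Integration.integrable_bound[OF fi]) (use fb v01 in \<open>auto simp: abs_mult intro!: AE_I2 mult_left_le\<close>)
      define D where "D = (LINT u|\<mu>. f u * v u z)"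
      have HN: "H u z * (at_risk n u z / S u) = f u - f u * v u z" for u
        by (auto simp: H_def f_def v_def indicator_def power2_eq_square)
      have "(LINT u|\<mu>. H u z * (at_risk n u z / S u)) = (LINT u|\<mu>. f u) - D"
        unfolding HN D_def by (rule Bochner_Integration.integral_diff[OF fi fvi])
      moreover have "(\<Sum>i<n. H (fst (z i)) z) = (\<Sum>i<n. if fst (z i) < t then surv n (fst (z i)) z / at_risk n (fst (z i)) z / S (fst (z i)) else 0)"
        by (rule sum.cong) (auto simp: H_def indicator_def mult.commute)
      ultimately have Q: "surv n t z / S t - 1 = D - comp_sum n H z"
        using Duhamel[OF elim(1) t] unfolding comp_sum_def f_def by simp
      have D0: "0 \<le> D" unfolding D_def by (intro integral_nonneg_AE AE_I2 mult_nonneg_nonneg fb v01)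
      have "D \<le> (LINT u|\<mu>. c * v u z)" unfolding D_def by (rule integral_mono[OF fvi integrable_mult_right[OF vi] vb])
      then have Dp: "D \<le> c * p z" by (simp add: p_def)
      have "p z \<le> (LINT u|\<mu>. 1)" unfolding p_def by (rule integral_mono[OF vi]) (use v01 in auto)
      then have p1: "p z \<le> 1" using X.prob_space by simp
      have p0: "0 \<le> p z" unfolding p_def by (intro integral_nonneg_AE AE_I2 v01)
      have "D\<^sup>2 \<le> (c * p z)\<^sup>2" by (rule power_mono[OF Dp D0])
      also have "\<dots> = c\<^sup>2 * (p z * p z)" by (simp add: power2_eq_square)
      also have "\<dots> \<le> c\<^sup>2 * (p z * 1)" using p0 p1 by (intro mult_left_mono) auto
      also have "\<dots> = 1 / (S t)^4 * p z" by (simp add: c_def power_divide)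
      finally have "D\<^sup>2 \<le> 1 / (S t)^4 * p z" .
      then show ?case unfolding Q using square_diff_le[of D "comp_sum n H z"] by linarith
    qed
    have p0: "0 \<le> p z" for z unfolding p_def by (intro integral_nonneg_AE AE_I2 v01)
    have cm[measurable]: "comp_sum n H \<in> borel_measurable (sample n)" by (rule comp_sum_measurable[OF Hm])
    have pm[measurable]: "p \<in> borel_measurable (sample n)"
    proof -
      have "(\<lambda>z. LINT u|\<mu>. v u z) \<in> borel_measurable (sample n)"
        by (rule X.borel_measurable_lebesgue_integral)
           (use vm in \<open>simp add: split_beta' measurable_cong_sets[OF sets_sample_mu refl]\<close>)
      then show ?thesis unfolding p_def[abs_def] .
    qed
    have "(\<integral>\<^sup>+z. ennreal ((surv n t z / S t - 1)\<^sup>2) \<partial>sample n)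
       \<le> (\<integral>\<^sup>+z. 2 * ennreal ((comp_sum n H z)\<^sup>2) + 2 * ennreal (1 / (S t)^4 * p z) \<partial>sample n)"
    proof (rule nn_integral_mono_AE, use path in eventually_elim)
      case (elim z)
      have "ennreal ((surv n t z / S t - 1)\<^sup>2) \<le> ennreal (2 * (comp_sum n H z)\<^sup>2 + 2 * (1 / (S t)^4 * p z))"
        by (rule ennreal_leI[OF elim])
      also have "\<dots> = 2 * ennreal ((comp_sum n H z)\<^sup>2) + 2 * ennreal (1 / (S t)^4 * p z)"
        using p0[of z] by (subst ennreal_plus) (auto simp: ennreal_mult' simp del: times_divide_eq_left)
      finally show ?case .
    qed
    also have "\<dots> = 2 * (\<integral>\<^sup>+z. ennreal ((comp_sum n H z)\<^sup>2) \<partial>sample n) + 2 * (\<integral>\<^sup>+z. ennreal (1 / (S t)^4 * p z) \<partial>sample n)"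
      by (subst nn_integral_add) (measurable, auto simp: nn_integral_cmult)
    also have "\<dots> \<le> 2 * ennreal (K1 / n) + 2 * ennreal (K2 / n)"
      by (intro add_mono mult_left_mono order_trans[OF iso EH] Ep) auto
    also have "\<dots> = ennreal (K / n)"
    proof -
      have "2 * ennreal (K1 / n) + 2 * ennreal (K2 / n) = ennreal (2 * (K1 / n)) + ennreal (2 * (K2 / n))"
        by (simp only: ennreal_mult' zero_le_numeral ennreal_numeral)
      also have "\<dots> = ennreal (2 * (K1 / n) + 2 * (K2 / n))" using K0 by (intro ennreal_plus[symmetric]) auto
      also have "2 * (K1 / n) + 2 * (K2 / n) = K / n" by (simp add: K_def add_divide_distrib)
      finally show ?thesis .
    qed
    finally show "(\<integral>\<^sup>+z. ennreal ((surv n t z / S t - 1)\<^sup>2) \<partial>sample n) \<le> ennreal (K / n)" .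
  qed
qed

lemma nn_integral_at_risk: "(\<integral>\<^sup>+z. ennreal (at_risk n s z) \<partial>sample n) = ennreal (n * C s)"
proof -
  have b: "integrable (sample n) (\<lambda>z. risk_ind s (z i))" if "i < n" for i
    by (rule sample.integrable_const_bound[where B=1, OF _ risk_ind_component_measurable[OF that]])
       (auto simp: risk_ind_def)
  have "(\<integral>\<^sup>+z. ennreal (at_risk n s z) \<partial>sample n) = ennreal (LINT z|sample n. at_risk n s z)"
  proof (rule nn_integral_eq_integral)
    show "integrable (sample n) (\<lambda>z. at_risk n s z)"
      unfolding at_risk_sum by (intro Bochner_Integration.integrable_sum b) simp
  qed simp
  also have "(LINT z|sample n. at_risk n s z) = (\<Sum>i<n. LINT z|sample n. risk_ind s (z i))"
    unfolding at_risk_sum by (rule Bochner_Integration.integral_sum) (auto intro: b)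
  also have "\<dots> = (\<Sum>i<n. C s)"
    by (rule sum.cong) (use integral_risk_ind_component[of _ n "\<lambda>u. u" s] integral_risk_ind in auto)
  finally show ?thesis by simp
qed

end

section \<open>The remainder\<close>

text \<open>
If \<open>x > c / 2\<close>, then \<open>q / x - 1 / c\<close> is controlled by the deviations of \<open>q\<close> from \<open>1\<close> and of \<open>x\<close> from \<open>c\<close>; it is used
with \<open>q = Q\<close>, \<open>x = C\<^sub>n\<close> and \<open>c = C\<close>.
\<close>

lemma weight_square_bound:
  fixes x c q :: real
  assumes "c / 2 < x" "0 < c" "a = 1"
  shows "(a * (q / x) - 1 / c)\<^sup>2 * x \<le> 4 / c * (q - 1)\<^sup>2 + 4 / c ^ 3 * (x - c)\<^sup>2"
proof -
  have x0: "0 < x" using assms by linarith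
  have x: "1 / x \<le> 2 / c" using assms x0 by (simp add: field_simps)
  have "q / x - 1 / c = (q - 1) / x - (x - c) / (c * x)"
    using x0 assms by (simp add: field_simps)
  then have "(q / x - 1 / c)\<^sup>2 \<le> 2 * ((q - 1) / x)\<^sup>2 + 2 * ((x - c) / (c * x))\<^sup>2"
    using square_diff_le by simp
  then have "(q / x - 1 / c)\<^sup>2 * x \<le> (2 * ((q - 1) / x)\<^sup>2 + 2 * ((x - c) / (c * x))\<^sup>2) * x"
    by (rule mult_right_mono) (use x0 in simp)
  also have "\<dots> = 2 * (q - 1)\<^sup>2 * (1 / x) + 2 * (x - c)\<^sup>2 / c\<^sup>2 * (1 / x)"
    using x0 assms by (simp add: field_simps power2_eq_square)
  also have "\<dots> \<le> 2 * (q - 1)\<^sup>2 * (2 / c) + 2 * (x - c)\<^sup>2 / c\<^sup>2 * (2 / c)"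
    by (intro add_mono mult_left_mono x) auto
  also have "\<dots> = 4 / c * (q - 1)\<^sup>2 + 4 / c ^ 3 * (x - c)\<^sup>2"
    by (simp add: power2_eq_square power3_eq_cube)
  finally show ?thesis using assms by simp
qed

context truncation_model
begin

text \<open>
The remainder of the expansion for a sample with distinct \<open>X\<^sub>i\<close>, with the integrals against \<open>F\<^sup>*\<close> written against
\<open>F\<close> by means of \<open>dF\<^sup>* = C / S dF\<close>.
\<close>

definition remainder :: "(real \<Rightarrow> real) \<Rightarrow> nat \<Rightarrow> (nat \<Rightarrow> real \<times> real) \<Rightarrow> real" where
  "remainder \<phi> n z =
     ((\<Sum>i<n. \<phi> (fst (z i)) * (surv n (fst (z i)) z / at_risk n (fst (z i)) z)) - (LINT x|\<mu>. \<phi> x))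
     - ((1 / n * (\<Sum>i<n. psi \<phi> (fst (z i)) / C (fst (z i))) - (LINT s|\<mu>. psi \<phi> s / S s))
        - (LINT s|\<mu>. (at_risk n s z / n - C s) * psi \<phi> s / (C s * S s)))"

text \<open>
The factor \<open>n Q / N - 1 / C\<close>. Beyond \<open>m\<close> its first term is switched off if nobody is at risk at \<open>m\<close>. This event is
known at times after \<open>m\<close>, so predictability survives, and its probability is negligible.
\<close>

definition weight :: "real \<Rightarrow> nat \<Rightarrow> real \<Rightarrow> (nat \<Rightarrow> real \<times> real) \<Rightarrow> real" where
  "weight m n s z = (if m < s \<and> at_risk n m z = 0 then 0 else 1) * (n * surv n s z / (S s * at_risk n s z)) - 1 / C s"

lemma weight_measurable:
  "(\<lambda>p. weight m n (fst p) (snd p)) \<in> borel_measurable (borel \<Otimes>\<^sub>M sample n)"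
  unfolding weight_def by measurable

lemma predictable_weight: "predictable n (weight m n)"
  unfolding predictable_def
proof (intro allI impI)
  fix i u and z :: "nat \<Rightarrow> real \<times> real"
  assume i: "i < n" "u \<le> fst (z i)"
  let ?z = "z(i := (u, snd (z i)))"
  have "at_risk n u ?z = at_risk n u z" "surv n u ?z = surv n u z"
    using predictable_at_risk predictable_surv i unfolding predictable_def by blast+
  moreover have "at_risk n m ?z = at_risk n m z" if "m < u"
    using predictableD[where z=z and t=u and s=m, OF predictable_at_risk i(1) _ i(2)] that by simp
  ultimately show "weight m n u ?z = weight m n u z" by (auto simp: weight_def)
qed

text \<open>
Integrated against \<open>\<psi>\<^sup>2 d\<Lambda>\<close>, this bounds the second moment of \<open>sqrt n\<close> times the martingale part of the
remainder.
\<close>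

definition weight_energy :: "real \<Rightarrow> nat \<Rightarrow> real \<Rightarrow> ennreal" where
  "weight_energy m n s = (\<integral>\<^sup>+z. ennreal ((weight m n s z)\<^sup>2 * (at_risk n s z / n)) \<partial>sample n)"

lemma weight_section_measurable [measurable]: "(\<lambda>z. weight m n s z) \<in> borel_measurable (sample n)"
  unfolding weight_def by measurable

text \<open>
The part \<open>1 / C\<close> of the weight contributes \<open>2 / C\<close>. The other part is \<open>2 n E[w\<^sup>2 / N] / S\<^sup>2\<close>: to the left of the median
\<open>m\<close> it is at most \<open>8 n E[1 / N]\<close>, to the right of it \<open>risk_ratio_moment\<close> supplies the factor \<open>S\<close> that turns
\<open>1 / S\<^sup>2\<close> into \<open>1 / S\<close>, which is at most \<open>1 / (\<alpha> C)\<close>.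
\<close>

lemma weight_energy_bound:
  assumes m: "S m = 1 / 2" "0 < C m" and n: "0 < n" and s: "0 < S s" "0 < C s"
  shows "weight_energy m n s \<le> ennreal ((50 + 24 / (\<alpha> * C m)) / C s)"
proof -
  define a where "a z = (if m < s \<and> at_risk n m z = 0 then 0 else 1 :: real)" for z
  have [measurable]: "a \<in> borel_measurable (sample n)" unfolding a_def[abs_def] by measurable
  have a01: "0 \<le> a z" "(a z)\<^sup>2 = a z" for z by (auto simp: a_def)
  define c where "c = 2 * n / (S s)\<^sup>2"
  have c0: "0 \<le> c" by (simp add: c_def)
  have pt: "(weight m n s z)\<^sup>2 * (at_risk n s z / n) \<le> c * (a z * risk_ratio n s z) + 2 / (n * (C s)\<^sup>2) * at_risk n s z" for z
  proof (cases "at_risk n s z = 0")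
    case False
    have "(weight m n s z)\<^sup>2 \<le> 2 * (a z * (n * surv n s z / (S s * at_risk n s z)))\<^sup>2 + 2 * (1 / C s)\<^sup>2"
      unfolding weight_def a_def by (rule square_diff_le)
    then have "(weight m n s z)\<^sup>2 * (at_risk n s z / n) \<le> (2 * (a z * (n * surv n s z / (S s * at_risk n s z)))\<^sup>2 + 2 * (1 / C s)\<^sup>2) * (at_risk n s z / n)"
      by (rule mult_right_mono) simp
    also have "\<dots> = c * (a z * risk_ratio n s z) + 2 / (n * (C s)\<^sup>2) * at_risk n s z"
      using False n s a01(2)[of z] unfolding c_def risk_ratio_def
      by (simp add: power_mult_distrib power_divide distrib_right) (simp add: field_simps power2_eq_square)
    finally show ?thesis .
  qed (use a01 c0 in simp)
  have "weight_energy m n s \<le> (\<integral>\<^sup>+z. ennreal c * ennreal (a z * risk_ratio n s z) + ennreal (2 / (n * (C s)\<^sup>2)) * ennreal (at_risk n s z) \<partial>sample n)"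
    unfolding weight_energy_def
  proof (rule nn_integral_mono)
    fix z
    have "ennreal ((weight m n s z)\<^sup>2 * (at_risk n s z / n)) \<le> ennreal (c * (a z * risk_ratio n s z) + 2 / (n * (C s)\<^sup>2) * at_risk n s z)"
      by (rule ennreal_leI[OF pt])
    also have "\<dots> = ennreal c * ennreal (a z * risk_ratio n s z) + ennreal (2 / (n * (C s)\<^sup>2)) * ennreal (at_risk n s z)"
      using c0 a01[of z] by (subst ennreal_plus) (auto simp: ennreal_mult simp del: times_divide_eq_left)
    finally show "ennreal ((weight m n s z)\<^sup>2 * (at_risk n s z / n)) \<le> \<dots>" .
  qed
  also have "\<dots> = ennreal c * (\<integral>\<^sup>+z. ennreal (a z * risk_ratio n s z) \<partial>sample n) + ennreal (2 / (n * (C s)\<^sup>2)) * (\<integral>\<^sup>+z. ennreal (at_risk n s z) \<partial>sample n)"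
    by (subst nn_integral_add) (measurable, simp add: nn_integral_cmult)
  also have "\<dots> \<le> ennreal ((48 + 24 / (\<alpha> * C m)) / C s) + ennreal (2 / C s)"
  proof (rule add_mono)
    show "ennreal (2 / (n * (C s)\<^sup>2)) * (\<integral>\<^sup>+z. ennreal (at_risk n s z) \<partial>sample n) \<le> ennreal (2 / C s)"
      using n s unfolding nn_integral_at_risk by (simp add: power2_eq_square flip: ennreal_mult)
    show "ennreal c * (\<integral>\<^sup>+z. ennreal (a z * risk_ratio n s z) \<partial>sample n) \<le> ennreal ((48 + 24 / (\<alpha> * C m)) / C s)"
    proof (cases "s \<le> m")
      case True
      then have S2: "1 / 2 \<le> S s" using S_antimono m(1) by metis
      have "(\<integral>\<^sup>+z. ennreal (a z * risk_ratio n s z) \<partial>sample n) \<le> (\<integral>\<^sup>+z. ennreal (1 / at_risk n s z) \<partial>sample n)"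
      proof (intro nn_integral_mono ennreal_leI)
        fix z
        have "(surv n s z)\<^sup>2 \<le> 1" by (simp add: power_le_one)
        then have "risk_ratio n s z \<le> 1 / at_risk n s z" unfolding risk_ratio_def by (rule divide_right_mono) simp
        then show "a z * risk_ratio n s z \<le> 1 / at_risk n s z" by (simp add: a_def)
      qed
      also have "\<dots> \<le> ennreal (6 / (n * C s))" by (rule inverse_at_risk_moment[OF n s(2)])
      finally have "ennreal c * (\<integral>\<^sup>+z. ennreal (a z * risk_ratio n s z) \<partial>sample n) \<le> ennreal c * ennreal (6 / (n * C s))"
        by (rule mult_left_mono) simp
      also have "\<dots> = ennreal (c * (6 / (n * C s)))" by (rule ennreal_mult'[OF c0, symmetric])
      also have "c * (6 / (n * C s)) \<le> (48 + 24 / (\<alpha> * C m)) / C s"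
      proof -
        have "(1 / 2)\<^sup>2 \<le> (S s)\<^sup>2" using S2 by (intro power_mono) auto
        then have "12 / (S s)\<^sup>2 \<le> 12 / (1 / 2)\<^sup>2" by (intro divide_left_mono) auto
        then have "12 / (S s)\<^sup>2 \<le> 48" by (simp add: power2_eq_square)
        also have "48 \<le> 48 + 24 / (\<alpha> * C m)" using alpha_pos m by simp
        finally have "12 / (S s)\<^sup>2 / C s \<le> (48 + 24 / (\<alpha> * C m)) / C s" by (rule divide_right_mono) simp
        moreover have "c * (6 / (n * C s)) = 12 / (S s)\<^sup>2 / C s" using n by (simp add: c_def)
        ultimately show ?thesis by simp
      qed
      finally show ?thesis by (simp add: ennreal_leI)
    next
      case False
      have "(\<integral>\<^sup>+z. ennreal (a z * risk_ratio n s z) \<partial>sample n) = (\<integral>\<^sup>+z. ennreal ((if at_risk n m z = 0 then 0 else 1) * risk_ratio n s z) \<partial>sample n)"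
        using False by (intro nn_integral_cong) (simp add: a_def)
      also have "\<dots> \<le> ennreal (6 * S s / (n * C m * S m))"
        by (rule risk_ratio_moment[OF n m(2) _ s(1)]) (use False in simp)
      finally have "ennreal c * (\<integral>\<^sup>+z. ennreal (a z * risk_ratio n s z) \<partial>sample n) \<le> ennreal c * ennreal (6 * S s / (n * C m * S m))"
        by (rule mult_left_mono) simp
      also have "\<dots> = ennreal (c * (6 * S s / (n * C m * S m)))" by (rule ennreal_mult'[OF c0, symmetric])
      also have "c * (6 * S s / (n * C m * S m)) \<le> (48 + 24 / (\<alpha> * C m)) / C s"
      proof -
        have "c * (6 * S s / (n * C m * S m)) = 24 / C m * (1 / S s)"
          using n s unfolding m(1) by (simp add: c_def power2_eq_square)
        also have "1 / S s \<le> 1 / (\<alpha> * C s)"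
        proof -
          have "\<alpha> * C s \<le> S s" using alpha_pos G_le_1[of s] s(1) by (simp add: C_def mult_right_le_one_le mult_left_le_one_le)
          then show ?thesis using alpha_pos s by (intro divide_left_mono) auto
        qed
        then have "24 / C m * (1 / S s) \<le> 24 / C m * (1 / (\<alpha> * C s))" by (rule mult_left_mono) (use m in simp)
        also have "\<dots> = 24 / (\<alpha> * C m) / C s" by simp
        also have "\<dots> \<le> (48 + 24 / (\<alpha> * C m)) / C s" by (intro divide_right_mono) auto
        finally show ?thesis .
      qed
      finally show ?thesis by (simp add: ennreal_leI)
    qed
  qed
  also have "\<dots> = ennreal ((48 + 24 / (\<alpha> * C m)) / C s + 2 / C s)"
    using alpha_pos m by (intro ennreal_plus[symmetric]) auto
  also have "(48 + 24 / (\<alpha> * C m)) / C s + 2 / C s = (50 + 24 / (\<alpha> * C m)) / C s"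
    by (simp add: add_divide_distrib[symmetric])
  finally show ?thesis .
qed

text \<open>
On \<open>N > n C / 2\<close> consistency of \<open>Q\<close> and the variance of \<open>N\<close> give the order \<open>1 / n\<close>, as does the probability
that the first term of the weight is switched off. On \<open>N \<le> n C / 2\<close> the integrand is
at most of order \<open>n\<close>, since \<open>1 / N \<le> 1\<close>, while the probability is exponentially small.
\<close>

lemma weight_energy_tendsto_0:
  assumes m: "0 < C m" and s: "0 < S s" "0 < C s"
  shows "(\<lambda>n. weight_energy m n s) \<longlonglongrightarrow> 0"
proof -
  obtain K where K: "0 \<le> K" "\<And>n. 0 < n \<Longrightarrow> (\<integral>\<^sup>+z. ennreal ((surv n s z / S s - 1)\<^sup>2) \<partial>sample n) \<le> ennreal (K / n)"
    using surv_consistency[OF s(1)] by blast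
  define c where "c = 2 / (S s)\<^sup>2 + 2 / (C s)\<^sup>2"
  have c0: "0 \<le> c" by (simp add: c_def)
  define R where "R n = 4 / C s * (K / n) + 4 / (C s)^3 * (C s / n) + 1 / (C s)\<^sup>2 * (1 / (n * C m)) + n * c * exp (- (C s)\<^sup>2 / 2 * n)" for n :: nat
  have bound: "weight_energy m n s \<le> ennreal (R n)" if n: "0 < n" for n
  proof -
    define B where "B z = (if at_risk n m z = 0 then 1 else 0 :: real)" for z
    define L where "L z = (if at_risk n s z \<le> n * C s / 2 then 1 else 0 :: real)" for z
    have [measurable]: "B \<in> borel_measurable (sample n)" "L \<in> borel_measurable (sample n)"
      unfolding B_def[abs_def] L_def[abs_def] by measurable
    have pt: "(weight m n s z)\<^sup>2 * (at_risk n s z / n)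
       \<le> 4 / C s * (surv n s z / S s - 1)\<^sup>2 + 4 / (C s)^3 * (1 / n\<^sup>2 * (at_risk n s z - n * C s)\<^sup>2) + 1 / (C s)\<^sup>2 * B z + n * c * L z" for z
    proof -
      define x where "x = at_risk n s z / n"
      define Q where "Q = surv n s z / S s"
      have x: "0 \<le> x" "x \<le> 1" using at_risk_le[of n s z] n by (auto simp: x_def)
      have w: "weight m n s z = (if m < s \<and> at_risk n m z = 0 then 0 else 1) * (Q / x) - 1 / C s"
        using n by (simp add: weight_def x_def Q_def mult.commute)
      have dev: "1 / n\<^sup>2 * (at_risk n s z - n * C s)\<^sup>2 = (x - C s)\<^sup>2"
        using n by (simp add: x_def field_simps power2_eq_square)
      have nn: "0 \<le> 4 / C s * (Q - 1)\<^sup>2" "0 \<le> 4 / (C s)^3 * (x - C s)\<^sup>2" "0 \<le> 1 / (C s)\<^sup>2 * B z" "0 \<le> n * c * L z"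
        using s c0 by (auto simp: B_def L_def)
      have "(weight m n s z)\<^sup>2 * x \<le> 4 / C s * (Q - 1)\<^sup>2 + 4 / (C s)^3 * (x - C s)\<^sup>2 + 1 / (C s)\<^sup>2 * B z + n * c * L z"
      proof (cases "at_risk n s z \<le> n * C s / 2")
        case True
        then have L1: "L z = 1" by (simp add: L_def)
        have "(weight m n s z)\<^sup>2 * x \<le> n * c"
        proof (cases "at_risk n s z = 0")
          case True
          then show ?thesis using c0 by (simp add: x_def)
        next
          case False
          then have N1: "1 \<le> at_risk n s z" using at_risk_cases[of n s z] by auto
          then have x0: "0 < x" "1 / n \<le> x" using n by (auto simp: x_def divide_right_mono)
          have "(weight m n s z)\<^sup>2 \<le> 2 * ((if m < s \<and> at_risk n m z = 0 then 0 else 1) * (Q / x))\<^sup>2 + 2 * (1 / C s)\<^sup>2"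
            unfolding w by (rule square_diff_le)
          also have "\<dots> \<le> 2 * (Q / x)\<^sup>2 + 2 * (1 / C s)\<^sup>2" by simp
          finally have "(weight m n s z)\<^sup>2 * x \<le> (2 * (Q / x)\<^sup>2 + 2 * (1 / C s)\<^sup>2) * x"
            by (rule mult_right_mono[OF _ x(1)])
          also have "\<dots> = 2 * Q\<^sup>2 * (1 / x) + 2 * (1 / C s)\<^sup>2 * x"
            using x0 by (simp add: field_simps power2_eq_square)
          also have "\<dots> \<le> 2 * (1 / (S s)\<^sup>2) * n + 2 * (1 / C s)\<^sup>2 * n"
          proof (intro add_mono mult_mono)
            have "(surv n s z)\<^sup>2 \<le> 1" by (simp add: power_le_one)
            then show "Q\<^sup>2 \<le> 1 / (S s)\<^sup>2" unfolding Q_def power_divide by (rule divide_right_mono) simp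
            show "1 / x \<le> n" using x0 n by (simp add: field_simps)
            show "x \<le> n" using x n by linarith
          qed (use x0 in auto)
          also have "\<dots> = n * c" by (simp add: c_def power_divide algebra_simps)
          finally show ?thesis .
        qed
        moreover have "n * c * L z = n * c" by (simp add: L1)
        ultimately show ?thesis using nn by linarith
      next
        case False
        then have xC: "C s / 2 < x" using n by (simp add: x_def field_simps)
        show ?thesis
        proof (cases "at_risk n m z = 0")
          case A: True
          then have B1: "B z = 1" by (simp add: B_def)
          show ?thesis
          proof (cases "m < s")
            case True
            have "(weight m n s z)\<^sup>2 * x = 1 / (C s)\<^sup>2 * x" using A True by (simp add: w power_divide)
            also have "\<dots> \<le> 1 / (C s)\<^sup>2 * 1" using x by (intro mult_left_mono) auto
            finally have "(weight m n s z)\<^sup>2 * x \<le> 1 / (C s)\<^sup>2 * B z" by (simp add: B1)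
            then show ?thesis using nn by linarith
          next
            case False2: False
            have "(weight m n s z)\<^sup>2 * x \<le> 4 / C s * (Q - 1)\<^sup>2 + 4 / (C s)^3 * (x - C s)\<^sup>2"
              using xC s(2) False2 unfolding w by (intro weight_square_bound) auto
            then show ?thesis using nn by linarith
          qed
        next
          case A: False
          have "(weight m n s z)\<^sup>2 * x \<le> 4 / C s * (Q - 1)\<^sup>2 + 4 / (C s)^3 * (x - C s)\<^sup>2"
            using xC s(2) A unfolding w by (intro weight_square_bound) auto
          then show ?thesis using nn by linarith
        qed
      qed
      then show ?thesis unfolding dev unfolding x_def Q_def .
    qed
    have p1: "0 \<le> 4 / C s * (surv n s z / S s - 1)\<^sup>2" "0 \<le> 4 / (C s)^3 * (1 / n\<^sup>2 * (at_risk n s z - n * C s)\<^sup>2)" "0 \<le> 1 / (C s)\<^sup>2 * B z" "0 \<le> n * c * L z" for z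
      using s c0 by (auto simp: B_def L_def)
    have "weight_energy m n s \<le> (\<integral>\<^sup>+z. ennreal (4 / C s * (surv n s z / S s - 1)\<^sup>2) + ennreal (4 / (C s)^3 * (1 / n\<^sup>2 * (at_risk n s z - n * C s)\<^sup>2)) + ennreal (1 / (C s)\<^sup>2 * B z) + ennreal (n * c * L z) \<partial>sample n)"
      unfolding weight_energy_def
      by (intro nn_integral_mono order_trans[OF ennreal_leI[OF pt]])
         (simp only: ennreal_plus p1 add_nonneg_nonneg order_refl)
    also have "\<dots> = (\<integral>\<^sup>+z. ennreal (4 / C s * (surv n s z / S s - 1)\<^sup>2) \<partial>sample n) + (\<integral>\<^sup>+z. ennreal (4 / (C s)^3 * (1 / n\<^sup>2 * (at_risk n s z - n * C s)\<^sup>2)) \<partial>sample n) + (\<integral>\<^sup>+z. ennreal (1 / (C s)\<^sup>2 * B z) \<partial>sample n) + (\<integral>\<^sup>+z. ennreal (n * c * L z) \<partial>sample n)"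
      by (simp add: nn_integral_add)
    also have "\<dots> \<le> ennreal (4 / C s * (K / n)) + ennreal (4 / (C s)^3 * (C s / n)) + ennreal (1 / (C s)\<^sup>2 * (1 / (n * C m))) + ennreal (n * c * exp (- (C s)\<^sup>2 / 2 * n))"
    proof (intro add_mono)
      have "(\<integral>\<^sup>+z. ennreal (4 / C s * (surv n s z / S s - 1)\<^sup>2) \<partial>sample n) = ennreal (4 / C s) * (\<integral>\<^sup>+z. ennreal ((surv n s z / S s - 1)\<^sup>2) \<partial>sample n)"
        by (subst nn_integral_cmult[symmetric]) (measurable, simp only: ennreal_mult'' zero_le_power2)
      also have "\<dots> \<le> ennreal (4 / C s) * ennreal (K / n)" by (intro mult_left_mono K n) simp
      also have "\<dots> = ennreal (4 / C s * (K / n))" using K s by (intro ennreal_mult''[symmetric]) auto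
      finally show "(\<integral>\<^sup>+z. ennreal (4 / C s * (surv n s z / S s - 1)\<^sup>2) \<partial>sample n) \<le> ennreal (4 / C s * (K / n))" .
      have "(\<integral>\<^sup>+z. ennreal (4 / (C s)^3 * (1 / n\<^sup>2 * (at_risk n s z - n * C s)\<^sup>2)) \<partial>sample n) = ennreal (LINT z|sample n. 4 / (C s)^3 * (1 / n\<^sup>2 * (at_risk n s z - n * C s)\<^sup>2))"
        by (rule nn_integral_eq_integral) (use at_risk_variance_integrable p1 in \<open>auto intro!: AE_I2\<close>)
      also have "(LINT z|sample n. 4 / (C s)^3 * (1 / n\<^sup>2 * (at_risk n s z - n * C s)\<^sup>2)) = 4 / (C s)^3 * (1 / n\<^sup>2 * (LINT z|sample n. (at_risk n s z - n * C s)\<^sup>2))"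
        by (simp only: integral_mult_right_zero)
      also have "\<dots> \<le> 4 / (C s)^3 * (1 / n\<^sup>2 * (n * C s))"
        by (intro mult_left_mono at_risk_variance) auto
      also have "1 / n\<^sup>2 * (n * C s) = C s / n" using n by (simp add: power2_eq_square)
      finally show "(\<integral>\<^sup>+z. ennreal (4 / (C s)^3 * (1 / n\<^sup>2 * (at_risk n s z - n * C s)\<^sup>2)) \<partial>sample n) \<le> ennreal (4 / (C s)^3 * (C s / n))"
        by (simp add: ennreal_leI)
      have "(\<integral>\<^sup>+z. ennreal (1 / (C s)\<^sup>2 * B z) \<partial>sample n) = ennreal (1 / (C s)\<^sup>2) * (\<integral>\<^sup>+z. ennreal (B z) \<partial>sample n)"
        by (subst nn_integral_cmult[symmetric]) (measurable, simp add: ennreal_mult' del: times_divide_eq_left)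
      also have "\<dots> \<le> ennreal (1 / (C s)\<^sup>2) * ennreal (1 / (n * C m))"
        unfolding B_def by (intro mult_left_mono at_risk_zero_prob n m) simp
      also have "\<dots> = ennreal (1 / (C s)\<^sup>2 * (1 / (n * C m)))" using m by (intro ennreal_mult''[symmetric]) auto
      finally show "(\<integral>\<^sup>+z. ennreal (1 / (C s)\<^sup>2 * B z) \<partial>sample n) \<le> ennreal (1 / (C s)\<^sup>2 * (1 / (n * C m)))" .
      have "(\<integral>\<^sup>+z. ennreal (n * c * L z) \<partial>sample n) = (\<integral>\<^sup>+z. ennreal (n * c) * indicator {z \<in> space (sample n). at_risk n s z \<le> n * C s / 2} z \<partial>sample n)"
        by (intro nn_integral_cong) (auto simp: L_def indicator_def)
      also have "\<dots> = ennreal (n * c) * emeasure (sample n) {z \<in> space (sample n). at_risk n s z \<le> n * C s / 2}"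
        by (rule nn_integral_cmult_indicator) measurable
      also have "\<dots> \<le> ennreal (n * c) * ennreal (exp (- (C s)\<^sup>2 / 2 * n))"
        unfolding sample.emeasure_eq_measure by (intro mult_left_mono ennreal_leI at_risk_lower_tail n) simp
      also have "\<dots> = ennreal (n * c * exp (- (C s)\<^sup>2 / 2 * n))" by (intro ennreal_mult''[symmetric]) auto
      finally show "(\<integral>\<^sup>+z. ennreal (n * c * L z) \<partial>sample n) \<le> ennreal (n * c * exp (- (C s)\<^sup>2 / 2 * n))" .
    qed
    also have "\<dots> = ennreal (R n)"
      using K(1) s m c0 unfolding R_def by (subst ennreal_plus[symmetric], auto)+
    finally show ?thesis .
  qed
  have "R \<longlonglongrightarrow> 0"
  proof -
    define e where "e = (C s)\<^sup>2 / 2"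
    have "0 < e" using s by (simp add: e_def)
    have i: "(\<lambda>n. 1 / real n) \<longlonglongrightarrow> 0" by (rule lim_1_over_n)
    have ex: "(\<lambda>n. real n * exp (- e * real n)) \<longlonglongrightarrow> 0"
      using \<open>0 < e\<close> by real_asymp
    have "(\<lambda>n. 4 * K / C s * (1 / real n) + 4 / (C s)^3 * C s * (1 / real n) + 1 / (C s)\<^sup>2 / C m * (1 / real n) + c * (real n * exp (- e * real n)))
       \<longlonglongrightarrow> 4 * K / C s * 0 + 4 / (C s)^3 * C s * 0 + 1 / (C s)\<^sup>2 / C m * 0 + c * 0"
      by (intro tendsto_add tendsto_mult tendsto_const i ex)
    also have "(\<lambda>n. 4 * K / C s * (1 / real n) + 4 / (C s)^3 * C s * (1 / real n) + 1 / (C s)\<^sup>2 / C m * (1 / real n) + c * (real n * exp (- e * real n))) = R"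
      by (simp add: R_def e_def fun_eq_iff mult_ac)
    finally show ?thesis by simp
  qed
  then have "(\<lambda>n. ennreal (R n)) \<longlonglongrightarrow> ennreal 0" by (rule tendsto_ennrealI)
  then have lim: "(\<lambda>n. ennreal (R n)) \<longlonglongrightarrow> 0" by simp
  show ?thesis
    by (rule tendsto_sandwich[OF _ _ tendsto_const lim])
       (auto intro!: eventually_sequentiallyI[of 1] bound)
qed

lemma martingale_part_tendsto_0:
  assumes phi[measurable]: "\<phi> \<in> borel_measurable borel" and i: "integrable \<mu> (\<lambda>x. (\<phi> x)\<^sup>2 / G x)"
    and m: "S m = 1 / 2" "0 < C m"
  defines "H \<equiv> \<lambda>n s z. psi \<phi> s * weight m n s z"
  shows "\<And>n. 0 < n \<Longrightarrow> AE z in sample n. integrable \<mu> (\<lambda>s. H n s z * (at_risk n s z / S s))"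
    and "\<And>n. comp_sum n (H n) \<in> borel_measurable (sample n)"
    and "(\<lambda>n. \<integral>\<^sup>+z. ennreal ((comp_sum n (H n) z)\<^sup>2 / n) \<partial>sample n) \<longlonglongrightarrow> 0"
proof -
  have Hm: "case_prod (H n) \<in> borel_measurable (borel \<Otimes>\<^sub>M sample n)" for n
    using weight_measurable[of m n] unfolding H_def split_beta' by measurable
  have Hpred: "predictable n (H n)" for n
    using predictable_weight[of n m] by (simp add: predictable_def H_def)
  define e where "e n s = ennreal ((psi \<phi> s)\<^sup>2 / S s) * weight_energy m n s" for n s
  define k where "k = 50 + 24 / (\<alpha> * C m)"
  have k0: "0 \<le> k" using alpha_pos m by (simp add: k_def)
  define w where "w s = (psi \<phi> s)\<^sup>2 / S s * (k / C s)" for s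
  have w: "w s = k * \<alpha> * ((psi \<phi> s)\<^sup>2 / (G s * (S s)\<^sup>2))" for s
    by (simp add: w_def C_def power2_eq_square mult_ac)
  have wint: "integrable \<mu> w"
    unfolding w by (intro integrable_mult_right psi_square_integrable phi i)
  have w_meas[measurable]: "w \<in> borel_measurable borel" unfolding w_def[abs_def] by measurable
  have wfin: "(\<integral>\<^sup>+s. ennreal (w s) \<partial>\<mu>) < \<infinity>"
    by (subst nn_integral_eq_integral[OF wint]) (use k0 in \<open>auto simp: w_def\<close>)
  have em[measurable]: "e n \<in> borel_measurable \<mu>" for n
  proof -
    have [measurable]: "(\<lambda>p. weight m n (fst p) (snd p)) \<in> borel_measurable (borel \<Otimes>\<^sub>M sample n)"
      by (rule weight_measurable)
    have "weight_energy m n \<in> borel_measurable borel"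
      unfolding weight_energy_def[abs_def]
      by (rule sample.borel_measurable_nn_integral) (unfold split_beta', measurable)
    then show ?thesis unfolding e_def[abs_def] by measurable
  qed
  have ebound: "AE s in \<mu>. e n s \<le> ennreal (w s)" if "0 < n" for n
    using AE_S_pos AE_C_pos
  proof eventually_elim
    case (elim s)
    have "e n s \<le> ennreal ((psi \<phi> s)\<^sup>2 / S s) * ennreal (k / C s)"
      unfolding e_def k_def by (intro mult_left_mono weight_energy_bound m that elim) auto
    also have "\<dots> = ennreal (w s)" using k0 unfolding w_def by (intro ennreal_mult[symmetric]) auto
    finally show ?case .
  qed
  have energy: "(\<integral>\<^sup>+z. \<integral>\<^sup>+s. ennreal ((H n s z)\<^sup>2) * ennreal (at_risk n s z / S s) \<partial>\<mu> \<partial>sample n) = ennreal n * (\<integral>\<^sup>+s. e n s \<partial>\<mu>)"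
    if n: "0 < n" for n
  proof -
    have wm[measurable]: "(\<lambda>p. weight m n (snd p) (fst p)) \<in> borel_measurable (sample n \<Otimes>\<^sub>M borel)"
      using measurable_compose[OF measurable_pair_swap' weight_measurable[of m n]] by (simp add: split_beta')
    have "(\<integral>\<^sup>+z. \<integral>\<^sup>+s. ennreal ((H n s z)\<^sup>2) * ennreal (at_risk n s z / S s) \<partial>\<mu> \<partial>sample n)
       = (\<integral>\<^sup>+s. \<integral>\<^sup>+z. ennreal ((H n s z)\<^sup>2) * ennreal (at_risk n s z / S s) \<partial>sample n \<partial>\<mu>)"
      by (rule nn_integral_sample_swap) (unfold H_def, measurable)
    also have "\<dots> = (\<integral>\<^sup>+s. ennreal n * e n s \<partial>\<mu>)"
    proof (rule nn_integral_cong)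
      fix s
      have "(\<integral>\<^sup>+z. ennreal ((H n s z)\<^sup>2) * ennreal (at_risk n s z / S s) \<partial>sample n)
          = (\<integral>\<^sup>+z. ennreal (n * ((psi \<phi> s)\<^sup>2 / S s)) * ennreal ((weight m n s z)\<^sup>2 * (at_risk n s z / n)) \<partial>sample n)"
      proof (rule nn_integral_cong)
        fix z
        have "(H n s z)\<^sup>2 * (at_risk n s z / S s) = n * ((psi \<phi> s)\<^sup>2 / S s) * ((weight m n s z)\<^sup>2 * (at_risk n s z / n))"
          using n by (simp add: H_def power_mult_distrib)
        then show "ennreal ((H n s z)\<^sup>2) * ennreal (at_risk n s z / S s) = ennreal (n * ((psi \<phi> s)\<^sup>2 / S s)) * ennreal ((weight m n s z)\<^sup>2 * (at_risk n s z / n))"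
          by (simp only: ennreal_mult''[symmetric] divide_nonneg_nonneg at_risk_nonneg S_nonneg of_nat_0_le_iff mult_nonneg_nonneg zero_le_power2)
      qed
      also have "\<dots> = ennreal (n * ((psi \<phi> s)\<^sup>2 / S s)) * weight_energy m n s"
        unfolding weight_energy_def by (rule nn_integral_cmult) measurable
      also have "ennreal (n * ((psi \<phi> s)\<^sup>2 / S s)) = ennreal n * ennreal ((psi \<phi> s)\<^sup>2 / S s)"
        by (rule ennreal_mult'') simp
      finally show "(\<integral>\<^sup>+z. ennreal ((H n s z)\<^sup>2) * ennreal (at_risk n s z / S s) \<partial>sample n) = ennreal n * e n s"
        by (simp add: e_def mult.assoc)
    qed
    also have "\<dots> = ennreal n * (\<integral>\<^sup>+s. e n s \<partial>\<mu>)" by (rule nn_integral_cmult) measurable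
    finally show ?thesis .
  qed
  have efin: "(\<integral>\<^sup>+s. e n s \<partial>\<mu>) < \<infinity>" if "0 < n" for n
    using nn_integral_mono_AE[OF ebound[OF that]] wfin by (rule order.strict_trans1)
  have fin: "(\<integral>\<^sup>+z. \<integral>\<^sup>+s. ennreal ((H n s z)\<^sup>2) * ennreal (at_risk n s z / S s) \<partial>\<mu> \<partial>sample n) < \<infinity>"
    if n: "0 < n" for n
    unfolding energy[OF n] using efin[OF n] by (simp add: ennreal_mult_less_top)
  show "AE z in sample n. integrable \<mu> (\<lambda>s. H n s z * (at_risk n s z / S s))" if "0 < n" for n
    by (rule isometry_inequality(1)[OF Hm Hpred fin[OF that]])
  show cm: "comp_sum n (H n) \<in> borel_measurable (sample n)" for n by (rule comp_sum_measurable[OF Hm])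
  have le: "(\<integral>\<^sup>+z. ennreal ((comp_sum n (H n) z)\<^sup>2 / n) \<partial>sample n) \<le> (\<integral>\<^sup>+s. e n s \<partial>\<mu>)" if n: "0 < n" for n
  proof -
    note [measurable] = cm
    have "(\<integral>\<^sup>+z. ennreal ((comp_sum n (H n) z)\<^sup>2 / n) \<partial>sample n) = (\<integral>\<^sup>+z. ennreal (1 / n) * ennreal ((comp_sum n (H n) z)\<^sup>2) \<partial>sample n)"
      by (intro nn_integral_cong) (simp flip: ennreal_mult'')
    also have "\<dots> = ennreal (1 / n) * (\<integral>\<^sup>+z. ennreal ((comp_sum n (H n) z)\<^sup>2) \<partial>sample n)"
      by (rule nn_integral_cmult) measurable
    also have "\<dots> \<le> ennreal (1 / n) * (ennreal n * (\<integral>\<^sup>+s. e n s \<partial>\<mu>))"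
      unfolding energy[OF n, symmetric] by (intro mult_left_mono isometry_inequality(2)[OF Hm Hpred fin[OF n]]) simp
    also have "\<dots> = (\<integral>\<^sup>+s. e n s \<partial>\<mu>)"
      using n by (simp add: mult.assoc[symmetric] flip: ennreal_mult'')
    finally show ?thesis .
  qed
  \<comment> \<open>The bounds need a nonempty sample, hence the shift of the index.\<close>
  have elim0: "(\<lambda>n. \<integral>\<^sup>+s. e (Suc n) s \<partial>\<mu>) \<longlonglongrightarrow> (\<integral>\<^sup>+s. 0 \<partial>\<mu>)"
  proof (rule nn_integral_dominated_convergence[where w="\<lambda>s. ennreal (w s)"])
    show "AE s in \<mu>. (\<lambda>n. e (Suc n) s) \<longlonglongrightarrow> 0"
      using AE_S_pos AE_C_pos
    proof eventually_elim
      case (elim s)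
      have "(\<lambda>n. weight_energy m (Suc n) s) \<longlonglongrightarrow> 0"
        by (rule LIMSEQ_Suc[OF weight_energy_tendsto_0[OF m(2) elim]])
      then have "(\<lambda>n. ennreal ((psi \<phi> s)\<^sup>2 / S s) * weight_energy m (Suc n) s) \<longlonglongrightarrow> ennreal ((psi \<phi> s)\<^sup>2 / S s) * 0"
        by (intro ennreal_tendsto_cmult) auto
      then show ?case by (simp add: e_def)
    qed
    show "AE s in \<mu>. e (Suc n) s \<le> ennreal (w s)" for n by (rule ebound) simp
  qed (use wfin in auto)
  have "(\<lambda>n. \<integral>\<^sup>+z. ennreal ((comp_sum (Suc n) (H (Suc n)) z)\<^sup>2 / Suc n) \<partial>sample (Suc n)) \<longlonglongrightarrow> 0"
    by (rule tendsto_sandwich[OF _ _ tendsto_const]) (use elim0 le in \<open>auto simp del: of_nat_Suc\<close>)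
  then show "(\<lambda>n. \<integral>\<^sup>+z. ennreal ((comp_sum n (H n) z)\<^sup>2 / n) \<partial>sample n) \<longlonglongrightarrow> 0"
    by (rule LIMSEQ_imp_Suc)
qed

text \<open>
The integral of \<open>\<psi> Q\<close> against \<open>\<Lambda>\<close> over the times without anybody at risk. Beyond \<open>m\<close> such times do not contribute
once somebody is at risk at \<open>m\<close>, since then \<open>w\<close> vanishes in every later gap.
\<close>

definition gap_term :: "(real \<Rightarrow> real) \<Rightarrow> real \<Rightarrow> nat \<Rightarrow> (nat \<Rightarrow> real \<times> real) \<Rightarrow> real" where
  "gap_term \<phi> m n z = (LINT s|\<mu>. indicator {..m} s * (psi \<phi> s * (surv n s z / (S s)\<^sup>2)) * (if at_risk n s z = 0 then 1 else 0))"

lemma gap_term_measurable: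
  assumes [measurable]: "\<phi> \<in> borel_measurable borel"
  shows "gap_term \<phi> m n \<in> borel_measurable (sample n)"
  unfolding gap_term_def[abs_def]
  by (rule X.borel_measurable_lebesgue_integral)
     (unfold split_beta' measurable_cong_sets[OF sets_sample_mu refl], measurable)

text \<open>
From \<open>P(N = 0) \<le> min 1 (1 / (n C))\<close> it follows that \<open>sqrt n P(N = 0)\<close> is at most \<open>1 / sqrt C\<close> and tends to \<open>0\<close>. The
function \<open>\<bar>\<psi>\<bar> / sqrt C\<close>, bounded by \<open>1 + \<psi>\<^sup>2 / C\<close>, is the integrable majorant.
\<close>

lemma gap_term_tendsto_0:
  assumes phi[measurable]: "\<phi> \<in> borel_measurable borel" and i: "integrable \<mu> (\<lambda>x. (\<phi> x)\<^sup>2 / G x)"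
    and m: "S m = 1 / 2"
  shows "(\<lambda>n. \<integral>\<^sup>+z. ennreal \<bar>sqrt n * gap_term \<phi> m n z\<bar> \<partial>sample n) \<longlonglongrightarrow> 0"
proof -
  define p where "p n s = (\<integral>\<^sup>+z. ennreal (if at_risk n s z = 0 then 1 else 0) \<partial>sample n)" for n s
  define g where "g n s = ennreal (4 * \<bar>psi \<phi> s\<bar> * indicator {..m} s) * (ennreal (sqrt n) * p n s)" for n s
  have pm[measurable]: "p n \<in> borel_measurable borel" for n
  proof -
    show ?thesis unfolding p_def[abs_def]
      by (rule sample.borel_measurable_nn_integral) (unfold split_beta', measurable)
  qed
  have p1: "p n s \<le> 1" for n s
  proof -
    have "p n s \<le> (\<integral>\<^sup>+z. 1 \<partial>sample n)" unfolding p_def by (intro nn_integral_mono) auto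
    then show ?thesis by (simp add: sample.emeasure_space_1)
  qed
  have S2: "1 / 2 \<le> S s" if "s \<le> m" for s using that S_antimono m by metis
  have le: "(\<integral>\<^sup>+z. ennreal \<bar>sqrt n * gap_term \<phi> m n z\<bar> \<partial>sample n) \<le> (\<integral>\<^sup>+s. g n s \<partial>\<mu>)" for n
  proof -
    let ?f = "\<lambda>s z. indicator {..m} s * (psi \<phi> s * (surv n s z / (S s)\<^sup>2)) * (if at_risk n s z = 0 then 1 else 0)"
    have "(\<integral>\<^sup>+z. ennreal \<bar>sqrt n * gap_term \<phi> m n z\<bar> \<partial>sample n) \<le> (\<integral>\<^sup>+z. \<integral>\<^sup>+s. ennreal (4 * \<bar>psi \<phi> s\<bar> * indicator {..m} s) * (ennreal (sqrt n) * ennreal (if at_risk n s z = 0 then 1 else 0)) \<partial>\<mu> \<partial>sample n)"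
    proof (rule nn_integral_mono)
      fix z assume z: "z \<in> space (sample n)"
      note [measurable] = at_risk_section_measurable[OF z]
      have "ennreal \<bar>gap_term \<phi> m n z\<bar> \<le> (\<integral>\<^sup>+s. ennreal \<bar>?f s z\<bar> \<partial>\<mu>)"
      proof (cases "integrable \<mu> (\<lambda>s. ?f s z)")
        case True
        from integral_norm_bound_ennreal[OF this] show ?thesis by (simp add: gap_term_def)
      qed (simp add: gap_term_def not_integrable_integral_eq)
      then have "ennreal (sqrt n) * ennreal \<bar>gap_term \<phi> m n z\<bar> \<le> ennreal (sqrt n) * (\<integral>\<^sup>+s. ennreal \<bar>?f s z\<bar> \<partial>\<mu>)"
        by (rule mult_left_mono) simp
      also have "\<dots> \<le> ennreal (sqrt n) * (\<integral>\<^sup>+s. ennreal (4 * \<bar>psi \<phi> s\<bar> * indicator {..m} s) * ennreal (if at_risk n s z = 0 then 1 else 0) \<partial>\<mu>)"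
      proof (intro mult_left_mono nn_integral_mono)
        fix s
        have "\<bar>?f s z\<bar> \<le> 4 * \<bar>psi \<phi> s\<bar> * indicator {..m} s * (if at_risk n s z = 0 then 1 else 0)"
        proof (cases "s \<le> m")
          case True
          have "(1 / 2)\<^sup>2 \<le> (S s)\<^sup>2" using S2[OF True] by (intro power_mono) auto
          then have "surv n s z / (S s)\<^sup>2 \<le> 1 / (1 / 2)\<^sup>2" by (intro frac_le) auto
          then have "surv n s z / (S s)\<^sup>2 \<le> 4" by (simp add: power2_eq_square)
          then have "\<bar>psi \<phi> s\<bar> * (surv n s z / (S s)\<^sup>2) \<le> \<bar>psi \<phi> s\<bar> * 4" by (rule mult_left_mono) simp
          then show ?thesis using True by (simp add: abs_mult)
        qed simp
        then show "ennreal \<bar>?f s z\<bar> \<le> ennreal (4 * \<bar>psi \<phi> s\<bar> * indicator {..m} s) * ennreal (if at_risk n s z = 0 then 1 else 0)"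
          by (subst ennreal_mult''[symmetric]) (auto intro: ennreal_leI)
      qed simp
      also have "\<dots> = (\<integral>\<^sup>+s. ennreal (sqrt n) * (ennreal (4 * \<bar>psi \<phi> s\<bar> * indicator {..m} s) * ennreal (if at_risk n s z = 0 then 1 else 0)) \<partial>\<mu>)"
        by (rule nn_integral_cmult[symmetric]) measurable
      also have "\<dots> = (\<integral>\<^sup>+s. ennreal (4 * \<bar>psi \<phi> s\<bar> * indicator {..m} s) * (ennreal (sqrt n) * ennreal (if at_risk n s z = 0 then 1 else 0)) \<partial>\<mu>)"
        by (intro nn_integral_cong mult.left_commute)
      finally show "ennreal \<bar>sqrt n * gap_term \<phi> m n z\<bar> \<le> \<dots>"
        by (simp add: abs_mult ennreal_mult)
    qed
    also have "\<dots> = (\<integral>\<^sup>+s. \<integral>\<^sup>+z. ennreal (4 * \<bar>psi \<phi> s\<bar> * indicator {..m} s) * (ennreal (sqrt n) * ennreal (if at_risk n s z = 0 then 1 else 0)) \<partial>sample n \<partial>\<mu>)"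
      by (rule nn_integral_sample_swap) measurable
    also have "\<dots> = (\<integral>\<^sup>+s. g n s \<partial>\<mu>)"
      unfolding g_def p_def by (intro nn_integral_cong) (simp add: nn_integral_cmult)
    finally show ?thesis .
  qed
  define w where "w s = 4 + 4 * \<alpha> * ((psi \<phi> s)\<^sup>2 / (G s * (S s)\<^sup>2))" for s
  have wint: "integrable \<mu> w"
    unfolding w_def[abs_def] by (intro Bochner_Integration.integrable_add integrable_mult_right psi_square_integrable phi i) simp
  have w_meas[measurable]: "w \<in> borel_measurable borel" unfolding w_def[abs_def] by measurable
  have wfin: "(\<integral>\<^sup>+s. ennreal (w s) \<partial>\<mu>) < \<infinity>"
    by (subst nn_integral_eq_integral[OF wint]) (use alpha_pos in \<open>auto simp: w_def\<close>)
  have pC: "ennreal (sqrt n) * p n s \<le> ennreal (1 / sqrt (C s))" "ennreal (sqrt n) * p n s \<le> ennreal (1 / C s * (1 / sqrt n))"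
    if n: "0 < n" and C: "0 < C s" for n s
  proof -
    have p2: "p n s \<le> ennreal (1 / (n * C s))" unfolding p_def by (rule at_risk_zero_prob[OF n C])
    have sq: "sqrt n * (1 / (n * C s)) = 1 / C s * (1 / sqrt n)"
    proof -
      have "sqrt n / n = 1 / sqrt n" using sqrt_divide_self_eq[of "real n"] by (simp add: inverse_eq_divide)
      moreover have "sqrt n * (1 / (n * C s)) = sqrt n / n * (1 / C s)" by simp
      ultimately show ?thesis by simp
    qed
    show 2: "ennreal (sqrt n) * p n s \<le> ennreal (1 / C s * (1 / sqrt n))"
      unfolding sq[symmetric] using mult_left_mono[OF p2, of "ennreal (sqrt n)"] C by (simp add: ennreal_mult del: times_divide_eq_right)
    have "1 / C s * (1 / sqrt n) \<le> 1 / sqrt (C s)" if "1 \<le> sqrt n * sqrt (C s)"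
    proof -
      have "1 / C s * (1 / sqrt n) = 1 / sqrt (C s) * (1 / (sqrt n * sqrt (C s)))"
        using C by (simp add: real_div_sqrt field_simps)
      also have "\<dots> \<le> 1 / sqrt (C s) * 1" using that C by (intro mult_left_mono) auto
      finally show ?thesis by simp
    qed
    moreover have "ennreal (sqrt n) * p n s \<le> ennreal (1 / sqrt (C s))" if "sqrt n * sqrt (C s) < 1"
    proof -
      have "sqrt n \<le> 1 / sqrt (C s)" using that C by (simp add: field_simps)
      then have "ennreal (sqrt n) * p n s \<le> ennreal (1 / sqrt (C s)) * 1"
        by (intro mult_mono p1 ennreal_leI) auto
      then show ?thesis by simp
    qed
    ultimately show "ennreal (sqrt n) * p n s \<le> ennreal (1 / sqrt (C s))"
      using 2 by (meson ennreal_leI not_le order_trans)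
  qed
  have bound: "AE s in \<mu>. g n s \<le> ennreal (w s)" if n: "0 < n" for n
    using AE_S_pos AE_C_pos AE_G_pos
  proof eventually_elim
    case (elim s)
    have "g n s \<le> ennreal (4 * \<bar>psi \<phi> s\<bar> * indicator {..m} s) * ennreal (1 / sqrt (C s))"
      unfolding g_def by (intro mult_left_mono pC n elim) simp
    also have "\<dots> = ennreal (4 * \<bar>psi \<phi> s\<bar> * indicator {..m} s * (1 / sqrt (C s)))"
      by (rule ennreal_mult''[symmetric]) simp
    also have "\<dots> \<le> ennreal (w s)"
    proof (rule ennreal_leI)
      have "\<bar>psi \<phi> s / sqrt (C s)\<bar> \<le> 1 + (psi \<phi> s / sqrt (C s))\<^sup>2" by (rule abs_le_1_plus_square)
      also have "(psi \<phi> s / sqrt (C s))\<^sup>2 = \<alpha> * ((psi \<phi> s)\<^sup>2 / (G s * S s))"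
        using elim by (simp add: power_divide C_def)
      also have "\<dots> \<le> \<alpha> * ((psi \<phi> s)\<^sup>2 / (G s * (S s)\<^sup>2))"
      proof (intro mult_left_mono divide_left_mono)
        have "S s * S s \<le> S s * 1" by (intro mult_left_mono) auto
        then show "(S s)\<^sup>2 \<le> S s" by (simp add: power2_eq_square)
      qed (use elim alpha_pos in auto)
      finally have "4 * \<bar>psi \<phi> s / sqrt (C s)\<bar> \<le> w s" by (simp add: w_def)
      moreover have "4 * \<bar>psi \<phi> s\<bar> * indicator {..m} s * (1 / sqrt (C s)) \<le> 4 * \<bar>psi \<phi> s / sqrt (C s)\<bar>"
        by (auto simp: indicator_def)
      ultimately show "4 * \<bar>psi \<phi> s\<bar> * indicator {..m} s * (1 / sqrt (C s)) \<le> w s" by linarith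
    qed
    finally show ?case .
  qed
  have lim: "(\<lambda>n. \<integral>\<^sup>+s. g (Suc n) s \<partial>\<mu>) \<longlonglongrightarrow> (\<integral>\<^sup>+s. 0 \<partial>\<mu>)"
  proof (rule nn_integral_dominated_convergence[where w="\<lambda>s. ennreal (w s)"])
    show "AE s in \<mu>. (\<lambda>n. g (Suc n) s) \<longlonglongrightarrow> 0"
      using AE_C_pos
    proof eventually_elim
      case (elim s)
      have "(\<lambda>n. 1 / C s * (1 / sqrt (real n))) \<longlonglongrightarrow> 0" by real_asymp
      then have "(\<lambda>n. 1 / C s * (1 / sqrt (real (Suc n)))) \<longlonglongrightarrow> 0" by (rule LIMSEQ_Suc)
      then have "(\<lambda>n. ennreal (1 / C s * (1 / sqrt (real (Suc n))))) \<longlonglongrightarrow> ennreal 0" by (rule tendsto_ennrealI)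
      then have l: "(\<lambda>n. ennreal (1 / C s * (1 / sqrt (real (Suc n))))) \<longlonglongrightarrow> 0" by simp
      have "(\<lambda>n. ennreal (sqrt (Suc n)) * p (Suc n) s) \<longlonglongrightarrow> 0"
        by (rule tendsto_sandwich[OF _ _ tendsto_const l]) (use pC(2)[OF _ elim] in \<open>auto simp del: of_nat_Suc\<close>)
      then have "(\<lambda>n. ennreal (4 * \<bar>psi \<phi> s\<bar> * indicator {..m} s) * (ennreal (sqrt (Suc n)) * p (Suc n) s)) \<longlonglongrightarrow> ennreal (4 * \<bar>psi \<phi> s\<bar> * indicator {..m} s) * 0"
        by (intro ennreal_tendsto_cmult) auto
      then show ?case by (simp add: g_def)
    qed
    show "AE s in \<mu>. g (Suc n) s \<le> ennreal (w s)" for n by (rule bound) simp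
    show "g (Suc n) \<in> borel_measurable \<mu>" for n unfolding g_def[abs_def] by measurable
  qed (use wfin in auto)
  have "(\<lambda>n. \<integral>\<^sup>+z. ennreal \<bar>sqrt (Suc n) * gap_term \<phi> m (Suc n) z\<bar> \<partial>sample (Suc n)) \<longlonglongrightarrow> 0"
    by (rule tendsto_sandwich[OF _ _ tendsto_const]) (use lim le in \<open>auto simp del: of_nat_Suc\<close>)
  then show ?thesis by (rule LIMSEQ_imp_Suc)
qed

lemma remainder_decomposition:
  assumes phi[measurable]: "\<phi> \<in> borel_measurable borel" and i: "integrable \<mu> (\<lambda>x. (\<phi> x)\<^sup>2 / G x)"
    and m: "S m = 1 / 2" "0 < C m" and n: "0 < n"
  shows "AE z in sample n. at_risk n m z \<noteq> 0 \<longrightarrow>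
    remainder \<phi> n z = comp_sum n (\<lambda>s z. psi \<phi> s * weight m n s z) z / n - gap_term \<phi> m n z"
  using martingale_part_tendsto_0(1)[OF phi i m n] AE_sample_distinct AE_sample_truncated AE_sample_S_pos AE_space
proof eventually_elim
  case (elim z)
  note phi_int = integrable_phi_square(2)[OF phi i]
  show ?case
  proof
    assume A: "at_risk n m z \<noteq> 0"
    note id = lynden_bell_identity[OF elim(5,2,3) n elim(4) phi phi_int]
    note [measurable] = at_risk_section_measurable[OF elim(5)]
    define f where "f s = psi \<phi> s * (surv n s z / (S s)\<^sup>2)" for s
    define v where "v s = (if at_risk n s z = 0 then 1 else 0 :: real)" for s
    have [measurable]: "v \<in> borel_measurable borel" unfolding v_def[abs_def] by measurable
    have fi: "integrable \<mu> f" using id(1) unfolding f_def .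
    have fm[measurable]: "f \<in> borel_measurable borel"
      using surv_section_measurable[OF elim(5)] unfolding f_def[abs_def] by measurable
    have fvi: "integrable \<mu> (\<lambda>s. f s * v s)"
      by (rule Bochner_Integration.integrable_bound[OF fi]) (auto simp: v_def)
    have psiS: "integrable \<mu> (\<lambda>s. psi \<phi> s / S s)"
    proof (rule Bochner_Integration.integrable_bound)
      show "integrable \<mu> (\<lambda>s. 1 + (psi \<phi> s)\<^sup>2 / (G s * (S s)\<^sup>2))"
        by (intro Bochner_Integration.integrable_add psi_square_integrable phi i) simp
      show "AE s in \<mu>. norm (psi \<phi> s / S s) \<le> norm (1 + (psi \<phi> s)\<^sup>2 / (G s * (S s)\<^sup>2))"
        using AE_S_pos AE_G_pos
      proof eventually_elim
        case (elim s)
        have "\<bar>psi \<phi> s / S s\<bar> \<le> 1 + (psi \<phi> s / S s)\<^sup>2" by (rule abs_le_1_plus_square)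
        also have "(psi \<phi> s / S s)\<^sup>2 = (psi \<phi> s)\<^sup>2 / (S s)\<^sup>2" by (rule power_divide)
        also have "\<dots> \<le> (psi \<phi> s)\<^sup>2 / (G s * (S s)\<^sup>2)"
          using elim by (intro divide_left_mono mult_left_le_one_le) auto
        finally show ?case using elim by simp
      qed
    qed measurable
    define g where "g s = at_risk n s z * psi \<phi> s / (C s * S s)" for s
    have [measurable]: "g \<in> borel_measurable borel" unfolding g_def[abs_def] by measurable
    have Hw: "psi \<phi> s * weight m n s z * (at_risk n s z / S s) = n * (f s - f s * v s) - g s" if "0 < S s" for s
      using that A by (auto simp: weight_def f_def v_def g_def right_diff_distrib left_diff_distrib power2_eq_square diff_divide_distrib mult_ac)
    have gi: "integrable \<mu> g"
    proof -
      have "integrable \<mu> (\<lambda>s. n * (f s - f s * v s) - psi \<phi> s * weight m n s z * (at_risk n s z / S s))"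
        by (intro Bochner_Integration.integrable_diff integrable_mult_right fi fvi elim(1))
      then show ?thesis
      proof (rule integrable_cong_AE_imp)
        show "AE s in \<mu>. n * (f s - f s * v s) - psi \<phi> s * weight m n s z * (at_risk n s z / S s) = g s"
          using AE_S_pos
        proof eventually_elim
          case (elim s)
          show ?case using Hw[OF elim] by linarith
        qed
      qed measurable
    qed
    have I1: "(LINT s|\<mu>. psi \<phi> s * weight m n s z * (at_risk n s z / S s)) = n * ((LINT s|\<mu>. f s) - (LINT s|\<mu>. f s * v s)) - (LINT s|\<mu>. g s)"
    proof -
      have "(LINT s|\<mu>. psi \<phi> s * weight m n s z * (at_risk n s z / S s)) = (LINT s|\<mu>. n * (f s - f s * v s) - g s)"
      proof (rule integral_cong_AE)
        show "AE s in \<mu>. psi \<phi> s * weight m n s z * (at_risk n s z / S s) = n * (f s - f s * v s) - g s"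
          using AE_S_pos by eventually_elim (rule Hw)
        show "(\<lambda>s. psi \<phi> s * weight m n s z * (at_risk n s z / S s)) \<in> borel_measurable \<mu>"
          by (rule borel_measurable_integrable[OF elim(1)])
      qed measurable
      also have "\<dots> = (LINT s|\<mu>. n * (f s - f s * v s)) - (LINT s|\<mu>. g s)"
        by (intro Bochner_Integration.integral_diff integrable_mult_right Bochner_Integration.integrable_diff fi fvi gi)
      also have "(LINT s|\<mu>. n * (f s - f s * v s)) = n * (LINT s|\<mu>. f s - f s * v s)" by (rule integral_mult_right_zero)
      also have "(LINT s|\<mu>. f s - f s * v s) = (LINT s|\<mu>. f s) - (LINT s|\<mu>. f s * v s)"
        by (rule Bochner_Integration.integral_diff[OF fi fvi])
      finally show ?thesis .
    qed
    have I2: "(LINT s|\<mu>. (at_risk n s z / n - C s) * psi \<phi> s / (C s * S s)) = (LINT s|\<mu>. g s) / n - (LINT s|\<mu>. psi \<phi> s / S s)"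
    proof -
      have "(LINT s|\<mu>. (at_risk n s z / n - C s) * psi \<phi> s / (C s * S s)) = (LINT s|\<mu>. 1 / n * g s - psi \<phi> s / S s)"
      proof (rule integral_cong_AE)
        show "AE s in \<mu>. (at_risk n s z / n - C s) * psi \<phi> s / (C s * S s) = 1 / n * g s - psi \<phi> s / S s"
          using AE_C_pos by eventually_elim (simp add: g_def left_diff_distrib diff_divide_distrib)
      qed measurable
      also have "\<dots> = (LINT s|\<mu>. 1 / n * g s) - (LINT s|\<mu>. psi \<phi> s / S s)"
        by (intro Bochner_Integration.integral_diff integrable_mult_right gi psiS)
      also have "(LINT s|\<mu>. 1 / n * g s) = 1 / n * (LINT s|\<mu>. g s)" by (rule integral_mult_right_zero)
      finally show ?thesis by simp
    qed
    have "\<exists>k<n. snd (z k) \<le> m"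
    proof (rule ccontr)
      assume "\<not> (\<exists>k<n. snd (z k) \<le> m)"
      then have "at_risk n m z = 0" unfolding at_risk_def by (intro sum.neutral) auto
      then show False using A by simp
    qed
    then obtain k where k: "k < n" "snd (z k) \<le> m" by blast
    have gap: "gap_term \<phi> m n z = (LINT s|\<mu>. f s * v s)"
      unfolding gap_term_def
    proof (rule Bochner_Integration.integral_cong[OF refl])
      fix s
      have "surv n s z = 0" if "m < s" "at_risk n s z = 0"
        by (rule surv_eq_0_of_gap[OF elim(2,3) k(1) _ that(2)]) (use k that in simp)
      then show "indicator {..m} s * (psi \<phi> s * (surv n s z / (S s)\<^sup>2)) * (if at_risk n s z = 0 then 1 else 0) = f s * v s"
        by (auto simp: f_def v_def indicator_def)
    qed
    define a where "a = (\<Sum>i<n. psi \<phi> (fst (z i)) * (surv n (fst (z i)) z / at_risk n (fst (z i)) z / S (fst (z i))))"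
    define b where "b = (\<Sum>i<n. psi \<phi> (fst (z i)) / C (fst (z i)))"
    have "(\<Sum>i<n. psi \<phi> (fst (z i)) * weight m n (fst (z i)) z) = n * a - b"
      unfolding a_def b_def sum_distrib_left sum_subtractf[symmetric]
      by (rule sum.cong) (use A in \<open>auto simp: weight_def right_diff_distrib mult_ac\<close>)
    then have "comp_sum n (\<lambda>s z. psi \<phi> s * weight m n s z) z = n * a - b - (n * ((LINT s|\<mu>. f s) - (LINT s|\<mu>. f s * v s)) - (LINT s|\<mu>. g s))"
      unfolding comp_sum_def I1 by simp
    also have "\<dots> / n = a - b / n - (LINT s|\<mu>. f s) + (LINT s|\<mu>. f s * v s) + (LINT s|\<mu>. g s) / n"
      using n by (simp add: field_simps)
    finally have 1: "comp_sum n (\<lambda>s z. psi \<phi> s * weight m n s z) z / n = \<dots>" .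
    have "remainder \<phi> n z = a - (LINT s|\<mu>. f s) - (b / n - (LINT s|\<mu>. psi \<phi> s / S s) - ((LINT s|\<mu>. g s) / n - (LINT s|\<mu>. psi \<phi> s / S s)))"
      unfolding remainder_def id(2) I2 a_def b_def f_def by simp
    then show "remainder \<phi> n z = comp_sum n (\<lambda>s z. psi \<phi> s * weight m n s z) z / n - gap_term \<phi> m n z"
      unfolding 1 gap by simp
  qed
qed

lemma remainder_measurable:
  assumes phi[measurable]: "\<phi> \<in> borel_measurable borel"
  shows "remainder \<phi> n \<in> borel_measurable (sample n)"
proof -
  have 1: "(\<lambda>z. \<phi> (fst (z i)) * (surv n (fst (z i)) z / at_risk n (fst (z i)) z)) \<in> borel_measurable (sample n)" if "i < n" for i
    by (rule measurable_at_observation[where M'=borel and H="\<lambda>t z. \<phi> t * (surv n t z / at_risk n t z)"])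
       (use that in \<open>auto simp: split_beta'\<close>)
  have 2: "(\<lambda>z. psi \<phi> (fst (z i)) / C (fst (z i))) \<in> borel_measurable (sample n)" if "i < n" for i
    using fst_component_measurable[OF that] by measurable
  have 3: "(\<lambda>z. LINT s|\<mu>. (at_risk n s z / n - C s) * psi \<phi> s / (C s * S s)) \<in> borel_measurable (sample n)"
    by (rule X.borel_measurable_lebesgue_integral)
       (unfold split_beta' measurable_cong_sets[OF sets_sample_mu refl], measurable)
  show ?thesis unfolding remainder_def[abs_def]
    by (intro borel_measurable_diff borel_measurable_times borel_measurable_const borel_measurable_sum 1 2 3) auto
qed

theorem remainder_small:
  assumes phi: "\<phi> \<in> borel_measurable borel" and i: "integrable \<mu> (\<lambda>x. (\<phi> x)\<^sup>2 / G x)" and e: "0 < \<epsilon>"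
  shows "(\<lambda>n. sample.prob n {z \<in> space (sample n). \<epsilon> < \<bar>sqrt n * remainder \<phi> n z\<bar>}) \<longlonglongrightarrow> 0"
proof -
  obtain m where m: "S m = 1 / 2" "0 < G m" by (rule median_exists)
  then have Cm: "0 < C m" by (intro C_pos) auto
  define H where "H n = (\<lambda>s z. psi \<phi> s * weight m n s z)" for n
  note mart = martingale_part_tendsto_0[OF phi i m(1) Cm, folded H_def]
  note [measurable] = mart(2) gap_term_measurable[OF phi] remainder_measurable[OF phi]
  define r where "r n = ennreal (1 / (n * C m)) + ennreal (4 / \<epsilon>\<^sup>2) * (\<integral>\<^sup>+z. ennreal ((comp_sum n (H n) z)\<^sup>2 / n) \<partial>sample n)
     + ennreal (2 / \<epsilon>) * (\<integral>\<^sup>+z. ennreal \<bar>sqrt n * gap_term \<phi> m n z\<bar> \<partial>sample n)" for n :: nat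
  have bound: "ennreal (sample.prob n {z \<in> space (sample n). \<epsilon> < \<bar>sqrt n * remainder \<phi> n z\<bar>}) \<le> r n" if n: "0 < n" for n
  proof -
    let ?E = "{z \<in> space (sample n). \<epsilon> < \<bar>sqrt n * remainder \<phi> n z\<bar>}"
    have "ennreal (sample.prob n ?E) = (\<integral>\<^sup>+z. indicator ?E z \<partial>sample n)"
      by (simp add: sample.emeasure_eq_measure)
    also have "\<dots> \<le> (\<integral>\<^sup>+z. ennreal (if at_risk n m z = 0 then 1 else 0) + ennreal (4 / \<epsilon>\<^sup>2) * ennreal ((comp_sum n (H n) z)\<^sup>2 / n) + ennreal (2 / \<epsilon>) * ennreal \<bar>sqrt n * gap_term \<phi> m n z\<bar> \<partial>sample n)"
    proof (rule nn_integral_mono_AE, use remainder_decomposition[OF phi i m(1) Cm n] in eventually_elim)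
      case (elim z)
      define x where "x = comp_sum n (H n) z / sqrt n"
      define y where "y = sqrt n * gap_term \<phi> m n z"
      have x2: "(comp_sum n (H n) z)\<^sup>2 / n = x\<^sup>2" by (simp add: x_def power_divide)
      have "indicator ?E z \<le> (if at_risk n m z = 0 then 1 else 0) + 4 / \<epsilon>\<^sup>2 * x\<^sup>2 + 2 / \<epsilon> * \<bar>y\<bar>"
      proof (cases "at_risk n m z = 0 \<or> \<not> \<epsilon> < \<bar>sqrt n * remainder \<phi> n z\<bar>")
        case True
        then show ?thesis using e by (auto simp: indicator_def)
      next
        case False
        then have "remainder \<phi> n z = comp_sum n (H n) z / n - gap_term \<phi> m n z"
          using elim by (simp add: H_def)
        then have "sqrt n * remainder \<phi> n z = sqrt n / n * comp_sum n (H n) z - y"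
          by (simp add: y_def right_diff_distrib)
        also have "sqrt n / n = 1 / sqrt n" using sqrt_divide_self_eq[of "real n"] by (simp add: inverse_eq_divide)
        finally have "sqrt n * remainder \<phi> n z = x - y" by (simp add: x_def)
        then have "\<epsilon> / 2 \<le> \<bar>x\<bar> \<or> \<epsilon> / 2 \<le> \<bar>y\<bar>" using False by linarith
        then have "1 \<le> 4 / \<epsilon>\<^sup>2 * x\<^sup>2 + 2 / \<epsilon> * \<bar>y\<bar>"
        proof
          assume "\<epsilon> / 2 \<le> \<bar>x\<bar>"
          then have "(\<epsilon> / 2)\<^sup>2 \<le> \<bar>x\<bar>\<^sup>2" using e by (intro power_mono) auto
          then have "4 / \<epsilon>\<^sup>2 * (\<epsilon> / 2)\<^sup>2 \<le> 4 / \<epsilon>\<^sup>2 * x\<^sup>2" by (intro mult_left_mono) auto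
          moreover have "4 / \<epsilon>\<^sup>2 * (\<epsilon> / 2)\<^sup>2 = 1" using e by (simp add: power_divide)
          moreover have "0 \<le> 2 / \<epsilon> * \<bar>y\<bar>" using e by simp
          ultimately show ?thesis by linarith
        next
          assume "\<epsilon> / 2 \<le> \<bar>y\<bar>"
          then have "2 / \<epsilon> * (\<epsilon> / 2) \<le> 2 / \<epsilon> * \<bar>y\<bar>" using e by (intro mult_left_mono) auto
          moreover have "2 / \<epsilon> * (\<epsilon> / 2) = 1" using e by simp
          moreover have "0 \<le> 4 / \<epsilon>\<^sup>2 * x\<^sup>2" by simp
          ultimately show ?thesis by linarith
        qed
        then show ?thesis by (auto simp: indicator_def)
      qed
      then have "ennreal (indicator ?E z) \<le> ennreal ((if at_risk n m z = 0 then 1 else 0) + 4 / \<epsilon>\<^sup>2 * x\<^sup>2 + 2 / \<epsilon> * \<bar>y\<bar>)"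
        by (rule ennreal_leI)
      also have "\<dots> = ennreal (if at_risk n m z = 0 then 1 else 0) + ennreal (4 / \<epsilon>\<^sup>2 * x\<^sup>2) + ennreal (2 / \<epsilon> * \<bar>y\<bar>)"
        using e by (subst ennreal_plus[symmetric], auto)+
      also have "\<dots> = ennreal (if at_risk n m z = 0 then 1 else 0) + ennreal (4 / \<epsilon>\<^sup>2) * ennreal (x\<^sup>2) + ennreal (2 / \<epsilon>) * ennreal \<bar>y\<bar>"
        by (simp only: ennreal_mult'' zero_le_power2 abs_ge_zero)
      finally show ?case unfolding x2 y_def ennreal_indicator .
    qed
    also have "\<dots> = (\<integral>\<^sup>+z. ennreal (if at_risk n m z = 0 then 1 else 0) \<partial>sample n) + ennreal (4 / \<epsilon>\<^sup>2) * (\<integral>\<^sup>+z. ennreal ((comp_sum n (H n) z)\<^sup>2 / n) \<partial>sample n)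
       + ennreal (2 / \<epsilon>) * (\<integral>\<^sup>+z. ennreal \<bar>sqrt n * gap_term \<phi> m n z\<bar> \<partial>sample n)"
      by (subst nn_integral_add, measurable, subst nn_integral_add, measurable) (simp add: nn_integral_cmult)
    also have "\<dots> \<le> r n"
      unfolding r_def by (intro add_mono order_refl at_risk_zero_prob n Cm)
    finally show ?thesis .
  qed
  have "r \<longlonglongrightarrow> ennreal 0 + ennreal (4 / \<epsilon>\<^sup>2) * 0 + ennreal (2 / \<epsilon>) * 0"
    unfolding r_def[abs_def]
  proof (intro tendsto_add ennreal_tendsto_cmult mart(3) gap_term_tendsto_0[OF phi i m(1)] tendsto_ennrealI)
    show "(\<lambda>n. 1 / (real n * C m)) \<longlonglongrightarrow> 0" using Cm by real_asymp
  qed auto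
  then have r: "r \<longlonglongrightarrow> 0" by simp
  have "(\<lambda>n. ennreal (sample.prob n {z \<in> space (sample n). \<epsilon> < \<bar>sqrt n * remainder \<phi> n z\<bar>})) \<longlonglongrightarrow> 0"
    by (rule tendsto_sandwich[OF _ _ tendsto_const r]) (auto intro!: eventually_sequentiallyI[of 1] bound)
  then have "(\<lambda>n. ennreal (sample.prob n {z \<in> space (sample n). \<epsilon> < \<bar>sqrt n * remainder \<phi> n z\<bar>})) \<longlonglongrightarrow> ennreal 0" by simp
  then show ?thesis by (subst (asm) tendsto_ennreal_iff) auto
qed

end

section \<open>The estimator as a function of the sample\<close>

text \<open>
Sums and products over the distinct observed values become sums and products over the indices at which a value
occurs first. In this form the estimator is visibly measurable even where observations are tied, and
the condition is void if they are distinct.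
\<close>

lemma sum_image_first_occurrence:
  fixes f :: "'a \<Rightarrow> real"
  shows "(\<Sum>u\<in>x ` {..<n::nat}. f u) = (\<Sum>i<n. if \<forall>j<i. x j \<noteq> x i then f (x i) else 0)"
    and "(\<Prod>u\<in>x ` {..<n}. f u) = (\<Prod>i<n. if \<forall>j<i. x j \<noteq> x i then f (x i) else 1)"
proof -
  let ?I = "{i\<in>{..<n}. \<forall>j<i. x j \<noteq> x i}"
  have inj: "inj_on x ?I"
  proof (rule inj_onI)
    fix i k assume "i \<in> ?I" "k \<in> ?I" "x i = x k"
    then show "i = k" by (cases i k rule: linorder_cases) force+
  qed
  have img: "x ` {..<n} = x ` ?I"
  proof (intro equalityI subsetI)
    fix u assume "u \<in> x ` {..<n}"
    then obtain i where i: "i < n" "x i = u" by auto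
    define k where "k = (LEAST k. x k = u)"
    have "x k = u" unfolding k_def using i(2) by (rule LeastI)
    moreover have "k \<le> i" unfolding k_def using i(2) by (rule Least_le)
    moreover have "x j \<noteq> u" if "j < k" for j using not_less_Least[of j "\<lambda>k. x k = u"] that unfolding k_def by blast
    ultimately show "u \<in> x ` ?I" using i(1) by (intro image_eqI[of _ _ k]) auto
  qed auto
  show "(\<Sum>u\<in>x ` {..<n}. f u) = (\<Sum>i<n. if \<forall>j<i. x j \<noteq> x i then f (x i) else 0)"
    unfolding img by (subst sum.reindex[OF inj]) (simp only: sum.inter_filter[OF finite_lessThan] o_def)
  show "(\<Prod>u\<in>x ` {..<n}. f u) = (\<Prod>i<n. if \<forall>j<i. x j \<noteq> x i then f (x i) else 1)"
    unfolding img by (subst prod.reindex[OF inj]) (simp only: prod.inter_filter[OF finite_lessThan] o_def)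
qed

lemma tendsto_step_at_left:
  fixes a u :: real
  shows "((\<lambda>z. if a \<le> z then b else c) \<longlongrightarrow> (if a < u then b else c :: real)) (at_left u)"
proof (rule tendsto_eventually)
  show "eventually (\<lambda>z. (if a \<le> z then b else c) = (if a < u then b else c)) (at_left u)"
  proof (cases "a < u")
    case True
    show ?thesis by (rule eventually_at_leftI[of a]) (use True in auto)
  next
    case False
    show ?thesis by (rule eventually_at_leftI[of "u - 1"]) (use False in auto)
  qed
qed

lemma jump_emp_F: "jump (emp_F n x) u = (1 / n) * (\<Sum>i<n. if x i = u then 1 else 0)"
proof -
  have "((\<lambda>z. (1 / n) * (\<Sum>i<n. if x i \<le> z then 1 else 0)) \<longlongrightarrow> (1 / n) * (\<Sum>i<n. if x i < u then 1 else 0)) (at_left u)"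
    by (intro tendsto_intros tendsto_step_at_left)
  then have "Lim (at_left u) (emp_F n x) = (1 / n) * (\<Sum>i<n. if x i < u then 1 else 0)"
    unfolding emp_F_def[abs_def] of_bool_def by (rule tendsto_Lim[rotated]) simp
  then have "jump (emp_F n x) u = (1 / n) * (\<Sum>i<n. (if x i \<le> u then 1 else 0) - (if x i < u then 1 else 0))"
    unfolding jump_def emp_F_def of_bool_def sum_subtractf by (simp only: right_diff_distrib)
  also have "(\<Sum>i<n. (if x i \<le> u then 1 else 0) - (if x i < u then 1 else (0::real))) = (\<Sum>i<n. if x i = u then 1 else 0)"
    by (rule sum.cong) auto
  finally show ?thesis .
qed

lemma jump_lynden_bell:
  fixes x y :: "nat \<Rightarrow> real"
  assumes "u \<in> x ` {..<n}"
  defines "q \<equiv> \<lambda>v. jump (emp_F n x) v / emp_C n x y v"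
  shows "jump (lynden_bell n x y) u = q u * (\<Prod>v\<in>x ` {..<n}. if v < u then 1 - q v else 1)"
proof -
  let ?X = "x ` {..<n}"
  have lb: "lynden_bell n x y z = 1 - (\<Prod>v\<in>?X. if v \<le> z then 1 - q v else 1)" for z
    unfolding lynden_bell_def q_def by (subst prod.inter_filter) auto
  have "((\<lambda>z. 1 - (\<Prod>v\<in>?X. if v \<le> z then 1 - q v else 1)) \<longlongrightarrow> 1 - (\<Prod>v\<in>?X. if v < u then 1 - q v else 1)) (at_left u)"
    by (intro tendsto_intros tendsto_prod tendsto_step_at_left)
  then have "Lim (at_left u) (lynden_bell n x y) = 1 - (\<Prod>v\<in>?X. if v < u then 1 - q v else 1)"
    unfolding lb[abs_def] by (rule tendsto_Lim[rotated]) simp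
  moreover have "(\<Prod>v\<in>?X. if v \<le> u then 1 - q v else 1) = (1 - q u) * (\<Prod>v\<in>?X. if v < u then 1 - q v else 1)"
  proof -
    have "(\<Prod>v\<in>?X. if v \<le> u then 1 - q v else 1) = (1 - q u) * (\<Prod>v\<in>?X - {u}. if v \<le> u then 1 - q v else 1)"
      using assms(1) by (subst prod.remove[of _ u]) auto
    also have "(\<Prod>v\<in>?X - {u}. if v \<le> u then 1 - q v else 1) = (\<Prod>v\<in>?X - {u}. if v < u then 1 - q v else 1)"
      by (rule prod.cong) auto
    also have "\<dots> = (\<Prod>v\<in>?X. if v < u then 1 - q v else 1)"
      using assms(1) by (subst (2) prod.remove[of _ u]) auto
    finally show ?thesis .
  qed
  ultimately show ?thesis unfolding jump_def lb by (simp add: algebra_simps)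
qed

text \<open>
The jump of the empirical distribution function at \<open>v\<close> divided by \<open>C\<^sub>n(v)\<close>, in terms of counts.
\<close>

definition hazard_jump :: "nat \<Rightarrow> (nat \<Rightarrow> real) \<Rightarrow> (nat \<Rightarrow> real) \<Rightarrow> real \<Rightarrow> real" where
  "hazard_jump n x y v = (1 / n * (\<Sum>i<n. if x i = v then 1 else 0)) / (1 / n * (\<Sum>i<n. if y i \<le> v \<and> v \<le> x i then 1 else 0))"

lemma lynden_bell_integral_index:
  "lynden_bell_integral n x y \<phi> = (\<Sum>i<n. if \<forall>j<i. x j \<noteq> x i then \<phi> (x i) * (hazard_jump n x y (x i)
     * (\<Prod>j<n. if \<forall>k<j. x k \<noteq> x j then (if x j < x i then 1 - hazard_jump n x y (x j) else 1) else 1)) else 0)"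
proof -
  have q: "(\<lambda>v. jump (emp_F n x) v / emp_C n x y v) = hazard_jump n x y"
    by (simp add: fun_eq_iff hazard_jump_def jump_emp_F emp_C_def of_bool_def)
  have "lynden_bell_integral n x y \<phi> = (\<Sum>u\<in>x ` {..<n}. \<phi> u * (hazard_jump n x y u * (\<Prod>v\<in>x ` {..<n}. if v < u then 1 - hazard_jump n x y v else 1)))"
    unfolding lynden_bell_integral_def
    by (rule sum.cong[OF refl], subst jump_lynden_bell[where y=y], simp, simp only: q[symmetric])
  then show ?thesis
    unfolding sum_image_first_occurrence(1)
    unfolding sum_image_first_occurrence(2) .
qed

lemma lynden_bell_integral_distinct:
  assumes n: "0 < n" and inj: "inj_on (\<lambda>i. fst (z i)) {..<n}"
  shows "lynden_bell_integral n (\<lambda>i. fst (z i)) (\<lambda>i. snd (z i)) \<phi>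
    = (\<Sum>i<n. \<phi> (fst (z i)) * (surv n (fst (z i)) z / at_risk n (fst (z i)) z))"
proof -
  have h: "hazard_jump n (\<lambda>i. fst (z i)) (\<lambda>i. snd (z i)) (fst (z i)) = 1 / at_risk n (fst (z i)) z" if "i < n" for i
  proof -
    have "(\<Sum>j<n. if fst (z j) = fst (z i) then 1 else 0) = (\<Sum>j<n. if j = i then 1 else (0::real))"
      by (rule sum.cong) (use inj that in \<open>auto simp: inj_on_def\<close>)
    then show ?thesis using that n by (simp add: hazard_jump_def at_risk_def)
  qed
  have f: "\<forall>j<i. fst (z j) \<noteq> fst (z i)" if "i < n" for i
  proof (intro allI impI notI)
    fix j assume "j < i" "fst (z j) = fst (z i)"
    then have "j = i" using inj_onD[OF inj, of j i] that by simp
    then show False using \<open>j < i\<close> by simp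
  qed
  show ?thesis
    unfolding lynden_bell_integral_index
  proof (rule sum.cong[OF refl])
    fix i assume i: "i \<in> {..<n}"
    have "(\<Prod>j<n. if \<forall>k<j. fst (z k) \<noteq> fst (z j) then (if fst (z j) < fst (z i) then 1 - hazard_jump n (\<lambda>i. fst (z i)) (\<lambda>i. snd (z i)) (fst (z j)) else 1) else 1)
       = surv n (fst (z i)) z"
      unfolding surv_def by (rule prod.cong) (use f h in auto)
    then show "(if \<forall>j<i. fst (z j) \<noteq> fst (z i) then \<phi> (fst (z i)) * (hazard_jump n (\<lambda>i. fst (z i)) (\<lambda>i. snd (z i)) (fst (z i))
     * (\<Prod>j<n. if \<forall>k<j. fst (z k) \<noteq> fst (z j) then (if fst (z j) < fst (z i) then 1 - hazard_jump n (\<lambda>i. fst (z i)) (\<lambda>i. snd (z i)) (fst (z j)) else 1) else 1)) else 0)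
      = \<phi> (fst (z i)) * (surv n (fst (z i)) z / at_risk n (fst (z i)) z)"
      using f[of i] h[of i] i by simp
  qed
qed

lemma lynden_bell_integral_measurable:
  assumes U: "\<And>i. U i \<in> borel_measurable M" and V: "\<And>i. V i \<in> borel_measurable M" and [measurable]: "\<phi> \<in> borel_measurable borel"
  shows "(\<lambda>\<omega>. lynden_bell_integral n (\<lambda>i. U i \<omega>) (\<lambda>i. V i \<omega>) \<phi>) \<in> borel_measurable M"
proof -
  note [measurable] = U V
  have h[measurable]: "(\<lambda>\<omega>. hazard_jump n (\<lambda>i. U i \<omega>) (\<lambda>i. V i \<omega>) (U k \<omega>)) \<in> borel_measurable M" for k
    unfolding hazard_jump_def by measurable
  show ?thesis unfolding lynden_bell_integral_index by measurable
qed

lemma emp_F_eq_rv_cdf: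
  assumes "0 < n"
  shows "emp_F n x = rv_cdf (measure_pmf (pmf_of_set {..<n})) x"
proof
  fix z
  have ne: "{..<n} \<noteq> {}" using assms by auto
  have "rv_cdf (measure_pmf (pmf_of_set {..<n})) x z = measure (measure_pmf (pmf_of_set {..<n})) {i. x i \<le> z}"
    unfolding rv_cdf_def cdf_def by (subst measure_distr) (auto simp: vimage_def)
  also have "\<dots> = real (card ({..<n} \<inter> {i. x i \<le> z})) / n"
    using ne by (subst measure_pmf_of_set) auto
  also have "real (card ({..<n} \<inter> {i. x i \<le> z})) = (\<Sum>i<n. of_bool (x i \<le> z))"
    by (simp add: of_bool_def sum.If_cases)
  finally show "emp_F n x z = rv_cdf (measure_pmf (pmf_of_set {..<n})) x z" by (simp add: emp_F_def)
qed

lemma integral_emp_F: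
  assumes n: "0 < n" and [measurable]: "f \<in> borel_measurable borel"
  shows "(LINT y|interval_measure (emp_F n x). f y) = 1 / n * (\<Sum>i<n. f (x i) :: real)"
proof -
  have ne: "{..<n} \<noteq> {}" using n by auto
  have "interval_measure (emp_F n x) = distr (measure_pmf (pmf_of_set {..<n})) borel x"
    unfolding emp_F_eq_rv_cdf[OF n] by (rule interval_measure_rv_cdf) (auto intro: measure_pmf.prob_space_axioms)
  then have "(LINT y|interval_measure (emp_F n x). f y) = (LINT i|measure_pmf (pmf_of_set {..<n}). f (x i))"
    by (simp add: integral_distr)
  also have "\<dots> = (\<Sum>i<n. f (x i)) / n" using ne by (subst integral_pmf_of_set) auto
  finally show ?thesis by simp
qed

section \<open>Transfer from the statistical model\<close>

text \<open>
By continuity \<open>F\<close> is still positive slightly to the left of \<open>x\<close>. Thus \<open>x\<close> lies strictly above the lower endpoint of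
\<open>F\<close>, hence strictly above that of \<open>G\<close>.
\<close>

lemma positive_beyond_lower_endpoint:
  assumes F: "0 < F x" "isCont F x" and G: "mono G" and le: "lower_endpoint G \<le> lower_endpoint F"
  shows "0 < G (x::real)"
proof -
  have "(F \<longlongrightarrow> F x) (at_left x)" using F(2) by (auto simp: isCont_def intro: filterlim_mono at_le)
  then have "eventually (\<lambda>y. 0 < F y) (at_left x)" using F(1) by (rule order_tendstoD)
  moreover have "eventually (\<lambda>y. y < x) (at_left x)" by (rule eventually_at_leftI[of "x - 1"]) auto
  ultimately have "eventually (\<lambda>y. 0 < F y \<and> y < x) (at_left x)" by eventually_elim auto
  then obtain y where y: "0 < F y" "y < x" using eventually_happens'[OF trivial_limit_at_left_real] by blast
  have "lower_endpoint F \<le> ereal y" unfolding lower_endpoint_def using y by (intro INF_lower) auto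
  then have "lower_endpoint G < ereal x" using le y by (meson ereal_less_eq(3) less_ereal.simps(1) order.strict_trans1 order_trans)
  then obtain w where "0 < G w" "w < x" unfolding lower_endpoint_def by (auto simp: INF_less_iff)
  then show ?thesis using G by (meson less_imp_le monoD order.strict_trans1 order_less_le_trans)
qed

lemma measure_eqI_cdf2:
  fixes A B :: "(real \<times> real) measure"
  assumes A: "prob_space A" "sets A = sets borel" and B: "prob_space B" "sets B = sets borel"
    and eq: "\<And>x y. measure A ({..x} \<times> {..y}) = measure B ({..x} \<times> {..y})"
  shows "A = B"
proof -
  interpret A: prob_space A by fact
  interpret B: prob_space B by fact
  let ?E = "range (\<lambda>p::real\<times>real. {..p})"
  have E: "{..p} = {..fst p} \<times> {..snd p}" for p :: "real \<times> real"
    by (auto simp: less_eq_prod_def)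
  have b: "sets (borel :: (real \<times> real) measure) = sigma_sets UNIV ?E"
    by (subst borel_eq_atMost) simp
  show ?thesis
  proof (rule measure_eqI_generator_eq[where E="?E" and \<Omega>=UNIV and A="\<lambda>i. {..(real i, real i)}"])
    show "Int_stable ?E"
    proof (rule Int_stableI)
      fix a b assume "a \<in> ?E" "b \<in> ?E"
      then obtain p q where "a = {..p}" "b = {..q}" by auto
      then have "a \<inter> b = {..(min (fst p) (fst q), min (snd p) (snd q))}" unfolding E by auto
      then show "a \<inter> b \<in> ?E" by blast
    qed
    show "emeasure A X = emeasure B X" if "X \<in> ?E" for X
      using that eq by (auto simp: E A.emeasure_eq_measure B.emeasure_eq_measure)
    show "(\<Union>i. {..(real i, real i)}) = UNIV"
    proof (intro equalityI subsetI UNIV_I)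
      fix p :: "real \<times> real"
      obtain i :: nat where "max (fst p) (snd p) \<le> real i" using real_arch_simple by blast
      then show "p \<in> (\<Union>i. {..(real i, real i)})" unfolding E by (auto intro!: exI[of _ i] simp: mem_Times_iff)
    qed
    show "sets A = sigma_sets UNIV ?E" "sets B = sigma_sets UNIV ?E" using A(2) B(2) b by auto
  qed auto
qed

lemma interval_measure_cdf:
  assumes "real_distribution D"
  shows "interval_measure (cdf D) = D"
proof -
  interpret D: real_distribution D by fact
  have "interval_measure (rv_cdf D (\<lambda>x. x)) = distr D borel (\<lambda>x. x)"
    by (rule interval_measure_rv_cdf) (auto intro: D.prob_space_axioms)
  moreover have "distr D borel (\<lambda>x. x) = D" by (rule distr_id2) simp
  ultimately show ?thesis by (simp add: rv_cdf_def)
qed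

context truncation_model
begin

text \<open>
The law \<open>F\<^sup>*\<close> of an observed \<open>X\<close> has density \<open>G / \<alpha>\<close> with respect to \<open>F\<close>.
\<close>

lemma observed_X_distribution:
  assumes Fs: "\<And>x. Fs x = 1 / \<alpha> * (LINT z:{..x}|\<mu>. G z)"
  shows "interval_measure Fs = density \<mu> (\<lambda>x. ennreal (G x / \<alpha>))" and "prob_space (interval_measure Fs)"
proof -
  let ?D = "density \<mu> (\<lambda>x. ennreal (G x / \<alpha>))"
  have nn: "(\<integral>\<^sup>+x. ennreal (G x / \<alpha>) * indicator A x \<partial>\<mu>) = ennreal (1 / \<alpha> * (LINT z:A|\<mu>. G z))" if A: "A \<in> sets borel" for A
  proof -
    have int: "integrable \<mu> (\<lambda>z. indicator A z * G z)"
      by (rule integrable_restrict[OF X.integrable_const_bound[where B=1]]) (use A in auto)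
    have "(\<integral>\<^sup>+x. ennreal (G x / \<alpha>) * indicator A x \<partial>\<mu>) = (\<integral>\<^sup>+x. ennreal (1 / \<alpha> * (indicator A x * G x)) \<partial>\<mu>)"
      by (intro nn_integral_cong) (auto simp: indicator_def)
    also have "\<dots> = ennreal (LINT x|\<mu>. 1 / \<alpha> * (indicator A x * G x))"
      by (rule nn_integral_eq_integral[OF integrable_mult_right[OF int]]) (use alpha_pos in auto)
    also have "(LINT x|\<mu>. 1 / \<alpha> * (indicator A x * G x)) = 1 / \<alpha> * (LINT x|\<mu>. indicator A x * G x)"
      by (rule integral_mult_right_zero)
    finally show ?thesis by (simp add: set_lebesgue_integral_def)
  qed
  have em: "emeasure ?D A = ennreal (1 / \<alpha> * (LINT z:A|\<mu>. G z))" if A: "A \<in> sets borel" for A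
    using nn[OF A] A by (subst emeasure_density) auto
  have ps: "prob_space ?D"
    by (rule prob_spaceI) (use em[of UNIV] alpha_pos in \<open>simp add: set_lebesgue_integral_def \<alpha>_def[symmetric]\<close>)
  then have rd: "real_distribution ?D"
    by (simp add: real_distribution_def real_distribution_axioms_def)
  have cdf: "cdf ?D = Fs"
  proof
    fix x
    have "0 \<le> 1 / \<alpha> * (LINT z:{..x}|\<mu>. G z)"
      unfolding set_lebesgue_integral_def using alpha_pos by (intro mult_nonneg_nonneg integral_nonneg_AE AE_I2) auto
    from measure_eq_emeasure_eq_ennreal[OF this em[OF atMost_borel]]
    show "cdf ?D x = Fs x" unfolding Fs cdf_def[of ?D] .
  qed
  show "interval_measure Fs = ?D" using interval_measure_cdf[OF rd] unfolding cdf .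
  then show "prob_space (interval_measure Fs)" using ps by simp
qed

lemma measure_law_atMost:
  "measure law ({..x} \<times> {..y}) = 1 / \<alpha> * (LINT z:{..x}|\<mu>. G (min y z))"
proof -
  have int: "integrable \<mu> (\<lambda>z. indicator {..x} z * G (min y z))"
    by (rule integrable_restrict[OF X.integrable_const_bound[where B=1]]) auto
  have "emeasure law ({..x} \<times> {..y}) = ennreal (1 / \<alpha>) * (\<integral>\<^sup>+z. emeasure \<nu> ({..z} \<inter> {..y}) * indicator {..x} z \<partial>\<mu>)"
    by (rule emeasure_law_Times) auto
  also have "(\<integral>\<^sup>+z. emeasure \<nu> ({..z} \<inter> {..y}) * indicator {..x} z \<partial>\<mu>) = (\<integral>\<^sup>+z. ennreal (indicator {..x} z * G (min y z)) \<partial>\<mu>)"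
  proof (rule nn_integral_cong)
    fix z
    have "{..z} \<inter> {..y} = {..min y z}" by auto
    then show "emeasure \<nu> ({..z} \<inter> {..y}) * indicator {..x} z = ennreal (indicator {..x} z * G (min y z))"
      by (auto simp: indicator_def cdf_def Y.emeasure_eq_measure)
  qed
  also have "\<dots> = ennreal (LINT z|\<mu>. indicator {..x} z * G (min y z))"
    by (rule nn_integral_eq_integral[OF int]) auto
  also have "ennreal (1 / \<alpha>) * \<dots> = ennreal (1 / \<alpha> * (LINT z|\<mu>. indicator {..x} z * G (min y z)))"
    by (rule ennreal_mult''[symmetric]) (intro integral_nonneg_AE AE_I2, simp)
  finally have "measure law ({..x} \<times> {..y}) = 1 / \<alpha> * (LINT z|\<mu>. indicator {..x} z * G (min y z))"
    unfolding measure_def using alpha_pos by (simp add: integral_nonneg_AE)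
  then show ?thesis by (simp add: set_lebesgue_integral_def)
qed

lemma integral_observed_X:
  assumes [measurable]: "f \<in> borel_measurable borel"
  shows "(LINT y|density \<mu> (\<lambda>x. ennreal (G x / \<alpha>)). f y) = (LINT y|\<mu>. G y / \<alpha> * f y :: real)"
  by (subst integral_density) (use alpha_pos in auto)

lemma psi_eq_integral:
  assumes "integrable \<mu> \<phi>"
  shows "psi \<phi> y = (LINT x:{y<..}|\<mu>. \<phi> y - \<phi> x)"
proof -
  have i: "integrable \<mu> (\<lambda>x. indicator {y<..} x * \<phi> y)" by (rule integrable_restrict) auto
  have "(LINT x:{y<..}|\<mu>. \<phi> y - \<phi> x) = (LINT x|\<mu>. indicator {y<..} x * \<phi> y - indicator {y<..} x * \<phi> x)"
    unfolding set_lebesgue_integral_def by (intro Bochner_Integration.integral_cong refl) (simp add: right_diff_distrib)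
  also have "\<dots> = (LINT x|\<mu>. indicator {y<..} x * \<phi> y) - tail \<phi> y"
    unfolding tail_def by (rule Bochner_Integration.integral_diff[OF i integrable_restrict[OF assms]]) simp
  also have "(LINT x|\<mu>. indicator {y<..} x * \<phi> y) = measure \<mu> {y<..} * \<phi> y" by simp
  also have "measure \<mu> {y<..} = S y"
    using X.prob_compl[of "{..y}"] by (simp add: S_def cdf_def Compl_eq_Diff_UNIV[symmetric])
  finally show ?thesis by (simp add: psi_def mult.commute)
qed

lemma lb_psi_eq_psi:
  assumes Fs: "interval_measure Fs = density \<mu> (\<lambda>x. ennreal (G x / \<alpha>))" and [measurable]: "\<phi> \<in> borel_measurable borel"
  shows "lb_psi \<phi> F Fs C = psi \<phi>"
proof
  fix y
  have "(LINT x:{y<..}|interval_measure Fs. \<phi> x * (1 - F x) / C x) = (LINT x|\<mu>. G x / \<alpha> * (indicator {y<..} x * (\<phi> x * S x / C x)))"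
    unfolding Fs set_lebesgue_integral_def by (subst integral_observed_X) (auto simp: S_def)
  also have "\<dots> = tail \<phi> y"
    unfolding tail_def
  proof (rule integral_cong_AE)
    show "AE x in \<mu>. G x / \<alpha> * (indicator {y<..} x * (\<phi> x * S x / C x)) = indicator {y<..} x * \<phi> x"
      using AE_G_pos AE_S_pos by eventually_elim (use alpha_pos in \<open>auto simp: C_def\<close>)
  qed measurable
  finally show "lb_psi \<phi> F Fs C y = psi \<phi> y" unfolding lb_psi_def psi_def S_def by simp
qed

lemma emp_C_eq_at_risk: "emp_C n (\<lambda>i. fst (z i)) (\<lambda>i. snd (z i)) s = at_risk n s z / n"
  unfolding emp_C_def at_risk_def of_bool_def by simp

lemma remainder_eq:
  assumes n: "0 < n" and inj: "inj_on (\<lambda>i. fst (z i)) {..<n}" and z: "z \<in> space (sample n)"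
    and Fs: "interval_measure Fs = density \<mu> (\<lambda>x. ennreal (G x / \<alpha>))" and [measurable]: "\<phi> \<in> borel_measurable borel"
  shows "(lynden_bell_integral n (\<lambda>i. fst (z i)) (\<lambda>i. snd (z i)) \<phi> - (LINT x|\<mu>. \<phi> x))
      - (((LINT y|interval_measure (emp_F n (\<lambda>i. fst (z i))). psi \<phi> y / C y) - (LINT y|interval_measure Fs. psi \<phi> y / C y))
         - (LINT y|interval_measure Fs. (emp_C n (\<lambda>i. fst (z i)) (\<lambda>i. snd (z i)) y - C y) / (C y)\<^sup>2 * psi \<phi> y))
     = remainder \<phi> n z"
proof -
  note [measurable] = at_risk_section_measurable[OF z]
  have 1: "(LINT y|interval_measure Fs. psi \<phi> y / C y) = (LINT s|\<mu>. psi \<phi> s / S s)"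
  proof -
    have "(LINT y|interval_measure Fs. psi \<phi> y / C y) = (LINT y|\<mu>. G y / \<alpha> * (psi \<phi> y / C y))"
      unfolding Fs by (rule integral_observed_X) measurable
    also have "\<dots> = (LINT s|\<mu>. psi \<phi> s / S s)"
    proof (rule integral_cong_AE)
      show "AE y in \<mu>. G y / \<alpha> * (psi \<phi> y / C y) = psi \<phi> y / S y"
        using AE_G_pos AE_S_pos by eventually_elim (use alpha_pos in \<open>auto simp: C_def\<close>)
    qed measurable
    finally show ?thesis .
  qed
  have 2: "(LINT y|interval_measure Fs. (at_risk n y z / n - C y) / (C y)\<^sup>2 * psi \<phi> y) = (LINT s|\<mu>. (at_risk n s z / n - C s) * psi \<phi> s / (C s * S s))"
  proof -
    have "(LINT y|interval_measure Fs. (at_risk n y z / n - C y) / (C y)\<^sup>2 * psi \<phi> y) = (LINT y|\<mu>. G y / \<alpha> * ((at_risk n y z / n - C y) / (C y)\<^sup>2 * psi \<phi> y))"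
      unfolding Fs by (rule integral_observed_X) measurable
    also have "\<dots> = (LINT s|\<mu>. (at_risk n s z / n - C s) * psi \<phi> s / (C s * S s))"
    proof (rule integral_cong_AE)
      show "AE y in \<mu>. G y / \<alpha> * ((at_risk n y z / n - C y) / (C y)\<^sup>2 * psi \<phi> y) = (at_risk n y z / n - C y) * psi \<phi> y / (C y * S y)"
        using AE_S_pos AE_C_pos
      proof eventually_elim
        case (elim y)
        have g: "G y / \<alpha> = C y / S y" using elim by (simp add: C_def)
        show ?case unfolding g using elim by (simp add: power2_eq_square)
      qed
    qed measurable
    finally show ?thesis .
  qed
  show ?thesis
    unfolding remainder_def lynden_bell_integral_distinct[OF n inj] emp_C_eq_at_risk 1 2
    by (subst integral_emp_F[OF n]) auto
qed

end

lemma emp_F_cong: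
  assumes "\<And>i. i < n \<Longrightarrow> x i = x' i"
  shows "emp_F n x = emp_F n x'"
  unfolding emp_F_def[abs_def] using assms by (auto intro!: sum.cong simp: fun_eq_iff)

lemma emp_C_cong:
  assumes "\<And>i. i < n \<Longrightarrow> x i = x' i" "\<And>i. i < n \<Longrightarrow> y i = y' i"
  shows "emp_C n x y = emp_C n x' y'"
  unfolding emp_C_def[abs_def] using assms by (auto intro!: sum.cong simp: fun_eq_iff)

lemma lynden_bell_integral_cong:
  assumes "\<And>i. i < n \<Longrightarrow> x i = x' i" "\<And>i. i < n \<Longrightarrow> y i = y' i"
  shows "lynden_bell_integral n x y \<phi> = lynden_bell_integral n x' y' \<phi>"
proof -
  have "x ` {..<n} = x' ` {..<n}" using assms(1) by (intro image_cong) auto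
  moreover have "emp_F n x = emp_F n x'" by (rule emp_F_cong) (rule assms(1))
  moreover have "emp_C n x y = emp_C n x' y'" by (rule emp_C_cong) (use assms in auto)
  ultimately show ?thesis unfolding lynden_bell_integral_def lynden_bell_def[abs_def] by simp
qed

theorem theorem1p1:
  fixes P :: "'a measure" and X Y :: "'a \<Rightarrow> real"
    and M :: "'b measure" and U V :: "nat \<Rightarrow> 'b \<Rightarrow> real"
    and \<phi> :: "real \<Rightarrow> real"
  defines "F \<equiv> rv_cdf P X" and "G \<equiv> rv_cdf P Y"
    and "Fs \<equiv> trunc_F P X Y" and "C \<equiv> trunc_C P X Y"
  defines "\<psi> \<equiv> lb_psi \<phi> F Fs C"
  assumes model: "prob_space P" "prob_space.indep_var P borel X borel Y" "trunc_alpha P X Y > 0"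
    and data: "prob_space M"
      "prob_space.indep_vars M (\<lambda>_. borel) (\<lambda>i \<omega>. (U i \<omega>, V i \<omega>)) UNIV"
      "\<And>i x y. \<P>(\<omega> in M. U i \<omega> \<le> x \<and> V i \<omega> \<le> y) = trunc_H P X Y x y"
    and phi: "\<phi> \<in> borel_measurable borel"
    and endpoints: "lower_endpoint G \<le> lower_endpoint F" "no_mass_at F (lower_endpoint F)"
    and cont: "continuous_on UNIV F"
    and i: "integrable (interval_measure F) (\<lambda>x. (\<phi> x)\<^sup>2 / G x)"
    and ii: "integrable (interval_measure F) (\<lambda>x. 1 / G x)"
  shows "(\<forall>y. \<psi> y = (LINT x:{y<..}|interval_measure F. \<phi> y - \<phi> x)) \<and>
    is_oP_inv_sqrt M (\<lambda>n \<omega>.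
      let Fn = emp_F n (\<lambda>i. U i \<omega>); Cn = emp_C n (\<lambda>i. U i \<omega>) (\<lambda>i. V i \<omega>) in
      (lynden_bell_integral n (\<lambda>i. U i \<omega>) (\<lambda>i. V i \<omega>) \<phi> - (LINT x|interval_measure F. \<phi> x))
      - (((LINT y|interval_measure Fn. \<psi> y / C y) - (LINT y|interval_measure Fs. \<psi> y / C y))
         - (LINT y|interval_measure Fs. (Cn y - C y) / (C y)\<^sup>2 * \<psi> y)))"
proof -
  interpret P: prob_space P by fact
  interpret M: prob_space M by fact
  have Xm[measurable]: "X \<in> borel_measurable P" and Ym[measurable]: "Y \<in> borel_measurable P"
    using P.indep_var_rv1[OF model(2)] P.indep_var_rv2[OF model(2)] by auto
  define \<mu> where "\<mu> = distr P borel X"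
  define \<nu> where "\<nu> = distr P borel Y"
  have F: "F = cdf \<mu>" and G: "G = cdf \<nu>" by (simp_all add: F_def G_def rv_cdf_def \<mu>_def \<nu>_def)
  have \<mu>: "interval_measure F = \<mu>"
    unfolding F_def \<mu>_def by (rule interval_measure_rv_cdf) (auto intro: model)
  interpret mu: real_distribution \<mu> unfolding \<mu>_def by (rule P.real_distribution_distr) simp
  interpret nu: real_distribution \<nu> unfolding \<nu>_def by (rule P.real_distribution_distr) simp
  have contF: "isCont (cdf \<mu>) x" for x
    using cont unfolding F by (simp add: continuous_on_eq_continuous_at)
  interpret T: truncation_model \<mu> \<nu>
  proof
    show "measure \<mu> {x} = 0" for x using contF[of x] mu.isCont_cdf by simp
    show "0 < cdf \<nu> x" if "0 < cdf \<mu> x" for x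
      using positive_beyond_lower_endpoint[OF that contF[of x], of "cdf \<nu>"] endpoints(1)
      unfolding F G by (auto intro: monoI nu.cdf_nondecreasing)
    show "integrable \<mu> (\<lambda>x. 1 / cdf \<nu> x)" using ii unfolding \<mu> G .
  qed
  have alpha: "trunc_alpha P X Y = T.\<alpha>"
  proof -
    have "trunc_alpha P X Y = \<P>(\<omega> in P. X \<omega> \<in> UNIV \<and> Y \<omega> \<le> X \<omega>)" by (simp add: trunc_alpha_def)
    also have "\<dots> = (LINT z:UNIV|interval_measure (rv_cdf P X). rv_cdf P Y z)"
      by (rule measure_indep_le[OF model(1,2)]) auto
    finally show ?thesis
      unfolding T.\<alpha>_def F_def[symmetric] G_def[symmetric] \<mu> G set_lebesgue_integral_def by simp
  qed
  have C: "C = T.C"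
  proof
    fix z
    have "Lim (at_left z) (cdf \<mu>) = cdf \<mu> z"
      by (rule tendsto_Lim) (use contF[of z] in \<open>auto simp: isCont_def intro: filterlim_mono at_le\<close>)
    then show "C z = T.C z"
      unfolding C_def trunc_C_eq[OF model(1,2)] alpha F_def[symmetric] G_def[symmetric] unfolding F G
      by (simp add: T.C_def T.S_def)
  qed
  have trunc_F: "Fs x = 1 / T.\<alpha> * (LINT z:{..x}|\<mu>. cdf \<nu> z)" for x
    by (simp only: Fs_def trunc_F_eq[OF model(1,2)] alpha F_def[symmetric] \<mu> G_def[symmetric] G)
  have Fs: "interval_measure Fs = density \<mu> (\<lambda>x. ennreal (cdf \<nu> x / T.\<alpha>))"
    by (rule T.observed_X_distribution(1)) (rule trunc_F)
  have psi: "\<psi> = T.psi \<phi>"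
    unfolding \<psi>_def F C by (rule T.lb_psi_eq_psi[OF Fs phi])
  have i': "integrable \<mu> (\<lambda>x. (\<phi> x)\<^sup>2 / cdf \<nu> x)" using i unfolding \<mu> G .
  have part1: "\<psi> y = (LINT x:{y<..}|interval_measure F. \<phi> y - \<phi> x)" for y
    unfolding psi \<mu> by (rule T.psi_eq_integral[OF T.integrable_phi_square(2)[OF phi i']])
  define R where "R n \<omega> = (lynden_bell_integral n (\<lambda>i. U i \<omega>) (\<lambda>i. V i \<omega>) \<phi> - (LINT x|\<mu>. \<phi> x))
      - (((LINT y|interval_measure (emp_F n (\<lambda>i. U i \<omega>)). \<psi> y / C y) - (LINT y|interval_measure Fs. \<psi> y / C y))
         - (LINT y|interval_measure Fs. (emp_C n (\<lambda>i. U i \<omega>) (\<lambda>i. V i \<omega>) y - C y) / (C y)\<^sup>2 * \<psi> y))" for n \<omega>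
  have UVm: "(\<lambda>\<omega>. (U k \<omega>, V k \<omega>)) \<in> M \<rightarrow>\<^sub>M borel" for k
    using data(2) unfolding M.indep_vars_def by auto
  have Um[measurable]: "U k \<in> borel_measurable M" and Vm[measurable]: "V k \<in> borel_measurable M" for k
    using UVm[of k] by (simp_all add: borel_prod[symmetric] measurable_pair_iff comp_def)
  have law: "distr M borel (\<lambda>\<omega>. (U k \<omega>, V k \<omega>)) = T.law" for k
  proof (rule measure_eqI_cdf2)
    show "prob_space (distr M borel (\<lambda>\<omega>. (U k \<omega>, V k \<omega>)))" by (rule M.prob_space_distr[OF UVm])
    show "prob_space T.law" by (rule T.law.prob_space_axioms)
    fix x y
    have "measure (distr M borel (\<lambda>\<omega>. (U k \<omega>, V k \<omega>))) ({..x} \<times> {..y}) = \<P>(\<omega> in M. U k \<omega> \<le> x \<and> V k \<omega> \<le> y)"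
      by (subst measure_distr[OF UVm]) (auto simp: borel_prod[symmetric] intro!: arg_cong[where f="measure M"])
    also have "\<dots> = measure T.law ({..x} \<times> {..y})"
      unfolding data(3) trunc_H_eq[OF model(1,2)] T.measure_law_atMost alpha F_def[symmetric] \<mu> G_def[symmetric] G ..
    finally show "measure (distr M borel (\<lambda>\<omega>. (U k \<omega>, V k \<omega>))) ({..x} \<times> {..y}) = measure T.law ({..x} \<times> {..y})" .
    show "sets T.law = sets borel" unfolding T.sets_law borel_prod ..
  qed simp
  \<comment> \<open>The first \<open>n\<close> observations have the law of the sample space on which the remainder was estimated.\<close>
  define Z where "Z n \<omega> = (\<lambda>i\<in>{..<n}. (U i \<omega>, V i \<omega>))" for n :: nat and \<omega>
  have sets_n: "sets (Pi\<^sub>M {..<n} (\<lambda>_. borel)) = sets (T.sample n)" for n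
    unfolding T.sets_sample borel_prod ..
  have Zm: "Z n \<in> M \<rightarrow>\<^sub>M T.sample n" for n
  proof -
    have "Z n \<in> M \<rightarrow>\<^sub>M Pi\<^sub>M {..<n} (\<lambda>_. borel)"
      unfolding Z_def[abs_def] by (rule measurable_restrict) (rule UVm)
    then show ?thesis by (simp add: measurable_cong_sets[OF refl sets_n])
  qed
  have distr_Z: "distr M (T.sample n) (Z n) = T.sample n" if n: "0 < n" for n
  proof -
    have ne: "{..<n} \<noteq> {}" using n by auto
    have "M.indep_vars (\<lambda>_. borel) (\<lambda>i \<omega>. (U i \<omega>, V i \<omega>)) {..<n}"
      by (rule M.indep_vars_subset[OF data(2)]) auto
    then have "distr M (Pi\<^sub>M {..<n} (\<lambda>_. borel)) (\<lambda>\<omega>. \<lambda>i\<in>{..<n}. (U i \<omega>, V i \<omega>)) = Pi\<^sub>M {..<n} (\<lambda>i. distr M borel (\<lambda>\<omega>. (U i \<omega>, V i \<omega>)))"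
      by (subst (asm) M.indep_vars_iff_distr_eq_PiM'[OF ne]) (auto intro: UVm)
    also have "\<dots> = T.sample n" by (simp add: law T.sample_def)
    also have "distr M (Pi\<^sub>M {..<n} (\<lambda>_. borel)) (\<lambda>\<omega>. \<lambda>i\<in>{..<n}. (U i \<omega>, V i \<omega>)) = distr M (T.sample n) (Z n)"
      by (rule distr_cong[OF refl sets_n]) (simp add: Z_def)
    finally show ?thesis .
  qed
  \<comment> \<open>For \<open>n = 0\<close> the empirical distribution function vanishes, but so does the factor \<open>sqrt n\<close>.\<close>
  have Rm: "(\<lambda>\<omega>. sqrt (real n) * R n \<omega>) \<in> borel_measurable M" for n
  proof (cases "n = 0")
    case False
    then have n: "0 < n" by simp
    have [measurable]: "\<psi> \<in> borel_measurable borel" "C \<in> borel_measurable borel"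
      unfolding psi C by (rule T.psi_measurable[OF phi]) (rule T.C_measurable)
    have 1: "(\<lambda>\<omega>. lynden_bell_integral n (\<lambda>i. U i \<omega>) (\<lambda>i. V i \<omega>) \<phi>) \<in> borel_measurable M"
      by (rule lynden_bell_integral_measurable[OF Um Vm phi])
    have 2: "(\<lambda>\<omega>. LINT y|interval_measure (emp_F n (\<lambda>i. U i \<omega>)). \<psi> y / C y) \<in> borel_measurable M"
      by (subst integral_emp_F[OF n]) measurable
    interpret FS: prob_space "interval_measure Fs"
      by (rule T.observed_X_distribution(2)) (rule trunc_F)
    have sM: "sets (M \<Otimes>\<^sub>M interval_measure Fs) = sets (M \<Otimes>\<^sub>M borel)" by (intro sets_pair_measure_cong) auto
    have 3: "(\<lambda>\<omega>. LINT y|interval_measure Fs. (emp_C n (\<lambda>i. U i \<omega>) (\<lambda>i. V i \<omega>) y - C y) / (C y)\<^sup>2 * \<psi> y) \<in> borel_measurable M"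
      by (rule FS.borel_measurable_lebesgue_integral)
         (unfold split_beta' emp_C_def of_bool_def measurable_cong_sets[OF sM refl], measurable)
    show ?thesis unfolding R_def by (intro borel_measurable_times borel_measurable_diff borel_measurable_const 1 2 3)
  qed simp
  have ae: "AE \<omega> in M. R n \<omega> = T.remainder \<phi> n (Z n \<omega>)" if n: "0 < n" for n
  proof -
    have "AE z in distr M (T.sample n) (Z n). inj_on (\<lambda>i. fst (z i)) {..<n}"
      unfolding distr_Z[OF n] by (rule T.AE_sample_distinct)
    then have "AE \<omega> in M. inj_on (\<lambda>i. fst (Z n \<omega> i)) {..<n}" by (rule AE_distrD[OF Zm])
    then show ?thesis using AE_space
    proof eventually_elim
      case (elim \<omega>)
      have zs: "Z n \<omega> \<in> space (T.sample n)" using measurable_space[OF Zm elim(2)] .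
      have e: "lynden_bell_integral n (\<lambda>i. U i \<omega>) (\<lambda>i. V i \<omega>) \<phi> = lynden_bell_integral n (\<lambda>i. fst (Z n \<omega> i)) (\<lambda>i. snd (Z n \<omega> i)) \<phi>"
        "emp_F n (\<lambda>i. U i \<omega>) = emp_F n (\<lambda>i. fst (Z n \<omega> i))"
        "emp_C n (\<lambda>i. U i \<omega>) (\<lambda>i. V i \<omega>) = emp_C n (\<lambda>i. fst (Z n \<omega> i)) (\<lambda>i. snd (Z n \<omega> i))"
        by (rule lynden_bell_integral_cong emp_F_cong emp_C_cong; simp add: Z_def)+
      show ?case
        unfolding R_def e psi C by (rule T.remainder_eq[OF n elim(1) zs Fs phi])
    qed
  qed
  have lim: "(\<lambda>n. \<P>(\<omega> in M. \<bar>sqrt (real n) * R n \<omega>\<bar> > \<epsilon>)) \<longlonglongrightarrow> 0" if e: "0 < \<epsilon>" for \<epsilon>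
  proof -
    have eq: "\<P>(\<omega> in M. \<bar>sqrt (real n) * R n \<omega>\<bar> > \<epsilon>) = T.sample.prob n {z \<in> space (T.sample n). \<epsilon> < \<bar>sqrt n * T.remainder \<phi> n z\<bar>}"
      if n: "0 < n" for n
    proof -
      let ?E = "{z \<in> space (T.sample n). \<epsilon> < \<bar>sqrt n * T.remainder \<phi> n z\<bar>}"
      note [measurable] = T.remainder_measurable[OF phi] Zm Rm
      have rZ[measurable]: "(\<lambda>\<omega>. T.remainder \<phi> n (Z n \<omega>)) \<in> borel_measurable M"
        using measurable_compose[OF Zm T.remainder_measurable[OF phi]] .
      have "\<P>(\<omega> in M. \<bar>sqrt (real n) * R n \<omega>\<bar> > \<epsilon>) = \<P>(\<omega> in M. \<bar>sqrt (real n) * T.remainder \<phi> n (Z n \<omega>)\<bar> > \<epsilon>)"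
        by (rule M.prob_eq_AE) (use ae[OF n] Rm[of n] in \<open>auto elim!: eventually_mono\<close>)
      also have "\<dots> = measure (distr M (T.sample n) (Z n)) ?E"
        by (subst measure_distr[OF Zm]) (auto intro!: arg_cong[where f="measure M"] dest: measurable_space[OF Zm])
      finally show ?thesis unfolding distr_Z[OF n] .
    qed
    show ?thesis
      by (rule Lim_transform_eventually[OF T.remainder_small[OF phi i' e]])
         (auto intro!: eventually_sequentiallyI[of 1] simp: eq)
  qed
  have "is_oP_inv_sqrt M R"
    unfolding is_oP_inv_sqrt_def tendsto_0_in_prob_def using Rm lim by blast
  then show ?thesis
    using part1 unfolding R_def[abs_def] Let_def \<mu> by blast
qed

end
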